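(* Let $\Sigma$ be a small category and let $\mathcal{B}$ be a $\Sigma$-complete abelian category. Then the following conditions are equivalent: (a) the functor $\lim_{\Sigma}:\mathrm{Fun}(\Sigma,\mathcal{B})\to\mathcal{B}$ is exact; (b) the maps $\Phi^{\Sigma}_{B,F}:\mathrm{Ext}^1_{\mathcal{B}}(B,L_F)\to\mathrm{Ext}^1_{\mathrm{Fun}(\Sigma,\mathcal{B})}(\kappa^{\Sigma}(B),F)$, for $B\in\mathcal{B}$ and $F\in\mathrm{Fun}(\Sigma,\mathcal{B})$, are natural isomorphisms both in $B$ and in $F$; (c) the bifunctors $\mathrm{Ext}^1_{\mathcal{B}}(?,\lim_{\Sigma}(-))$ and $\mathrm{Ext}^1_{\mathrm{Fun}(\Sigma,\mathcal{B})}(\kappa^{\Sigma}(?),-)$ are naturally isomorphic in the obvious way, i.e. via the maps $\Phi^{\Sigma}_{?,-}$.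
   Context: A category is called small when the isomorphism classes of its objects form a set. $\mathrm{Fun}(\Sigma,\mathcal{B})$ is the abelian category of functors $\Sigma\to\mathcal{B}$ with natural transformations (exactness computed objectwise). $\mathcal{B}$ is $\Sigma$-complete if every functor $\Sigma\to\mathcal{B}$ has a limit in $\mathcal{B}$. For $F\in\mathrm{Fun}(\Sigma,\mathcal{B})$ write $L_F:=\lim_{\Sigma}(F)$, with universal natural transformation $\varrho^F:\kappa^{\Sigma}(L_F)\to F$, where $\kappa^{\Sigma}:\mathcal{B}\to\mathrm{Fun}(\Sigma,\mathcal{B})$ is the constant diagram functor ($\kappa^{\Sigma}(B)$ sends every object to $B$ and every morphism to $1_B$), which is exact. For an abelian category $\mathcal{X}$ and $X,Y\in\mathcal{X}$, $\mathrm{Ext}^1_{\mathcal{X}}(X,Y)$ denotes the (possibly "big", i.e. class-sized) Yoneda group of equivalence classes $\overline{\epsilon}$ of short exact sequences $\epsilon:0\to Y\to E\to X\to0$; it is functorial via pullback in the first variable and pushout in the second. Definition of $\Phi$: for a short exact sequence $\epsilon:0\to L_F\to A\to B\to0$ in $\mathcal{B}$, $\Phi^{\Sigma}_{B,F}(\overline{\epsilon})$ is the class of the short exact sequence $0\to F\to G\to\kappa^{\Sigma}(B)\to0$ obtained from $\kappa^{\Sigma}(\epsilon):0\to\kappa^{\Sigma}(L_F)\to\kappa^{\Sigma}(A)\to\kappa^{\Sigma}(B)\to0$ by pushout along $\varrho^F:\kappa^{\Sigma}(L_F)\to F$. *)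

theory Defs
  imports "HOL-Library.FuncSet" "HOL-Algebra.Group"
begin

text \<open>
  A category has a set of objects and a set of arrows in two ambient types. As these are
  arbitrary, every category here is a small one relative to some universe; in particular the
  Yoneda Ext classes below are sets. \<open>g \<cdot> f\<close> means ``first \<open>f\<close>, then \<open>g\<close>'' and is
  meaningful only for composable arrows.
\<close>

section \<open>Categories\<close>

record ('o, 'a) category =
  Obj :: "'o set"
  Arr :: "'a set"
  Src :: "'a \<Rightarrow> 'o"
  Tgt :: "'a \<Rightarrow> 'o"
  Ident :: "'o \<Rightarrow> 'a"
  Comp :: "'a \<Rightarrow> 'a \<Rightarrow> 'a"  (infixl \<open>\<cdot>\<index>\<close> 70)

definition Hom :: "('o, 'a, 'z) category_scheme \<Rightarrow> 'o \<Rightarrow> 'o \<Rightarrow> 'a set" where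
  "Hom C x y = {f \<in> Arr C. Src C f = x \<and> Tgt C f = y}"

locale category =
  fixes C (structure)
  assumes Src_in_Obj: "f \<in> Arr C \<Longrightarrow> Src C f \<in> Obj C"
    and Tgt_in_Obj: "f \<in> Arr C \<Longrightarrow> Tgt C f \<in> Obj C"
    and Ident_in_Hom: "x \<in> Obj C \<Longrightarrow> Ident C x \<in> Hom C x x"
    and Comp_in_Hom: "f \<in> Hom C x y \<Longrightarrow> g \<in> Hom C y z \<Longrightarrow> g \<cdot> f \<in> Hom C x z"
    and Comp_Ident_right: "f \<in> Hom C x y \<Longrightarrow> f \<cdot> Ident C x = f"
    and Comp_Ident_left: "f \<in> Hom C x y \<Longrightarrow> Ident C y \<cdot> f = f"
    and Comp_assoc: "f \<in> Hom C w x \<Longrightarrow> g \<in> Hom C x y \<Longrightarrow> h \<in> Hom C y z \<Longrightarrow>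
      (h \<cdot> g) \<cdot> f = h \<cdot> (g \<cdot> f)"

definition Op :: "('o, 'a, 'z) category_scheme \<Rightarrow> ('o, 'a) category" where
  "Op C = \<lparr>Obj = Obj C, Arr = Arr C, Src = Tgt C, Tgt = Src C,
     Ident = Ident C, Comp = (\<lambda>g f. f \<cdot>\<^bsub>C\<^esub> g)\<rparr>"

definition ProdCat :: "('o, 'a, 'z) category_scheme \<Rightarrow> ('p, 'b, 'y) category_scheme
    \<Rightarrow> ('o \<times> 'p, 'a \<times> 'b) category" where
  "ProdCat C D = \<lparr>Obj = Obj C \<times> Obj D, Arr = Arr C \<times> Arr D,
     Src = map_prod (Src C) (Src D), Tgt = map_prod (Tgt C) (Tgt D),
     Ident = map_prod (Ident C) (Ident D),
     Comp = (\<lambda>(g, g') (f, f'). (g \<cdot>\<^bsub>C\<^esub> f, g' \<cdot>\<^bsub>D\<^esub> f'))\<rparr>"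

definition is_mono :: "('o, 'a, 'z) category_scheme \<Rightarrow> 'a \<Rightarrow> bool" where
  "is_mono C f \<longleftrightarrow> f \<in> Arr C \<and>
     (\<forall>w \<in> Obj C. \<forall>g \<in> Hom C w (Src C f). \<forall>h \<in> Hom C w (Src C f).
        f \<cdot>\<^bsub>C\<^esub> g = f \<cdot>\<^bsub>C\<^esub> h \<longrightarrow> g = h)"

definition is_epi :: "('o, 'a, 'z) category_scheme \<Rightarrow> 'a \<Rightarrow> bool" where
  "is_epi C f \<longleftrightarrow> f \<in> Arr C \<and>
     (\<forall>w \<in> Obj C. \<forall>g \<in> Hom C (Tgt C f) w. \<forall>h \<in> Hom C (Tgt C f) w.
        g \<cdot>\<^bsub>C\<^esub> f = h \<cdot>\<^bsub>C\<^esub> f \<longrightarrow> g = h)"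

definition is_iso_arr :: "('o, 'a, 'z) category_scheme \<Rightarrow> 'a \<Rightarrow> bool" where
  "is_iso_arr C f \<longleftrightarrow> f \<in> Arr C \<and>
     (\<exists>g \<in> Hom C (Tgt C f) (Src C f).
        g \<cdot>\<^bsub>C\<^esub> f = Ident C (Src C f) \<and> f \<cdot>\<^bsub>C\<^esub> g = Ident C (Tgt C f))"

text \<open>The square \<open>f' \<cdot> f = g' \<cdot> g\<close> is a pushout of the span \<open>f, g\<close>.\<close>

definition is_pushout :: "('o, 'a, 'z) category_scheme \<Rightarrow> 'a \<Rightarrow> 'a \<Rightarrow> 'a \<Rightarrow> 'a \<Rightarrow> bool" where
  "is_pushout C f g f' g' \<longleftrightarrow>
     f \<in> Arr C \<and> g \<in> Arr C \<and> f' \<in> Arr C \<and> g' \<in> Arr C \<and>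
     Src C f = Src C g \<and> Src C f' = Tgt C f \<and> Src C g' = Tgt C g \<and> Tgt C f' = Tgt C g' \<and>
     f' \<cdot>\<^bsub>C\<^esub> f = g' \<cdot>\<^bsub>C\<^esub> g \<and>
     (\<forall>w \<in> Obj C. \<forall>u \<in> Hom C (Tgt C f) w. \<forall>v \<in> Hom C (Tgt C g) w.
        u \<cdot>\<^bsub>C\<^esub> f = v \<cdot>\<^bsub>C\<^esub> g \<longrightarrow>
        (\<exists>!t. t \<in> Hom C (Tgt C f') w \<and> t \<cdot>\<^bsub>C\<^esub> f' = u \<and> t \<cdot>\<^bsub>C\<^esub> g' = v))"

text \<open>The square \<open>f \<cdot> f' = g \<cdot> g'\<close> is a pullback of the cospan \<open>f, g\<close>.\<close>

definition is_pullback :: "('o, 'a, 'z) category_scheme \<Rightarrow> 'a \<Rightarrow> 'a \<Rightarrow> 'a \<Rightarrow> 'a \<Rightarrow> bool" where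
  "is_pullback C f g f' g' \<longleftrightarrow>
     f \<in> Arr C \<and> g \<in> Arr C \<and> f' \<in> Arr C \<and> g' \<in> Arr C \<and>
     Tgt C f = Tgt C g \<and> Tgt C f' = Src C f \<and> Tgt C g' = Src C g \<and> Src C f' = Src C g' \<and>
     f \<cdot>\<^bsub>C\<^esub> f' = g \<cdot>\<^bsub>C\<^esub> g' \<and>
     (\<forall>w \<in> Obj C. \<forall>u \<in> Hom C w (Src C f). \<forall>v \<in> Hom C w (Src C g).
        f \<cdot>\<^bsub>C\<^esub> u = g \<cdot>\<^bsub>C\<^esub> v \<longrightarrow>
        (\<exists>!t. t \<in> Hom C w (Src C f') \<and> f' \<cdot>\<^bsub>C\<^esub> t = u \<and> g' \<cdot>\<^bsub>C\<^esub> t = v))"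


section \<open>Abelian categories\<close>

text \<open>
  \<open>f \<oplus> g\<close> is meaningful only for parallel arrows; \<open>HZero x y\<close> is the zero arrow from \<open>x\<close> to
  \<open>y\<close>.
\<close>

record ('o, 'a) ab_category = "('o, 'a) category" +
  HAdd :: "'a \<Rightarrow> 'a \<Rightarrow> 'a"  (infixl \<open>\<oplus>\<index>\<close> 65)
  HZero :: "'o \<Rightarrow> 'o \<Rightarrow> 'a"

locale preadditive_category = category C for C (structure) +
  assumes Hom_comm_group: "x \<in> Obj C \<Longrightarrow> y \<in> Obj C \<Longrightarrow>
      comm_group \<lparr>carrier = Hom C x y, mult = HAdd C, one = HZero C x y\<rparr>"
    and Comp_HAdd_right: "f \<in> Hom C x y \<Longrightarrow> g \<in> Hom C x y \<Longrightarrow> h \<in> Hom C y z \<Longrightarrow>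
      h \<cdot> (f \<oplus> g) = h \<cdot> f \<oplus> h \<cdot> g"
    and Comp_HAdd_left: "f \<in> Hom C x y \<Longrightarrow> g \<in> Hom C y z \<Longrightarrow> h \<in> Hom C y z \<Longrightarrow>
      (g \<oplus> h) \<cdot> f = g \<cdot> f \<oplus> h \<cdot> f"

definition is_zero_obj :: "('o, 'a, 'z) category_scheme \<Rightarrow> 'o \<Rightarrow> bool" where
  "is_zero_obj C z \<longleftrightarrow> z \<in> Obj C \<and>
     (\<forall>x \<in> Obj C. (\<exists>!f. f \<in> Hom C z x) \<and> (\<exists>!f. f \<in> Hom C x z))"

text \<open>\<open>Tgt C j\<^sub>1 = Src C q\<^sub>1\<close> is a biproduct of \<open>x\<close> and \<open>y\<close>.\<close>

definition is_biproduct ::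
  "('o, 'a, 'z) ab_category_scheme \<Rightarrow> 'o \<Rightarrow> 'o \<Rightarrow> 'a \<Rightarrow> 'a \<Rightarrow> 'a \<Rightarrow> 'a \<Rightarrow> bool" where
  "is_biproduct C x y j\<^sub>1 j\<^sub>2 q\<^sub>1 q\<^sub>2 \<longleftrightarrow> x \<in> Obj C \<and> y \<in> Obj C \<and>
     (\<exists>z \<in> Obj C.
        j\<^sub>1 \<in> Hom C x z \<and> j\<^sub>2 \<in> Hom C y z \<and> q\<^sub>1 \<in> Hom C z x \<and> q\<^sub>2 \<in> Hom C z y \<and>
        q\<^sub>1 \<cdot>\<^bsub>C\<^esub> j\<^sub>1 = Ident C x \<and> q\<^sub>2 \<cdot>\<^bsub>C\<^esub> j\<^sub>2 = Ident C y \<and>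
        q\<^sub>2 \<cdot>\<^bsub>C\<^esub> j\<^sub>1 = HZero C x y \<and> q\<^sub>1 \<cdot>\<^bsub>C\<^esub> j\<^sub>2 = HZero C y x \<and>
        j\<^sub>1 \<cdot>\<^bsub>C\<^esub> q\<^sub>1 \<oplus>\<^bsub>C\<^esub> j\<^sub>2 \<cdot>\<^bsub>C\<^esub> q\<^sub>2 = Ident C z)"

definition is_kernel :: "('o, 'a, 'z) ab_category_scheme \<Rightarrow> 'a \<Rightarrow> 'a \<Rightarrow> bool" where
  "is_kernel C f k \<longleftrightarrow> f \<in> Arr C \<and> k \<in> Arr C \<and> Tgt C k = Src C f \<and>
     f \<cdot>\<^bsub>C\<^esub> k = HZero C (Src C k) (Tgt C f) \<and>
     (\<forall>w \<in> Obj C. \<forall>h \<in> Hom C w (Src C f). f \<cdot>\<^bsub>C\<^esub> h = HZero C w (Tgt C f) \<longrightarrow>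
        (\<exists>!u. u \<in> Hom C w (Src C k) \<and> k \<cdot>\<^bsub>C\<^esub> u = h))"

definition is_cokernel :: "('o, 'a, 'z) ab_category_scheme \<Rightarrow> 'a \<Rightarrow> 'a \<Rightarrow> bool" where
  "is_cokernel C f q \<longleftrightarrow> f \<in> Arr C \<and> q \<in> Arr C \<and> Src C q = Tgt C f \<and>
     q \<cdot>\<^bsub>C\<^esub> f = HZero C (Src C f) (Tgt C q) \<and>
     (\<forall>w \<in> Obj C. \<forall>h \<in> Hom C (Tgt C f) w. h \<cdot>\<^bsub>C\<^esub> f = HZero C (Src C f) w \<longrightarrow>
        (\<exists>!u. u \<in> Hom C (Tgt C q) w \<and> u \<cdot>\<^bsub>C\<^esub> q = h))"

locale abelian_category = preadditive_category C for C (structure) +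
  assumes has_zero_obj: "\<exists>z. is_zero_obj C z"
    and has_biproducts: "x \<in> Obj C \<Longrightarrow> y \<in> Obj C \<Longrightarrow>
      \<exists>j\<^sub>1 j\<^sub>2 q\<^sub>1 q\<^sub>2. is_biproduct C x y j\<^sub>1 j\<^sub>2 q\<^sub>1 q\<^sub>2"
    and has_kernels: "f \<in> Arr C \<Longrightarrow> \<exists>k. is_kernel C f k"
    and has_cokernels: "f \<in> Arr C \<Longrightarrow> \<exists>q. is_cokernel C f q"
    and mono_normal: "is_mono C f \<Longrightarrow> \<exists>g. is_kernel C g f"
    and epi_normal: "is_epi C f \<Longrightarrow> \<exists>g. is_cokernel C g f"

text \<open>
  \<open>(i, p)\<close> stands for the sequence \<open>0 \<rightarrow> Src i \<rightarrow> Tgt i = Src p \<rightarrow> Tgt p \<rightarrow> 0\<close>.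
\<close>

definition short_exact :: "('o, 'a, 'z) ab_category_scheme \<Rightarrow> 'a \<times> 'a \<Rightarrow> bool" where
  "short_exact C = (\<lambda>(i, p). is_kernel C p i \<and> is_cokernel C i p)"


section \<open>Functors and functor categories\<close>

record ('o, 'a, 'p, 'b) ftor =
  omap :: "'o \<Rightarrow> 'p"
  amap :: "'a \<Rightarrow> 'b"

definition is_functor :: "('o, 'a, 'z) category_scheme \<Rightarrow> ('p, 'b, 'y) category_scheme
    \<Rightarrow> ('o, 'a, 'p, 'b) ftor \<Rightarrow> bool" where
  "is_functor C D F \<longleftrightarrow>
     (\<forall>x \<in> Obj C. omap F x \<in> Obj D) \<and>
     (\<forall>f \<in> Arr C. amap F f \<in> Hom D (omap F (Src C f)) (omap F (Tgt C f))) \<and>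
     (\<forall>x \<in> Obj C. amap F (Ident C x) = Ident D (omap F x)) \<and>
     (\<forall>f \<in> Arr C. \<forall>g \<in> Arr C. Tgt C f = Src C g \<longrightarrow>
        amap F (g \<cdot>\<^bsub>C\<^esub> f) = amap F g \<cdot>\<^bsub>D\<^esub> amap F f)"

definition exact_functor :: "('o, 'a, 'z) ab_category_scheme \<Rightarrow> ('p, 'b, 'y) ab_category_scheme
    \<Rightarrow> ('o, 'a, 'p, 'b) ftor \<Rightarrow> bool" where
  "exact_functor C D F \<longleftrightarrow> is_functor C D F \<and>
     (\<forall>f \<in> Arr C. \<forall>g \<in> Arr C. Src C f = Src C g \<and> Tgt C f = Tgt C g \<longrightarrow>
        amap F (f \<oplus>\<^bsub>C\<^esub> g) = amap F f \<oplus>\<^bsub>D\<^esub> amap F g) \<and>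
     (\<forall>i p. short_exact C (i, p) \<longrightarrow> short_exact D (amap F i, amap F p))"

text \<open>A natural transformation carries its source and target functors.\<close>

record ('o, 'a, 'p, 'b) ntrans =
  nsrc :: "('o, 'a, 'p, 'b) ftor"
  ntgt :: "('o, 'a, 'p, 'b) ftor"
  ncomp :: "'o \<Rightarrow> 'b"

text \<open>
  Functors and transformations that are objects and arrows of the functor category are
  \<open>undefined\<close> outside the index category, so that equality of HOL functions is equality of
  functors and of transformations.
\<close>

definition FunCat :: "('s, 't, 'z) category_scheme \<Rightarrow> ('o, 'a, 'y) ab_category_scheme
    \<Rightarrow> (('s, 't, 'o, 'a) ftor, ('s, 't, 'o, 'a) ntrans) ab_category" where
  "FunCat S B =
    (let obs = {F. is_functor S B F \<and> omap F \<in> extensional (Obj S) \<and> amap F \<in> extensional (Arr S)}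
     in \<lparr>Obj = obs,
         Arr = {\<tau>. nsrc \<tau> \<in> obs \<and> ntgt \<tau> \<in> obs \<and> ncomp \<tau> \<in> extensional (Obj S) \<and>
           (\<forall>s \<in> Obj S. ncomp \<tau> s \<in> Hom B (omap (nsrc \<tau>) s) (omap (ntgt \<tau>) s)) \<and>
           (\<forall>f \<in> Arr S. ncomp \<tau> (Tgt S f) \<cdot>\<^bsub>B\<^esub> amap (nsrc \<tau>) f =
                        amap (ntgt \<tau>) f \<cdot>\<^bsub>B\<^esub> ncomp \<tau> (Src S f))},
         Src = nsrc,
         Tgt = ntgt,
         Ident = (\<lambda>F. \<lparr>nsrc = F, ntgt = F, ncomp = (\<lambda>s \<in> Obj S. Ident B (omap F s))\<rparr>),
         Comp = (\<lambda>\<tau> \<sigma>. \<lparr>nsrc = nsrc \<sigma>, ntgt = ntgt \<tau>,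
           ncomp = (\<lambda>s \<in> Obj S. ncomp \<tau> s \<cdot>\<^bsub>B\<^esub> ncomp \<sigma> s)\<rparr>),
         HAdd = (\<lambda>\<sigma> \<tau>. \<lparr>nsrc = nsrc \<sigma>, ntgt = ntgt \<sigma>,
           ncomp = (\<lambda>s \<in> Obj S. ncomp \<sigma> s \<oplus>\<^bsub>B\<^esub> ncomp \<tau> s)\<rparr>),
         HZero = (\<lambda>F G. \<lparr>nsrc = F, ntgt = G,
           ncomp = (\<lambda>s \<in> Obj S. HZero B (omap F s) (omap G s))\<rparr>)\<rparr>)"

definition Const :: "('s, 't, 'z) category_scheme \<Rightarrow> ('o, 'a, 'y) category_scheme
    \<Rightarrow> ('o, 'a, ('s, 't, 'o, 'a) ftor, ('s, 't, 'o, 'a) ntrans) ftor" where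
  "Const S B =
    (let K = (\<lambda>b. \<lparr>omap = (\<lambda>s \<in> Obj S. b), amap = (\<lambda>f \<in> Arr S. Ident B b)\<rparr>)
     in \<lparr>omap = K,
         amap = (\<lambda>f. \<lparr>nsrc = K (Src B f), ntgt = K (Tgt B f), ncomp = (\<lambda>s \<in> Obj S. f)\<rparr>)\<rparr>)"


section \<open>Limits\<close>

definition is_limit :: "('s, 't, 'z) category_scheme \<Rightarrow> ('o, 'a, 'y) ab_category_scheme
    \<Rightarrow> ('s, 't, 'o, 'a) ftor \<Rightarrow> 'o \<Rightarrow> ('s, 't, 'o, 'a) ntrans \<Rightarrow> bool" where
  "is_limit S B F L \<rho> \<longleftrightarrow> L \<in> Obj B \<and> \<rho> \<in> Hom (FunCat S B) (omap (Const S B) L) F \<and>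
     (\<forall>X \<in> Obj B. \<forall>\<sigma> \<in> Hom (FunCat S B) (omap (Const S B) X) F.
        \<exists>!u. u \<in> Hom B X L \<and> \<rho> \<cdot>\<^bsub>FunCat S B\<^esub> amap (Const S B) u = \<sigma>)"

definition complete_for :: "('s, 't, 'z) category_scheme \<Rightarrow> ('o, 'a, 'y) ab_category_scheme
    \<Rightarrow> bool" where
  "complete_for S B \<longleftrightarrow> (\<forall>F \<in> Obj (FunCat S B). \<exists>L \<rho>. is_limit S B F L \<rho>)"

text \<open>A chosen limit of each functor, with its universal transformation.\<close>

definition lim_cone :: "('s, 't, 'z) category_scheme \<Rightarrow> ('o, 'a, 'y) ab_category_scheme
    \<Rightarrow> ('s, 't, 'o, 'a) ftor \<Rightarrow> 'o \<times> ('s, 't, 'o, 'a) ntrans" where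
  "lim_cone S B F = (SOME (L, \<rho>). is_limit S B F L \<rho>)"

definition lim_proj :: "('s, 't, 'z) category_scheme \<Rightarrow> ('o, 'a, 'y) ab_category_scheme
    \<Rightarrow> ('s, 't, 'o, 'a) ftor \<Rightarrow> ('s, 't, 'o, 'a) ntrans" where
  "lim_proj S B F = snd (lim_cone S B F)"

definition Lim :: "('s, 't, 'z) category_scheme \<Rightarrow> ('o, 'a, 'y) ab_category_scheme
    \<Rightarrow> (('s, 't, 'o, 'a) ftor, ('s, 't, 'o, 'a) ntrans, 'o, 'a) ftor" where
  "Lim S B =
    (let L = (\<lambda>F. fst (lim_cone S B F))
     in \<lparr>omap = L,
         amap = (\<lambda>\<tau>. THE u. u \<in> Hom B (L (nsrc \<tau>)) (L (ntgt \<tau>)) \<and>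
           lim_proj S B (ntgt \<tau>) \<cdot>\<^bsub>FunCat S B\<^esub> amap (Const S B) u =
           \<tau> \<cdot>\<^bsub>FunCat S B\<^esub> lim_proj S B (nsrc \<tau>))\<rparr>)"


section \<open>Yoneda Ext groups\<close>

definition extensions :: "('o, 'a, 'z) ab_category_scheme \<Rightarrow> 'o \<Rightarrow> 'o \<Rightarrow> ('a \<times> 'a) set" where
  "extensions C X Y = {(i, p). short_exact C (i, p) \<and> Src C i = Y \<and> Tgt C p = X}"

definition ext_rel :: "('o, 'a, 'z) ab_category_scheme \<Rightarrow> (('a \<times> 'a) \<times> ('a \<times> 'a)) set" where
  "ext_rel C = {((i, p), (i', p')). short_exact C (i, p) \<and> short_exact C (i', p') \<and>
     Src C i = Src C i' \<and> Tgt C p = Tgt C p' \<and>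
     (\<exists>e \<in> Hom C (Tgt C i) (Tgt C i'). is_iso_arr C e \<and> e \<cdot>\<^bsub>C\<^esub> i = i' \<and> p' \<cdot>\<^bsub>C\<^esub> e = p)}"

abbreviation ext_class :: "('o, 'a, 'z) ab_category_scheme \<Rightarrow> 'a \<times> 'a \<Rightarrow> ('a \<times> 'a) set" where
  "ext_class C \<epsilon> \<equiv> ext_rel C `` {\<epsilon>}"

text \<open>
  The second sequence is a pushout of the first along \<open>h\<close>, respectively a pullback of the first
  along \<open>g\<close>.
\<close>

definition pushout_ext :: "('o, 'a, 'z) ab_category_scheme \<Rightarrow> 'a \<Rightarrow> 'a \<times> 'a \<Rightarrow> 'a \<times> 'a \<Rightarrow> bool"
  where
  "pushout_ext C h = (\<lambda>(i, p) (i', p'). short_exact C (i, p) \<and> short_exact C (i', p') \<and>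
     Tgt C p' = Tgt C p \<and> (\<exists>e. is_pushout C i h e i' \<and> p' \<cdot>\<^bsub>C\<^esub> e = p))"

definition pullback_ext :: "('o, 'a, 'z) ab_category_scheme \<Rightarrow> 'a \<Rightarrow> 'a \<times> 'a \<Rightarrow> 'a \<times> 'a \<Rightarrow> bool"
  where
  "pullback_ext C g = (\<lambda>(i, p) (i', p'). short_exact C (i, p) \<and> short_exact C (i', p') \<and>
     Src C i' = Src C i \<and> (\<exists>e. is_pullback C p g e p' \<and> e \<cdot>\<^bsub>C\<^esub> i' = i))"

text \<open>
  The operations on classes below are the usual ones on representatives: the union ranges over all
  representatives and all choices of the construction, which in an abelian category all yield the
  same class.
\<close>

definition ext_push :: "('o, 'a, 'z) ab_category_scheme \<Rightarrow> 'a \<Rightarrow> ('a \<times> 'a) set \<Rightarrow> ('a \<times> 'a) set"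
  where
  "ext_push C h c = (\<Union>\<epsilon> \<in> c. \<Union>\<epsilon>' \<in> {\<epsilon>'. pushout_ext C h \<epsilon> \<epsilon>'}. ext_class C \<epsilon>')"

definition ext_pull :: "('o, 'a, 'z) ab_category_scheme \<Rightarrow> 'a \<Rightarrow> ('a \<times> 'a) set \<Rightarrow> ('a \<times> 'a) set"
  where
  "ext_pull C g c = (\<Union>\<epsilon> \<in> c. \<Union>\<epsilon>' \<in> {\<epsilon>'. pullback_ext C g \<epsilon> \<epsilon>'}. ext_class C \<epsilon>')"

text \<open>The action of the bifunctor Ext on an arrow \<open>g\<close> in the first and \<open>h\<close> in the second variable.\<close>

definition ext_map :: "('o, 'a, 'z) ab_category_scheme \<Rightarrow> 'a \<Rightarrow> 'a \<Rightarrow> ('a \<times> 'a) set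
    \<Rightarrow> ('a \<times> 'a) set" where
  "ext_map C g h c = ext_push C h (ext_pull C g c)"

text \<open>
  \<open>\<epsilon>\<close> is a Baer sum of \<open>\<epsilon>\<^sub>1\<close> and \<open>\<epsilon>\<^sub>2\<close>: with \<open>q\<^sub>1 \<oplus> q\<^sub>2\<close> the codiagonal of \<open>Y\<close> and \<open>l\<^sub>1 \<oplus> l\<^sub>2\<close> the
  diagonal of \<open>X\<close>, the direct sum of \<open>\<epsilon>\<^sub>1\<close> and \<open>\<epsilon>\<^sub>2\<close> is pulled back along the diagonal and then
  pushed out along the codiagonal.
\<close>

definition baer_sum :: "('o, 'a, 'z) ab_category_scheme \<Rightarrow> 'a \<times> 'a \<Rightarrow> 'a \<times> 'a \<Rightarrow> 'a \<times> 'a \<Rightarrow> bool"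
  where
  "baer_sum C = (\<lambda>(i\<^sub>1, p\<^sub>1) (i\<^sub>2, p\<^sub>2) \<epsilon>.
     \<exists>j\<^sub>1 j\<^sub>2 q\<^sub>1 q\<^sub>2 k\<^sub>1 k\<^sub>2 r\<^sub>1 r\<^sub>2 l\<^sub>1 l\<^sub>2 s\<^sub>1 s\<^sub>2 \<delta>.
       is_biproduct C (Src C i\<^sub>1) (Src C i\<^sub>2) j\<^sub>1 j\<^sub>2 q\<^sub>1 q\<^sub>2 \<and>
       is_biproduct C (Tgt C i\<^sub>1) (Tgt C i\<^sub>2) k\<^sub>1 k\<^sub>2 r\<^sub>1 r\<^sub>2 \<and>
       is_biproduct C (Tgt C p\<^sub>1) (Tgt C p\<^sub>2) l\<^sub>1 l\<^sub>2 s\<^sub>1 s\<^sub>2 \<and>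
       pullback_ext C (l\<^sub>1 \<oplus>\<^bsub>C\<^esub> l\<^sub>2)
         (k\<^sub>1 \<cdot>\<^bsub>C\<^esub> i\<^sub>1 \<cdot>\<^bsub>C\<^esub> q\<^sub>1 \<oplus>\<^bsub>C\<^esub> k\<^sub>2 \<cdot>\<^bsub>C\<^esub> i\<^sub>2 \<cdot>\<^bsub>C\<^esub> q\<^sub>2,
          l\<^sub>1 \<cdot>\<^bsub>C\<^esub> p\<^sub>1 \<cdot>\<^bsub>C\<^esub> r\<^sub>1 \<oplus>\<^bsub>C\<^esub> l\<^sub>2 \<cdot>\<^bsub>C\<^esub> p\<^sub>2 \<cdot>\<^bsub>C\<^esub> r\<^sub>2) \<delta> \<and>
       pushout_ext C (q\<^sub>1 \<oplus>\<^bsub>C\<^esub> q\<^sub>2) \<delta> \<epsilon>)"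

definition Ext1 :: "('o, 'a, 'z) ab_category_scheme \<Rightarrow> 'o \<Rightarrow> 'o \<Rightarrow> ('a \<times> 'a) set monoid" where
  "Ext1 C X Y =
    \<lparr>carrier = extensions C X Y // ext_rel C,
     mult = (\<lambda>c d. \<Union>\<epsilon>\<^sub>1 \<in> c. \<Union>\<epsilon>\<^sub>2 \<in> d. \<Union>\<epsilon> \<in> {\<epsilon>. baer_sum C \<epsilon>\<^sub>1 \<epsilon>\<^sub>2 \<epsilon>}. ext_class C \<epsilon>),
     one = (\<Union>\<epsilon> \<in> {(i, p). \<exists>j q. is_biproduct C Y X i j q p}. ext_class C \<epsilon>)\<rparr>"


section \<open>The comparison maps\<close>

definition Phi :: "('s, 't, 'z) category_scheme \<Rightarrow> ('o, 'a, 'y) ab_category_scheme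
    \<Rightarrow> ('s, 't, 'o, 'a) ftor \<Rightarrow> ('a \<times> 'a) set
    \<Rightarrow> (('s, 't, 'o, 'a) ntrans \<times> ('s, 't, 'o, 'a) ntrans) set" where
  "Phi S B F c =
     (\<Union>(i, p) \<in> c.
        \<Union>\<epsilon>' \<in> {\<epsilon>'. pushout_ext (FunCat S B) (lim_proj S B F)
                     (amap (Const S B) i, amap (Const S B) p) \<epsilon>'}.
          ext_class (FunCat S B) \<epsilon>')"

text \<open>
  \<open>\<phi>\<close> is a natural isomorphism between the group-valued functors on \<open>C\<close> given by \<open>G, T\<close> (groups and
  induced maps) and by \<open>G', T'\<close>. Functoriality of \<open>G, T\<close> and \<open>G', T'\<close> is not part of the predicate.
\<close>

definition nat_group_iso :: "('o, 'a, 'z) category_scheme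
    \<Rightarrow> ('o \<Rightarrow> 'x monoid) \<Rightarrow> ('a \<Rightarrow> 'x \<Rightarrow> 'x)
    \<Rightarrow> ('o \<Rightarrow> 'y monoid) \<Rightarrow> ('a \<Rightarrow> 'y \<Rightarrow> 'y) \<Rightarrow> ('o \<Rightarrow> 'x \<Rightarrow> 'y) \<Rightarrow> bool" where
  "nat_group_iso C G T G' T' \<phi> \<longleftrightarrow>
     (\<forall>x \<in> Obj C. \<phi> x \<in> iso (G x) (G' x)) \<and>
     (\<forall>f \<in> Arr C. \<forall>c \<in> carrier (G (Src C f)).
        \<phi> (Tgt C f) (T f c) = T' f (\<phi> (Src C f) c))"

end

theory Submission
  imports Defs
begin

text \<open>
  Write \<open>emor h g \<epsilon> \<epsilon>'\<close> if there is a morphism of short exact sequences from \<open>\<epsilon>\<close> to \<open>\<epsilon>'\<close> with ends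
  \<open>h\<close> and \<open>g\<close>. Equivalence of extensions, pushouts and pullbacks are the cases where both ends, the
  right end, or the left end are identities, and the universal properties become two cancellation
  rules for \<open>emor\<close>. They show, for every \<open>\<Sigma>\<close>-complete \<open>\<B>\<close>, that \<open>\<Phi>\<close> is well defined, additive and
  natural in both variables. It is also always injective: a sequence whose image is \<open>0 \<rightarrow> F \<rightarrow> G \<rightarrow> \<kappa>B \<rightarrow> 0\<close>
  is the pullback of \<open>0 \<rightarrow> L\<^sub>F \<rightarrow> L\<^sub>G \<rightarrow> L\<^bsub>\<kappa>B\<^esub>\<close> along the unit \<open>B \<rightarrow> L\<^bsub>\<kappa>B\<^esub>\<close>. So the content of (b) and of (c) is
  the surjectivity of \<open>\<Phi>\<close>. If limits are exact, the pullback just described is a preimage. Conversely,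
  given \<open>0 \<rightarrow> F \<rightarrow> G \<rightarrow> H \<rightarrow> 0\<close>, pull it back along \<open>\<kappa>L\<^sub>H \<rightarrow> H\<close> and choose a preimage
  \<open>0 \<rightarrow> L\<^sub>F \<rightarrow> A \<rightarrow> L\<^sub>H \<rightarrow> 0\<close>; the epimorphism \<open>A \<rightarrow> L\<^sub>H\<close> factors through \<open>L\<^sub>G \<rightarrow> L\<^sub>H\<close>.
\<close>

text \<open>Constant diagrams are left adjoint to limits, so limits always preserve kernels and
  exactness only asks that they preserve the epimorphism of a short exact sequence. The obstacle is
  that limits, pushouts, pullbacks, biproducts and representatives of classes are all determined
  only up to isomorphism, while \<open>Phi\<close> and the operations on \<open>Ext1\<close> are
  unions over all choices. This is why the middle arrow of \<open>emor\<close> is existentially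
  quantified: by the short five lemma the ends alone decide what kind of morphism it is, so
  independence of choices becomes a calculation with ends. Baer sums fit this scheme, since two
  morphisms with common ends \<open>h\<close> and \<open>g\<close> induce one between the sums; the
  ends \<open>\<rho> F\<close> and identity give additivity. Injectivity survives the failure of
  right exactness because the pullback of a left exact sequence is short exact as soon as some short
  exact sequence maps to it with the right ends. The factorization of A \<rightarrow> L_H comes from
  transposing the middle arrow \<kappa>A \<rightarrow> G to A \<rightarrow> L_G.\<close>

lemma in_Hom [simp]: "f \<in> Hom C x y \<longleftrightarrow> f \<in> Arr C \<and> Src C f = x \<and> Tgt C f = y"
  by (auto simp: Hom_def)

section \<open>Elementary category theory\<close>

context category
begin

lemma Src_Obj: "f \<in> Arr C \<Longrightarrow> Src C f = x \<Longrightarrow> x \<in> Obj C"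
  using Src_in_Obj by blast

lemma Tgt_Obj: "f \<in> Arr C \<Longrightarrow> Tgt C f = x \<Longrightarrow> x \<in> Obj C"
  using Tgt_in_Obj by blast

lemma Src_Obj' [simp]: "f \<in> Arr C \<Longrightarrow> Src C f \<in> Obj C"
  and Tgt_Obj' [simp]: "f \<in> Arr C \<Longrightarrow> Tgt C f \<in> Obj C"
  using Src_in_Obj Tgt_in_Obj by blast+

lemma Ident_simps [simp]:
  assumes "x \<in> Obj C"
  shows "Ident C x \<in> Arr C" "Src C (Ident C x) = x" "Tgt C (Ident C x) = x"
  using Ident_in_Hom[OF assms] by auto

lemma Comp_simps [simp]:
  assumes "f \<in> Arr C" "g \<in> Arr C" "Tgt C f = Src C g"
  shows "g \<cdot> f \<in> Arr C" "Src C (g \<cdot> f) = Src C f" "Tgt C (g \<cdot> f) = Tgt C g"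
  using Comp_in_Hom[of f "Src C f" "Tgt C f" g "Tgt C g"] assms by auto

lemma Comp_Ident [simp]:
  "f \<in> Arr C \<Longrightarrow> Src C f = x \<Longrightarrow> f \<cdot> Ident C x = f"
  "f \<in> Arr C \<Longrightarrow> Tgt C f = x \<Longrightarrow> Ident C x \<cdot> f = f"
  using Comp_Ident_right Comp_Ident_left by auto

lemma Comp_assoc' [simp]:
  assumes "f \<in> Arr C" "g \<in> Arr C" "h \<in> Arr C" "Tgt C f = Src C g" "Tgt C g = Src C h"
  shows "(h \<cdot> g) \<cdot> f = h \<cdot> (g \<cdot> f)"
  using Comp_assoc[of f "Src C f" "Tgt C f" g "Tgt C g" h "Tgt C h"] assms by auto

lemma Comp_reassoc:
  assumes "g \<cdot> f = k" "f \<in> Arr C" "g \<in> Arr C" "Tgt C f = Src C g"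
    and "x \<in> Arr C" "Tgt C x = Src C f"
  shows "g \<cdot> (f \<cdot> x) = k \<cdot> x"
  using assms by (metis Comp_assoc')

lemma mono_cancel:
  assumes "is_mono C f" "f \<cdot> g = f \<cdot> h" "g \<in> Arr C" "h \<in> Arr C"
    "Src C g = Src C h" "Tgt C g = Src C f" "Tgt C h = Src C f"
  shows "g = h"
proof -
  have "g \<in> Hom C (Src C h) (Src C f)" "h \<in> Hom C (Src C h) (Src C f)" "Src C h \<in> Obj C"
    using assms by auto
  then show ?thesis
    using assms(1,2) unfolding is_mono_def by blast
qed

lemma mono_Arr: "is_mono C f \<Longrightarrow> f \<in> Arr C"
  by (simp add: is_mono_def)

lemma mono_of_comp:
  assumes "is_mono C (g \<cdot> f)" "f \<in> Arr C" "g \<in> Arr C" "Tgt C f = Src C g"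
  shows "is_mono C f"
  unfolding is_mono_def
proof (intro conjI ballI impI)
  fix w a b
  assume "a \<in> Hom C w (Src C f)" "b \<in> Hom C w (Src C f)" and eq: "f \<cdot> a = f \<cdot> b"
  then show "a = b"
    using assms by (auto intro!: mono_cancel[OF assms(1), of a b])
qed (use assms in auto)

end


section \<open>Preadditive categories and duality\<close>

context preadditive_category
begin

lemma HZero_simps [simp]:
  assumes "x \<in> Obj C" "y \<in> Obj C"
  shows "HZero C x y \<in> Arr C" "Src C (HZero C x y) = x" "Tgt C (HZero C x y) = y"
proof -
  interpret G: comm_group "\<lparr>carrier = Hom C x y, mult = HAdd C, one = HZero C x y\<rparr>"
    by (rule Hom_comm_group[OF assms])
  show "HZero C x y \<in> Arr C" "Src C (HZero C x y) = x" "Tgt C (HZero C x y) = y"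
    using G.one_closed by auto
qed

lemma HAdd_simps [simp]:
  assumes "f \<in> Arr C" "g \<in> Arr C" "Src C f = Src C g" "Tgt C f = Tgt C g"
  shows "f \<oplus> g \<in> Arr C" "Src C (f \<oplus> g) = Src C f" "Tgt C (f \<oplus> g) = Tgt C f"
proof -
  interpret G: comm_group "\<lparr>carrier = Hom C (Src C f) (Tgt C f), mult = HAdd C,
      one = HZero C (Src C f) (Tgt C f)\<rparr>"
    by (rule Hom_comm_group) (use assms in auto)
  show "f \<oplus> g \<in> Arr C" "Src C (f \<oplus> g) = Src C f" "Tgt C (f \<oplus> g) = Tgt C f"
    using G.m_closed[of f g] assms by auto
qed

lemma HAdd_HZero [simp]:
  assumes "f \<in> Arr C" "Src C f = x" "Tgt C f = y"
  shows "f \<oplus> HZero C x y = f" "HZero C x y \<oplus> f = f"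
proof -
  interpret G: comm_group "\<lparr>carrier = Hom C x y, mult = HAdd C, one = HZero C x y\<rparr>"
    by (rule Hom_comm_group) (use assms in auto)
  show "f \<oplus> HZero C x y = f" "HZero C x y \<oplus> f = f"
    using G.r_one[of f] G.l_one[of f] assms by auto
qed

lemma HAdd_commute:
  assumes "f \<in> Arr C" "g \<in> Arr C" "Src C f = Src C g" "Tgt C f = Tgt C g"
  shows "f \<oplus> g = g \<oplus> f"
proof -
  interpret G: comm_group "\<lparr>carrier = Hom C (Src C f) (Tgt C f), mult = HAdd C,
      one = HZero C (Src C f) (Tgt C f)\<rparr>"
    by (rule Hom_comm_group) (use assms in auto)
  show ?thesis
    using G.m_comm[of f g] assms by auto
qed

lemma HAdd_assoc:
  assumes "f \<in> Arr C" "g \<in> Arr C" "h \<in> Arr C" "Src C f = Src C g" "Tgt C f = Tgt C g"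
    "Src C g = Src C h" "Tgt C g = Tgt C h"
  shows "(f \<oplus> g) \<oplus> h = f \<oplus> (g \<oplus> h)"
proof -
  interpret G: comm_group "\<lparr>carrier = Hom C (Src C f) (Tgt C f), mult = HAdd C,
      one = HZero C (Src C f) (Tgt C f)\<rparr>"
    by (rule Hom_comm_group) (use assms in auto)
  show ?thesis
    using G.m_assoc[of f g h] assms by auto
qed

lemma HAdd_right_cancel:
  assumes "f \<oplus> h = g \<oplus> h" "f \<in> Arr C" "g \<in> Arr C" "h \<in> Arr C"
    "Src C f = Src C h" "Tgt C f = Tgt C h" "Src C g = Src C h" "Tgt C g = Tgt C h"
  shows "f = g"
proof -
  interpret G: comm_group "\<lparr>carrier = Hom C (Src C h) (Tgt C h), mult = HAdd C,
      one = HZero C (Src C h) (Tgt C h)\<rparr>"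
    by (rule Hom_comm_group) (use assms in auto)
  show ?thesis
    using G.right_cancel[of h f g] assms by auto
qed

lemma ex_neg:
  assumes "f \<in> Arr C"
  obtains g where "g \<in> Arr C" "Src C g = Src C f" "Tgt C g = Tgt C f"
    "f \<oplus> g = HZero C (Src C f) (Tgt C f)" "g \<oplus> f = HZero C (Src C f) (Tgt C f)"
proof -
  interpret G: comm_group "\<lparr>carrier = Hom C (Src C f) (Tgt C f), mult = HAdd C,
      one = HZero C (Src C f) (Tgt C f)\<rparr>"
    by (rule Hom_comm_group) (use assms in auto)
  show ?thesis
    using G.inv_closed[of f] G.r_inv[of f] G.l_inv[of f] assms that by auto
qed

lemma Comp_HAdd [simp]:
  "f \<in> Arr C \<Longrightarrow> g \<in> Arr C \<Longrightarrow> h \<in> Arr C \<Longrightarrow> Src C f = Src C g \<Longrightarrow> Tgt C f = Tgt C g \<Longrightarrow>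
    Tgt C g = Src C h \<Longrightarrow> h \<cdot> (f \<oplus> g) = h \<cdot> f \<oplus> h \<cdot> g"
  "f \<in> Arr C \<Longrightarrow> g \<in> Arr C \<Longrightarrow> h \<in> Arr C \<Longrightarrow> Src C h = Src C g \<Longrightarrow> Tgt C h = Tgt C g \<Longrightarrow>
    Tgt C f = Src C h \<Longrightarrow> (h \<oplus> g) \<cdot> f = h \<cdot> f \<oplus> g \<cdot> f"
  using Comp_HAdd_right Comp_HAdd_left by auto

lemma Comp_HZero [simp]:
  assumes "f \<in> Arr C" "Src C f = x" "Tgt C f = y" "z \<in> Obj C"
  shows "f \<cdot> HZero C z x = HZero C z y" "HZero C y z \<cdot> f = HZero C x z"
proof -
  have [simp]: "x \<in> Obj C" "y \<in> Obj C"
    using assms by auto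
  \<comment> \<open>A group element equal to its own double is zero; additivity of composition and
    \<open>0 + 0 = 0\<close> give the doubling.\<close>
  have "f \<cdot> HZero C z x \<oplus> f \<cdot> HZero C z x = HZero C z y \<oplus> f \<cdot> HZero C z x"
    using assms by (simp flip: Comp_HAdd(1))
  then show "f \<cdot> HZero C z x = HZero C z y"
    using assms by (intro HAdd_right_cancel[of "f \<cdot> HZero C z x" "f \<cdot> HZero C z x"]) auto
  have "HZero C y z \<cdot> f \<oplus> HZero C y z \<cdot> f = HZero C x z \<oplus> HZero C y z \<cdot> f"
    using assms by (simp flip: Comp_HAdd(2))
  then show "HZero C y z \<cdot> f = HZero C x z"
    using assms by (intro HAdd_right_cancel[of "HZero C y z \<cdot> f" "HZero C y z \<cdot> f"]) auto
qed

text \<open>Two arrows with the same composite differ by an arrow that \<open>f\<close> kills, so it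
  is enough to test \<open>f\<close> against zero. The difference is formed with a negative
  \<open>n\<close> of \<open>h\<close>.\<close>

lemma is_monoI:
  assumes "f \<in> Arr C"
    and "\<And>g. g \<in> Arr C \<Longrightarrow> Tgt C g = Src C f \<Longrightarrow> f \<cdot> g = HZero C (Src C g) (Tgt C f) \<Longrightarrow>
      g = HZero C (Src C g) (Src C f)"
  shows "is_mono C f"
  unfolding is_mono_def
proof (intro conjI ballI impI)
  fix w g h
  assume g: "g \<in> Hom C w (Src C f)" and h: "h \<in> Hom C w (Src C f)" and eq: "f \<cdot> g = f \<cdot> h"
  obtain n where n: "n \<in> Arr C" "Src C n = w" "Tgt C n = Src C f" "h \<oplus> n = HZero C w (Src C f)"
    using ex_neg[of h] h by auto
  have "f \<cdot> (g \<oplus> n) = f \<cdot> (h \<oplus> n)"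
    using g h n(1-3) eq assms(1) by simp
  then have "g \<oplus> n = HZero C w (Src C f)"
    using assms(2)[of "g \<oplus> n"] g h n assms(1) by auto
  then show "g = h"
    using g h n by (intro HAdd_right_cancel[of g n h]) auto
qed (use assms in auto)

lemma mono_zero:
  assumes "is_mono C f" "f \<cdot> g = HZero C (Src C g) (Tgt C f)" "g \<in> Arr C" "Tgt C g = Src C f"
  shows "g = HZero C (Src C g) (Src C f)"
  using assms mono_Arr[OF assms(1)]
  by (auto intro!: mono_cancel[OF assms(1), of g "HZero C (Src C g) (Src C f)"])

lemma kernelD:
  assumes "is_kernel C f k"
  shows "f \<in> Arr C" "k \<in> Arr C" "Tgt C k = Src C f" "f \<cdot> k = HZero C (Src C k) (Tgt C f)"
  using assms by (auto simp: is_kernel_def)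

lemma kernel_factor:
  assumes "is_kernel C f k" "h \<in> Arr C" "Tgt C h = Src C f" "f \<cdot> h = HZero C (Src C h) (Tgt C f)"
  obtains u where "u \<in> Arr C" "Src C u = Src C h" "Tgt C u = Src C k" "k \<cdot> u = h"
proof -
  have "h \<in> Hom C (Src C h) (Src C f)" "Src C h \<in> Obj C"
    using assms by auto
  then have "\<exists>!u. u \<in> Hom C (Src C h) (Src C k) \<and> k \<cdot> u = h"
    using assms(1,4) unfolding is_kernel_def by blast
  then show ?thesis
    using that by auto
qed

lemma kernel_mono:
  assumes "is_kernel C f k"
  shows "is_mono C k"
  unfolding is_mono_def
proof (intro conjI ballI impI)
  fix w g h
  assume g: "g \<in> Hom C w (Src C k)" and h: "h \<in> Hom C w (Src C k)" and eq: "k \<cdot> g = k \<cdot> h"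
  note k = kernelD[OF assms]
  have "f \<cdot> (k \<cdot> g) = HZero C w (Tgt C f)"
    using g k Comp_reassoc[OF k(4,2,1,3), of g] by simp
  moreover have "k \<cdot> g \<in> Hom C w (Src C f)" "w \<in> Obj C"
    using g k by auto
  ultimately have "\<exists>!u. u \<in> Hom C w (Src C k) \<and> k \<cdot> u = k \<cdot> g"
    using assms unfolding is_kernel_def by blast
  then show "g = h"
    using g h eq by metis
qed (rule kernelD(2)[OF assms])

text \<open>Cancelling the mono \<open>k\<close> settles uniqueness, so only the existence of a
  factorization has to be supplied.\<close>

lemma is_kernelI:
  assumes "f \<in> Arr C" "is_mono C k" "Tgt C k = Src C f" "f \<cdot> k = HZero C (Src C k) (Tgt C f)"
    and "\<And>h. h \<in> Arr C \<Longrightarrow> Tgt C h = Src C f \<Longrightarrow> f \<cdot> h = HZero C (Src C h) (Tgt C f) \<Longrightarrow>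
      \<exists>u \<in> Arr C. Src C u = Src C h \<and> Tgt C u = Src C k \<and> k \<cdot> u = h"
  shows "is_kernel C f k"
  unfolding is_kernel_def
proof (intro conjI ballI impI)
  fix w h
  assume h: "h \<in> Hom C w (Src C f)" "f \<cdot> h = HZero C w (Tgt C f)"
  then have "\<exists>u \<in> Arr C. Src C u = Src C h \<and> Tgt C u = Src C k \<and> k \<cdot> u = h"
    by (intro assms(5)) simp_all
  then obtain u where "u \<in> Arr C" "Src C u = Src C h" "Tgt C u = Src C k" and ku: "k \<cdot> u = h"
    by blast
  then have u: "u \<in> Hom C w (Src C k)"
    using h by simp
  show "\<exists>!u. u \<in> Hom C w (Src C k) \<and> k \<cdot> u = h"
    using u ku by (intro ex1I[of _ u]) (auto intro!: mono_cancel[OF assms(2), of _ u])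
qed (use assms mono_Arr in auto)

end

section \<open>Opposite categories and dual statements\<close>

definition OpA :: "('o, 'a, 'z) ab_category_scheme \<Rightarrow> ('o, 'a) ab_category" where
  "OpA C = \<lparr>Obj = Obj C, Arr = Arr C, Src = Tgt C, Tgt = Src C,
     Ident = Ident C, Comp = (\<lambda>g f. f \<cdot>\<^bsub>C\<^esub> g), HAdd = HAdd C, HZero = (\<lambda>x y. HZero C y x)\<rparr>"

lemma OpA_simps [simp]:
  "Obj (OpA C) = Obj C" "Arr (OpA C) = Arr C" "Src (OpA C) = Tgt C" "Tgt (OpA C) = Src C"
  "Ident (OpA C) = Ident C" "Comp (OpA C) g f = f \<cdot>\<^bsub>C\<^esub> g" "HAdd (OpA C) = HAdd C"
  "HZero (OpA C) x y = HZero C y x"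
  by (auto simp: OpA_def)

lemma Hom_OpA: "Hom (OpA C) x y = Hom C y x"
  by auto

lemma is_mono_OpA [simp]: "is_mono (OpA C) = is_epi C"
  and is_epi_OpA [simp]: "is_epi (OpA C) = is_mono C"
  by (auto simp: fun_eq_iff is_mono_def is_epi_def Hom_OpA simp del: in_Hom)

lemma is_kernel_OpA [simp]: "is_kernel (OpA C) = is_cokernel C"
  and is_cokernel_OpA [simp]: "is_cokernel (OpA C) = is_kernel C"
  by (auto simp: fun_eq_iff is_kernel_def is_cokernel_def Hom_OpA simp del: in_Hom)

lemma short_exact_OpA [simp]: "short_exact (OpA C) (i, p) \<longleftrightarrow> short_exact C (p, i)"
  by (auto simp: short_exact_def)

lemma is_pullback_OpA [simp]: "is_pullback (OpA C) = is_pushout C"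
  and is_pushout_OpA [simp]: "is_pushout (OpA C) = is_pullback C"
  unfolding fun_eq_iff is_pullback_def is_pushout_def Hom_OpA OpA_simps
  by (blast, blast)

lemma is_biproduct_OpA: "is_biproduct C x y j\<^sub>1 j\<^sub>2 q\<^sub>1 q\<^sub>2 \<Longrightarrow> is_biproduct (OpA C) x y q\<^sub>1 q\<^sub>2 j\<^sub>1 j\<^sub>2"
  by (auto simp: is_biproduct_def)

lemma is_zero_obj_OpA [simp]: "is_zero_obj (OpA C) = is_zero_obj C"
  by (auto simp: fun_eq_iff is_zero_obj_def Hom_OpA simp del: in_Hom)

text \<open>Unlike \<open>Op\<close>, \<open>OpA\<close> retains the addition of arrows. Its Hom
  groups are those of \<open>C\<close> with the two objects exchanged, so the locale can be
  instantiated at the opposite category and each fact yields its dual.\<close>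

lemma (in preadditive_category) preadditive_OpA: "preadditive_category (OpA C)"
proof (intro preadditive_category.intro category.intro preadditive_category_axioms.intro)
  fix x y
  assume "x \<in> Obj (OpA C)" "y \<in> Obj (OpA C)"
  then show "comm_group \<lparr>carrier = Hom (OpA C) x y, mult = HAdd (OpA C), one = HZero (OpA C) x y\<rparr>"
    using Hom_comm_group[of y x] unfolding Hom_OpA by simp
qed auto

lemma (in abelian_category) abelian_OpA: "abelian_category (OpA C)"
proof (intro abelian_category.intro abelian_category_axioms.intro preadditive_OpA)
  fix x y
  assume "x \<in> Obj (OpA C)" "y \<in> Obj (OpA C)"
  then show "\<exists>j\<^sub>1 j\<^sub>2 q\<^sub>1 q\<^sub>2. is_biproduct (OpA C) x y j\<^sub>1 j\<^sub>2 q\<^sub>1 q\<^sub>2"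
    using has_biproducts[of x y] is_biproduct_OpA[of C x y] unfolding OpA_simps by blast
qed (simp_all add: has_zero_obj has_kernels has_cokernels mono_normal epi_normal)

context preadditive_category
begin

text \<open>The locale facts at \<open>OpA C\<close>: the simp rules above exchange mono with epi,
  kernel with cokernel and source with target.\<close>

lemmas epi_cancel = category.mono_cancel[OF preadditive_category.axioms(1)[OF preadditive_OpA], simplified]
lemmas epi_Arr = category.mono_Arr[OF preadditive_category.axioms(1)[OF preadditive_OpA], simplified]
lemmas epi_of_comp = category.mono_of_comp[OF preadditive_category.axioms(1)[OF preadditive_OpA], simplified]
lemmas epi_zero = preadditive_category.mono_zero[OF preadditive_OpA, simplified]
lemmas cokernelD = preadditive_category.kernelD[OF preadditive_OpA, simplified]
lemmas cokernel_factor = preadditive_category.kernel_factor[OF preadditive_OpA, simplified]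
lemmas cokernel_epi = preadditive_category.kernel_mono[OF preadditive_OpA, simplified]
lemmas is_cokernelI = preadditive_category.is_kernelI[OF preadditive_OpA, simplified]

end

section \<open>Pushout squares\<close>

context category
begin

lemma pushoutD:
  assumes "is_pushout C f g f' g'"
  shows "f \<in> Arr C" "g \<in> Arr C" "f' \<in> Arr C" "g' \<in> Arr C"
    "Src C f = Src C g" "Src C f' = Tgt C f" "Src C g' = Tgt C g" "Tgt C f' = Tgt C g'"
    "f' \<cdot> f = g' \<cdot> g"
  using assms by (simp_all add: is_pushout_def)

lemma pushout_ex1:
  assumes "is_pushout C f g f' g'" "u \<in> Arr C" "v \<in> Arr C" "Src C u = Tgt C f" "Src C v = Tgt C g"
    "Tgt C u = Tgt C v" "u \<cdot> f = v \<cdot> g"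
  shows "\<exists>!t. t \<in> Hom C (Tgt C f') (Tgt C v) \<and> t \<cdot> f' = u \<and> t \<cdot> g' = v"
proof -
  have "Tgt C v \<in> Obj C" "u \<in> Hom C (Tgt C f) (Tgt C v)" "v \<in> Hom C (Tgt C g) (Tgt C v)"
    using assms by simp_all
  then show ?thesis
    using assms(1,7) unfolding is_pushout_def by blast
qed

lemma pushout_factor:
  assumes "is_pushout C f g f' g'" "u \<in> Arr C" "v \<in> Arr C" "Src C u = Tgt C f" "Src C v = Tgt C g"
    "Tgt C u = Tgt C v" "u \<cdot> f = v \<cdot> g"
  obtains t where "t \<in> Arr C" "Src C t = Tgt C f'" "Tgt C t = Tgt C v" "t \<cdot> f' = u" "t \<cdot> g' = v"
  using pushout_ex1[OF assms] unfolding in_Hom by blast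

lemma pushout_unique:
  assumes "is_pushout C f g f' g'" "t \<in> Arr C" "t' \<in> Arr C" "Src C t = Tgt C f'"
    "Src C t' = Tgt C f'" "Tgt C t = Tgt C t'" "t \<cdot> f' = t' \<cdot> f'" "t \<cdot> g' = t' \<cdot> g'"
  shows "t = t'"
proof -
  note p = pushoutD[OF assms(1)]
  have "(t' \<cdot> f') \<cdot> f = (t' \<cdot> g') \<cdot> g"
    using assms p by simp
  then have "\<exists>!s. s \<in> Hom C (Tgt C f') (Tgt C (t' \<cdot> g')) \<and> s \<cdot> f' = t' \<cdot> f' \<and> s \<cdot> g' = t' \<cdot> g'"
    using assms(2-6) p by (intro pushout_ex1[OF assms(1)]) simp_all
  moreover have "t \<in> Hom C (Tgt C f') (Tgt C (t' \<cdot> g'))" "t' \<in> Hom C (Tgt C f') (Tgt C (t' \<cdot> g'))"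
    using assms(2-6) p by simp_all
  ultimately show ?thesis
    using assms(7,8) by blast
qed

lemma is_pushoutI:
  assumes "f \<in> Arr C" "g \<in> Arr C" "f' \<in> Arr C" "g' \<in> Arr C"
    "Src C f = Src C g" "Src C f' = Tgt C f" "Src C g' = Tgt C g" "Tgt C f' = Tgt C g'"
    "f' \<cdot> f = g' \<cdot> g"
    and "\<And>u v. u \<in> Arr C \<Longrightarrow> v \<in> Arr C \<Longrightarrow> Src C u = Tgt C f \<Longrightarrow> Src C v = Tgt C g \<Longrightarrow>
      Tgt C u = Tgt C v \<Longrightarrow> u \<cdot> f = v \<cdot> g \<Longrightarrow>
      \<exists>t \<in> Hom C (Tgt C f') (Tgt C v). t \<cdot> f' = u \<and> t \<cdot> g' = v"
    and "\<And>t t'. t \<in> Arr C \<Longrightarrow> t' \<in> Arr C \<Longrightarrow> Src C t = Tgt C f' \<Longrightarrow> Src C t' = Tgt C f' \<Longrightarrow>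
      Tgt C t = Tgt C t' \<Longrightarrow> t \<cdot> f' = t' \<cdot> f' \<Longrightarrow> t \<cdot> g' = t' \<cdot> g' \<Longrightarrow> t = t'"
  shows "is_pushout C f g f' g'"
  unfolding is_pushout_def
proof (intro conjI ballI impI)
  fix w u v
  assume *: "u \<in> Hom C (Tgt C f) w" "v \<in> Hom C (Tgt C g) w" "u \<cdot> f = v \<cdot> g"
  then have "\<exists>t \<in> Hom C (Tgt C f') (Tgt C v). t \<cdot> f' = u \<and> t \<cdot> g' = v"
    by (intro assms(10)) simp_all
  then obtain t where t: "t \<in> Hom C (Tgt C f') w" "t \<cdot> f' = u" "t \<cdot> g' = v"
    using * by auto
  show "\<exists>!t. t \<in> Hom C (Tgt C f') w \<and> t \<cdot> f' = u \<and> t \<cdot> g' = v"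
  proof (rule ex1I[of _ t])
    fix s
    assume s: "s \<in> Hom C (Tgt C f') w \<and> s \<cdot> f' = u \<and> s \<cdot> g' = v"
    show "s = t"
      by (rule assms(11)) (use s t in simp_all)
  qed (use t in simp)
qed fact+

end

context preadditive_category
begin

lemma biproductE:
  assumes "is_biproduct C x y j\<^sub>1 j\<^sub>2 q\<^sub>1 q\<^sub>2"
  obtains z where "x \<in> Obj C" "y \<in> Obj C" "z \<in> Obj C"
    "j\<^sub>1 \<in> Arr C" "Src C j\<^sub>1 = x" "Tgt C j\<^sub>1 = z" "j\<^sub>2 \<in> Arr C" "Src C j\<^sub>2 = y" "Tgt C j\<^sub>2 = z"
    "q\<^sub>1 \<in> Arr C" "Src C q\<^sub>1 = z" "Tgt C q\<^sub>1 = x" "q\<^sub>2 \<in> Arr C" "Src C q\<^sub>2 = z" "Tgt C q\<^sub>2 = y"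
    "q\<^sub>1 \<cdot> j\<^sub>1 = Ident C x" "q\<^sub>2 \<cdot> j\<^sub>2 = Ident C y" "q\<^sub>2 \<cdot> j\<^sub>1 = HZero C x y" "q\<^sub>1 \<cdot> j\<^sub>2 = HZero C y x"
    "j\<^sub>1 \<cdot> q\<^sub>1 \<oplus> j\<^sub>2 \<cdot> q\<^sub>2 = Ident C z"
  using assms that unfolding is_biproduct_def in_Hom by blast

text \<open>The identity of the biproduct is the sum of two idempotents; composing it with
  \<open>t\<close> expands \<open>t\<close> into components. Arrows out of or into a biproduct can
  thus be compared componentwise.\<close>

lemma biproduct_decomp:
  assumes "is_biproduct C x y j\<^sub>1 j\<^sub>2 q\<^sub>1 q\<^sub>2"
  shows "t \<in> Arr C \<Longrightarrow> Src C t = Tgt C j\<^sub>1 \<Longrightarrow> t = (t \<cdot> j\<^sub>1) \<cdot> q\<^sub>1 \<oplus> (t \<cdot> j\<^sub>2) \<cdot> q\<^sub>2"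
    and "t \<in> Arr C \<Longrightarrow> Tgt C t = Src C q\<^sub>1 \<Longrightarrow> t = j\<^sub>1 \<cdot> (q\<^sub>1 \<cdot> t) \<oplus> j\<^sub>2 \<cdot> (q\<^sub>2 \<cdot> t)"
proof -
  obtain z where z: "x \<in> Obj C" "y \<in> Obj C" "z \<in> Obj C"
    "j\<^sub>1 \<in> Arr C" "Src C j\<^sub>1 = x" "Tgt C j\<^sub>1 = z" "j\<^sub>2 \<in> Arr C" "Src C j\<^sub>2 = y" "Tgt C j\<^sub>2 = z"
    "q\<^sub>1 \<in> Arr C" "Src C q\<^sub>1 = z" "Tgt C q\<^sub>1 = x" "q\<^sub>2 \<in> Arr C" "Src C q\<^sub>2 = z" "Tgt C q\<^sub>2 = y"
    and *: "j\<^sub>1 \<cdot> q\<^sub>1 \<oplus> j\<^sub>2 \<cdot> q\<^sub>2 = Ident C z"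
    using assms by (rule biproductE)
  show "t = (t \<cdot> j\<^sub>1) \<cdot> q\<^sub>1 \<oplus> (t \<cdot> j\<^sub>2) \<cdot> q\<^sub>2" if "t \<in> Arr C" "Src C t = Tgt C j\<^sub>1"
  proof -
    have "t = t \<cdot> (j\<^sub>1 \<cdot> q\<^sub>1 \<oplus> j\<^sub>2 \<cdot> q\<^sub>2)"
      unfolding * using that z by simp
    then show ?thesis
      using that z by simp
  qed
  show "t = j\<^sub>1 \<cdot> (q\<^sub>1 \<cdot> t) \<oplus> j\<^sub>2 \<cdot> (q\<^sub>2 \<cdot> t)" if "t \<in> Arr C" "Tgt C t = Src C q\<^sub>1"
  proof -
    have "t = (j\<^sub>1 \<cdot> q\<^sub>1 \<oplus> j\<^sub>2 \<cdot> q\<^sub>2) \<cdot> t"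
      unfolding * using that z by simp
    then show ?thesis
      using that z by simp
  qed
qed

end

section \<open>Abelian categories\<close>

context abelian_category
begin

text \<open>By normality \<open>f\<close> is the kernel of some \<open>g\<close>, which factors
  through the cokernel \<open>q\<close> of \<open>f\<close>. So every arrow killed by
  \<open>q\<close> is killed by \<open>g\<close> and hence factors through \<open>f\<close>.\<close>

lemma mono_kernel_of_cokernel:
  assumes "is_mono C f" "is_cokernel C f q"
  shows "is_kernel C q f"
proof -
  obtain g where g: "is_kernel C g f"
    using mono_normal[OF assms(1)] by blast
  note [simp] = kernelD[OF g] cokernelD[OF assms(2)]
  obtain w where w: "w \<in> Arr C" "Tgt C w = Tgt C g" "Src C w = Tgt C q" "w \<cdot> q = g"
    by (rule cokernel_factor[OF assms(2), of g]) simp_all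
  show ?thesis
  proof (rule is_kernelI[OF _ assms(1)])
    fix h
    assume h: "h \<in> Arr C" "Tgt C h = Src C q" "q \<cdot> h = HZero C (Src C h) (Tgt C q)"
    have "g \<cdot> h = w \<cdot> (q \<cdot> h)"
      using w(1-3) h(1,2) by (subst w(4)[symmetric], intro Comp_assoc') simp_all
    then have "g \<cdot> h = HZero C (Src C h) (Tgt C g)"
      unfolding h(3) using w h(1,2) by simp
    then show "\<exists>u\<in>Arr C. Src C u = Src C h \<and> Tgt C u = Src C f \<and> f \<cdot> u = h"
      using kernel_factor[OF g, of h] h by (metis \<open>Src C q = Tgt C f\<close> kernelD(3) g)
  qed simp_all
qed

lemmas epi_cokernel_of_kernel =
  abelian_category.mono_kernel_of_cokernel[OF abelian_OpA, simplified]

text \<open>One half of exactness implies the other: a mono is the kernel of its cokernel, an epi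
  the cokernel of its kernel.\<close>

lemma short_exactI:
  "is_mono C i \<Longrightarrow> is_cokernel C i p \<Longrightarrow> short_exact C (i, p)"
  "is_epi C p \<Longrightarrow> is_kernel C p i \<Longrightarrow> short_exact C (i, p)"
  by (auto simp: short_exact_def mono_kernel_of_cokernel epi_cokernel_of_kernel)

lemma short_exactD:
  assumes "short_exact C (i, p)"
  shows "i \<in> Arr C" "p \<in> Arr C" "Src C p = Tgt C i" "p \<cdot> i = HZero C (Src C i) (Tgt C p)"
    "is_mono C i" "is_epi C p" "is_kernel C p i" "is_cokernel C i p"
  using assms kernelD[of p i] by (auto simp: short_exact_def intro: kernel_mono cokernel_epi)

text \<open>If \<open>f\<close> is the kernel of \<open>g\<close>, then \<open>f\<close> being epi
  forces \<open>g = 0\<close>, so the identity of the target factors through \<open>f\<close>. The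
  right inverse found this way is also a left inverse because \<open>f\<close> is mono.\<close>

lemma mono_epi_iso:
  assumes "is_mono C f" "is_epi C f"
  shows "is_iso_arr C f"
proof -
  obtain g where g: "is_kernel C g f"
    using mono_normal[OF assms(1)] by blast
  note [simp] = kernelD[OF g]
  have "g = HZero C (Src C g) (Tgt C g)"
    using epi_zero[OF assms(2), of g] by simp
  then have "g \<cdot> Ident C (Src C g) = HZero C (Src C g) (Tgt C g)"
    by (subst Comp_Ident) simp_all
  then obtain u where u: "u \<in> Arr C" "Src C u = Tgt C f" "Tgt C u = Src C f"
    "f \<cdot> u = Ident C (Tgt C f)"
    using kernel_factor[OF g, of "Ident C (Src C g)"] kernelD(3)[OF g] by auto
  have "f \<cdot> (u \<cdot> f) = f \<cdot> Ident C (Src C f)"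
    using u Comp_reassoc[OF u(4), of f] by simp
  then have "u \<cdot> f = Ident C (Src C f)"
    using u by (intro mono_cancel[OF assms(1), of "u \<cdot> f"]) simp_all
  then show ?thesis
    using u by (auto simp: is_iso_arr_def)
qed

text \<open>The pushout is the cokernel \<open>c\<close> of the arrow with components
  \<open>f\<close> and \<open>-g\<close> into the biproduct of the targets. Stability of monos is
  recorded together with the construction because its proof uses \<open>c\<close> itself.\<close>

lemma ex_pushout:
  assumes "f \<in> Arr C" "g \<in> Arr C" "Src C f = Src C g"
  obtains f' g' where "is_pushout C f g f' g'" "is_mono C f \<Longrightarrow> is_mono C g'"
proof -
  define x where "x = Src C g"
  define y where "y = Tgt C f"
  define z where "z = Tgt C g"
  have fg [simp]: "f \<in> Arr C" "g \<in> Arr C" "Src C f = x" "Src C g = x" "Tgt C f = y" "Tgt C g = z"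
    using assms by (simp_all add: x_def y_def z_def)
  have [simp]: "x \<in> Obj C" "y \<in> Obj C" "z \<in> Obj C"
    using fg Src_Obj Tgt_Obj by blast+
  obtain j\<^sub>1 j\<^sub>2 q\<^sub>1 q\<^sub>2 where bp: "is_biproduct C y z j\<^sub>1 j\<^sub>2 q\<^sub>1 q\<^sub>2"
    using has_biproducts[of y z] by auto
  obtain s where s [simp]: "s \<in> Obj C"
    "j\<^sub>1 \<in> Arr C" "Src C j\<^sub>1 = y" "Tgt C j\<^sub>1 = s" "j\<^sub>2 \<in> Arr C" "Src C j\<^sub>2 = z" "Tgt C j\<^sub>2 = s"
    "q\<^sub>1 \<in> Arr C" "Src C q\<^sub>1 = s" "Tgt C q\<^sub>1 = y" "q\<^sub>2 \<in> Arr C" "Src C q\<^sub>2 = s" "Tgt C q\<^sub>2 = z"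
    and qj: "q\<^sub>1 \<cdot> j\<^sub>1 = Ident C y" "q\<^sub>2 \<cdot> j\<^sub>2 = Ident C z" "q\<^sub>2 \<cdot> j\<^sub>1 = HZero C y z" "q\<^sub>1 \<cdot> j\<^sub>2 = HZero C z y"
    using bp by (rule biproductE)
  note qj' = qj[THEN Comp_reassoc]
  obtain n where n [simp]: "n \<in> Arr C" "Src C n = x" "Tgt C n = z"
    and gn: "g \<oplus> n = HZero C x z" "n \<oplus> g = HZero C x z"
    using ex_neg[of g] by auto
  \<comment> \<open>With \<open>n = -g\<close>, an arrow \<open>r\<close> out of the biproduct kills
    \<open>m\<close> exactly when \<open>(r \<cdot> j\<^sub>1) \<cdot> f = (r \<cdot> j\<^sub>2)
    \<cdot> g\<close>.\<close>
  define m where "m = j\<^sub>1 \<cdot> f \<oplus> j\<^sub>2 \<cdot> n"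
  have m [simp]: "m \<in> Arr C" "Src C m = x" "Tgt C m = s"
    by (simp_all add: m_def)
  obtain c where c: "is_cokernel C m c"
    using has_cokernels[of m] by auto
  define w where "w = Tgt C c"
  have c' [simp]: "c \<in> Arr C" "Src C c = s" "Tgt C c = w" and cm: "c \<cdot> m = HZero C x w"
    using cokernelD[OF c] by (simp_all add: w_def)
  have [simp]: "w \<in> Obj C"
    using c' Tgt_Obj by blast
  have comm: "c \<cdot> (j\<^sub>1 \<cdot> f) = c \<cdot> (j\<^sub>2 \<cdot> g)"
  proof (rule HAdd_right_cancel)
    have "c \<cdot> (j\<^sub>2 \<cdot> g) \<oplus> c \<cdot> (j\<^sub>2 \<cdot> n) = c \<cdot> (j\<^sub>2 \<cdot> (g \<oplus> n))"
      by simp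
    also have "\<dots> = c \<cdot> m"
      unfolding gn cm by simp
    finally show "c \<cdot> (j\<^sub>1 \<cdot> f) \<oplus> c \<cdot> (j\<^sub>2 \<cdot> n) = c \<cdot> (j\<^sub>2 \<cdot> g) \<oplus> c \<cdot> (j\<^sub>2 \<cdot> n)"
      by (simp add: m_def)
  qed simp_all
  have "is_pushout C f g (c \<cdot> j\<^sub>1) (c \<cdot> j\<^sub>2)"
  proof (rule is_pushoutI)
    fix u v
    assume uv0: "u \<in> Arr C" "v \<in> Arr C" "Src C u = Tgt C f" "Src C v = Tgt C g" "Tgt C u = Tgt C v"
      and eq: "u \<cdot> f = v \<cdot> g"
    define t where "t = Tgt C v"
    have uv [simp]: "u \<in> Arr C" "v \<in> Arr C" "Src C u = y" "Src C v = z" "Tgt C u = t" "Tgt C v = t"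
      using uv0 by (simp_all add: t_def)
    have [simp]: "t \<in> Obj C"
      using uv Tgt_Obj by blast
    define r where "r = u \<cdot> q\<^sub>1 \<oplus> v \<cdot> q\<^sub>2"
    have r [simp]: "r \<in> Arr C" "Src C r = s" "Tgt C r = t"
      by (simp_all add: r_def)
    have rj: "r \<cdot> j\<^sub>1 = u" "r \<cdot> j\<^sub>2 = v"
      by (simp_all add: r_def qj)
    have "r \<cdot> m = v \<cdot> (g \<oplus> n)"
      by (simp add: m_def Comp_reassoc[OF rj(1)] Comp_reassoc[OF rj(2)] eq)
    then have "r \<cdot> m = HZero C x t"
      by (simp add: gn)
    then obtain d where d: "d \<in> Arr C" "Tgt C d = t" "Src C d = w" "d \<cdot> c = r"
      using cokernel_factor[OF c, of r] by auto
    then show "\<exists>d\<in>Hom C (Tgt C (c \<cdot> j\<^sub>1)) (Tgt C v). d \<cdot> (c \<cdot> j\<^sub>1) = u \<and> d \<cdot> (c \<cdot> j\<^sub>2) = v"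
      by (intro bexI[of _ d]) (simp_all add: Comp_reassoc[OF d(4)] rj)
  next
    fix d d'
    assume d0: "d \<in> Arr C" "d' \<in> Arr C" "Src C d = Tgt C (c \<cdot> j\<^sub>1)" "Src C d' = Tgt C (c \<cdot> j\<^sub>1)"
      "Tgt C d = Tgt C d'" and eq: "d \<cdot> (c \<cdot> j\<^sub>1) = d' \<cdot> (c \<cdot> j\<^sub>1)" "d \<cdot> (c \<cdot> j\<^sub>2) = d' \<cdot> (c \<cdot> j\<^sub>2)"
    have d: "d \<in> Arr C" "d' \<in> Arr C" "Src C d = w" "Src C d' = w" "Tgt C d = Tgt C d'"
      using d0 by simp_all
    have "d \<cdot> c = d' \<cdot> c"
      using biproduct_decomp(1)[OF bp, of "d \<cdot> c"] biproduct_decomp(1)[OF bp, of "d' \<cdot> c"] d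
        Comp_assoc'[of q\<^sub>1 "c \<cdot> j\<^sub>1" d] Comp_assoc'[of q\<^sub>2 "c \<cdot> j\<^sub>2" d]
        Comp_assoc'[of q\<^sub>1 "c \<cdot> j\<^sub>1" d'] Comp_assoc'[of q\<^sub>2 "c \<cdot> j\<^sub>2" d'] by (simp add: eq)
    then show "d = d'"
      using d by (intro epi_cancel[OF cokernel_epi[OF c], of d d']) simp_all
  qed (simp_all add: comm)
  \<comment> \<open>When \<open>f\<close> is mono so is \<open>m\<close>, since
    \<open>q\<^sub>1 \<cdot> m = f\<close>; hence \<open>m\<close> is the kernel of
    \<open>c\<close>. If \<open>c \<cdot> j\<^sub>2\<close> kills \<open>a\<close>, then
    \<open>j\<^sub>2 \<cdot> a\<close> equals \<open>m \<cdot> u\<close> for some \<open>u\<close>;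
    its first component gives \<open>f \<cdot> u = 0\<close>, so \<open>u\<close> vanishes and with
    it \<open>a\<close>.\<close>
  moreover have "is_mono C (c \<cdot> j\<^sub>2)" if mf: "is_mono C f"
  proof (rule is_monoI)
    have q1m: "q\<^sub>1 \<cdot> m = f"
      by (simp add: m_def qj')
    have "is_mono C m"
      by (rule mono_of_comp[of q\<^sub>1]) (simp_all add: q1m mf)
    then have mk: "is_kernel C c m"
      using c by (rule mono_kernel_of_cokernel)
    fix a
    assume a0: "a \<in> Arr C" "Tgt C a = Src C (c \<cdot> j\<^sub>2)"
      and eq: "(c \<cdot> j\<^sub>2) \<cdot> a = HZero C (Src C a) (Tgt C (c \<cdot> j\<^sub>2))"
    have a [simp]: "a \<in> Arr C" "Tgt C a = z"
      using a0 by simp_all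
    have "c \<cdot> (j\<^sub>2 \<cdot> a) = HZero C (Src C a) w"
      using eq by simp
    then obtain u where u: "u \<in> Arr C" "Src C u = Src C a" "Tgt C u = x" "m \<cdot> u = j\<^sub>2 \<cdot> a"
      using kernel_factor[OF mk, of "j\<^sub>2 \<cdot> a"] by auto
    have "f \<cdot> u = q\<^sub>1 \<cdot> (j\<^sub>2 \<cdot> a)"
      using u by (simp add: Comp_reassoc[OF q1m] flip: u(4))
    then have "f \<cdot> u = HZero C (Src C u) y"
      by (simp add: qj' u)
    then have u0: "u = HZero C (Src C a) x"
      using mono_zero[OF mf, of u] u by simp
    have "a = q\<^sub>2 \<cdot> (j\<^sub>2 \<cdot> a)"
      by (simp add: qj')
    also have "\<dots> = HZero C (Src C a) z"
      unfolding u(4)[symmetric] u0 by simp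
    finally show "a = HZero C (Src C a) (Src C (c \<cdot> j\<^sub>2))"
      by simp
  qed simp
  ultimately show thesis
    by (rule that)
qed

end

section \<open>Morphisms of short exact sequences\<close>

text \<open>Short exactness of both sequences is built in and only the ends are exposed, so that
  morphisms can be composed and compared without naming their middle arrows.\<close>

definition emor :: "('o, 'a, 'z) ab_category_scheme \<Rightarrow> 'a \<Rightarrow> 'a \<Rightarrow> 'a \<times> 'a \<Rightarrow> 'a \<times> 'a \<Rightarrow> bool"
  where
  "emor C h g = (\<lambda>(i, p) (i', p'). short_exact C (i, p) \<and> short_exact C (i', p') \<and>
     h \<in> Hom C (Src C i) (Src C i') \<and> g \<in> Hom C (Tgt C p) (Tgt C p') \<and>
     (\<exists>e \<in> Hom C (Tgt C i) (Tgt C i'). e \<cdot>\<^bsub>C\<^esub> i = i' \<cdot>\<^bsub>C\<^esub> h \<and> p' \<cdot>\<^bsub>C\<^esub> e = g \<cdot>\<^bsub>C\<^esub> p))"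

lemma (in category) pushout_transport:
  assumes "is_pushout C f g f' g'" "is_iso_arr C t" "Src C t = Tgt C f'"
  shows "is_pushout C f g (t \<cdot> f') (t \<cdot> g')"
proof -
  note p [simp] = pushoutD[OF assms(1)]
  obtain s where s [simp]: "s \<in> Arr C" "Src C s = Tgt C t" "Tgt C s = Tgt C g'"
    and st: "s \<cdot> t = Ident C (Tgt C g')" "t \<cdot> s = Ident C (Tgt C t)" and [simp]: "t \<in> Arr C"
    using assms unfolding is_iso_arr_def by auto
  note st' = st[THEN Comp_reassoc]
  note [simp] = assms(3)
  show ?thesis
  proof (rule is_pushoutI)
    fix u v
    assume "u \<in> Arr C" "v \<in> Arr C" "Src C u = Tgt C f" "Src C v = Tgt C g" "Tgt C u = Tgt C v"
      and "u \<cdot> f = v \<cdot> g"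
    then obtain d where "d \<in> Arr C" "Src C d = Tgt C f'" "Tgt C d = Tgt C v" "d \<cdot> f' = u" "d \<cdot> g' = v"
      using pushout_factor[OF assms(1)] by metis
    then show "\<exists>d\<in>Hom C (Tgt C (t \<cdot> f')) (Tgt C v). d \<cdot> (t \<cdot> f') = u \<and> d \<cdot> (t \<cdot> g') = v"
      by (intro bexI[of _ "d \<cdot> s"]) (simp_all add: st')
  next
    fix d d'
    assume d: "d \<in> Arr C" "d' \<in> Arr C" "Src C d = Tgt C (t \<cdot> f')" "Src C d' = Tgt C (t \<cdot> f')"
      "Tgt C d = Tgt C d'" and eq: "d \<cdot> (t \<cdot> f') = d' \<cdot> (t \<cdot> f')" "d \<cdot> (t \<cdot> g') = d' \<cdot> (t \<cdot> g')"
    have "d \<cdot> t = d' \<cdot> t"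
      by (rule pushout_unique[OF assms(1)]) (use d eq in simp_all)
    then have "(d \<cdot> t) \<cdot> s = (d' \<cdot> t) \<cdot> s"
      by simp
    then show "d = d'"
      using d by (simp add: st)
  qed simp_all
qed

section \<open>Pushouts of short exact sequences and the short five lemma\<close>

context abelian_category
begin

text \<open>The pushout supplies the middle object, and \<open>p'\<close> is induced by
  \<open>p\<close> and zero. It is a cokernel of \<open>i'\<close>: if \<open>w\<close> kills
  \<open>i'\<close>, then \<open>w \<cdot> e\<close> kills \<open>i\<close> and descends along
  \<open>p\<close>.\<close>

lemma ses_pushout:
  assumes ip: "short_exact C (i, p)" and h0: "h \<in> Arr C" "Src C h = Src C i"
  obtains e i' p' where "is_pushout C i h e i'" "short_exact C (i', p')" "Tgt C p' = Tgt C p"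
    "p' \<cdot> e = p"
proof -
  define y where "y = Src C i"
  define a where "a = Tgt C i"
  define x where "x = Tgt C p"
  define y' where "y' = Tgt C h"
  have i [simp]: "i \<in> Arr C" "p \<in> Arr C" "Src C i = y" "Tgt C i = a" "Src C p = a" "Tgt C p = x"
    and pi: "p \<cdot> i = HZero C y x"
    and h [simp]: "h \<in> Arr C" "Src C h = y" "Tgt C h = y'"
    using short_exactD[OF ip] h0 by (simp_all add: y_def a_def x_def y'_def)
  have [simp]: "y \<in> Obj C" "a \<in> Obj C" "x \<in> Obj C" "y' \<in> Obj C"
    using i h Src_Obj Tgt_Obj by blast+
  obtain e i' where po: "is_pushout C i h e i'" and mono: "is_mono C i'"
    using ex_pushout[of i h] short_exactD(5)[OF ip] by auto
  define a' where "a' = Tgt C i'"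
  have e [simp]: "e \<in> Arr C" "Src C e = a" "Tgt C e = a'" "i' \<in> Arr C" "Src C i' = y'" "Tgt C i' = a'"
    and comm: "e \<cdot> i = i' \<cdot> h"
    using pushoutD[OF po] by (simp_all add: a'_def)
  obtain p' where p' [simp]: "p' \<in> Arr C" "Src C p' = a'" "Tgt C p' = x"
    and p'e: "p' \<cdot> e = p" and p'i: "p' \<cdot> i' = HZero C y' x"
    using pushout_factor[OF po, of p "HZero C y' x"] pi by auto
  have epi: "is_epi C p'"
    by (rule epi_of_comp[of _ e]) (simp_all add: p'e short_exactD[OF ip])
  have "is_cokernel C i' p'"
  proof (rule is_cokernelI)
    fix w
    assume w: "w \<in> Arr C" "Src C w = Tgt C i'" "w \<cdot> i' = HZero C (Src C i') (Tgt C w)"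
    have "(w \<cdot> e) \<cdot> i = (w \<cdot> i') \<cdot> h"
      using w(1,2) by (simp add: comm)
    then have "(w \<cdot> e) \<cdot> i = HZero C y (Tgt C w)"
      unfolding w(3) using w(1) by simp
    then obtain s where s: "s \<in> Arr C" "Tgt C s = Tgt C w" "Src C s = x" "s \<cdot> p = w \<cdot> e"
      using cokernel_factor[OF short_exactD(8)[OF ip], of "w \<cdot> e"] w by auto
    have "s \<cdot> p' = w"
      by (rule pushout_unique[OF po]) (use s w in \<open>simp_all add: p'e p'i\<close>)
    then show "\<exists>u\<in>Arr C. Tgt C u = Tgt C w \<and> Src C u = Tgt C p' \<and> u \<cdot> p' = w"
      using s by auto
  qed (simp_all add: epi p'i)
  then show thesis
    using that[of e i' p'] po mono p'e by (simp add: short_exactI)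
qed

text \<open>Mono half of the short five lemma for identity ends: an arrow killed by \<open>t\<close>
  is killed by \<open>p\<close>, hence is \<open>i \<cdot> v\<close> for some \<open>v\<close>; then
  \<open>i' \<cdot> v = 0\<close> and so \<open>v = 0\<close>.\<close>

lemma ses_iso_mono:
  assumes ip: "short_exact C (i, p)" and ip': "short_exact C (i', p')"
    and t0: "t \<in> Arr C" "Src C t = Tgt C i" "t \<cdot> i = i'" "p' \<cdot> t = p" "Src C p' = Tgt C t"
  shows "is_mono C t"
proof (rule is_monoI)
  define y where "y = Src C i"
  define a where "a = Tgt C i"
  define x where "x = Tgt C p"
  define b where "b = Tgt C t"
  have i [simp]: "i \<in> Arr C" "p \<in> Arr C" "Src C i = y" "Tgt C i = a" "Src C p = a" "Tgt C p = x"
    using short_exactD[OF ip] by (simp_all add: y_def a_def x_def)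
  have t [simp]: "t \<in> Arr C" "Src C t = a" "Tgt C t = b" "p' \<in> Arr C" "Src C p' = b"
    using t0(1,2,5) short_exactD(2)[OF ip'] by (simp_all add: b_def)
  have i' [simp]: "Tgt C p' = x" "Src C i' = y" "i' \<in> Arr C" "Tgt C i' = b"
    using arg_cong[OF t0(3), of "Src C"] arg_cong[OF t0(4), of "Tgt C"] short_exactD(1,3)[OF ip']
    by simp_all
  have [simp]: "y \<in> Obj C" "a \<in> Obj C" "x \<in> Obj C" "b \<in> Obj C"
    using i t Src_Obj Tgt_Obj by blast+
  fix g
  assume g0: "g \<in> Arr C" "Tgt C g = Src C t" "t \<cdot> g = HZero C (Src C g) (Tgt C t)"
  define w where "w = Src C g"
  have g [simp]: "g \<in> Arr C" "Tgt C g = a" "Src C g = w" and tg: "t \<cdot> g = HZero C w b"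
    using g0 by (simp_all add: w_def)
  have [simp]: "w \<in> Obj C"
    using g Src_Obj by blast
  have "p \<cdot> g = p' \<cdot> (t \<cdot> g)"
    by (simp add: Comp_reassoc[OF t0(4)])
  then have "p \<cdot> g = HZero C w x"
    by (simp add: tg)
  then obtain v where v: "v \<in> Arr C" "Src C v = w" "Tgt C v = y" "i \<cdot> v = g"
    using kernel_factor[OF short_exactD(7)[OF ip], of g] by auto
  have "i' \<cdot> v = t \<cdot> g"
    using v(1-3) by (simp add: Comp_reassoc[OF t0(3)] flip: v(4))
  then have "v = HZero C w y"
    using mono_zero[OF short_exactD(5)[OF ip'], of v] v tg by simp
  then show "g = HZero C (Src C g) (Src C t)"
    using v(4) by simp
qed (rule t0)

lemma ses_iso:
  assumes "short_exact C (i, p)" "short_exact C (i', p')"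
    and "t \<in> Arr C" "Src C t = Tgt C i" "t \<cdot> i = i'" "p' \<cdot> t = p" "Src C p' = Tgt C t"
  shows "is_iso_arr C t"
proof (rule mono_epi_iso)
  show "is_mono C t"
    using assms by (rule ses_iso_mono)
  show "is_epi C t"
    \<comment> \<open>In the opposite category \<open>t\<close> runs from the reversed second
      sequence to the reversed first, so the epi half is the mono half there.\<close>
    using abelian_category.ses_iso_mono[OF abelian_OpA, of p' i' p i t] assms by simp
qed

text \<open>Comparison with a constructed pushout sequence yields an arrow \<open>t\<close> with
  identity ends; it is an isomorphism by the short five lemma and carries the pushout property over.
  Commuting squares over an identity right end are thus already a pushout.\<close>

lemma pushout_of_ses_morphism:
  assumes ip: "short_exact C (i, p)" and ip': "short_exact C (i', p')"
    and h: "h \<in> Hom C (Src C i) (Src C i')" and e: "e \<in> Hom C (Tgt C i) (Tgt C i')"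
    and comm: "e \<cdot> i = i' \<cdot> h" "p' \<cdot> e = p"
  shows "is_pushout C i h e i'"
proof -
  obtain a j q where po: "is_pushout C i h a j" and jq: "short_exact C (j, q)" "Tgt C q = Tgt C p"
    and qa: "q \<cdot> a = p"
    using ses_pushout[OF ip, of h] h by auto
  note [simp] = pushoutD(1-8)[OF po] short_exactD(1-3)[OF ip'] short_exactD(1-3)[OF jq(1)]
  obtain t where t: "t \<in> Arr C" "Src C t = Tgt C a" "Tgt C t = Tgt C i'" "t \<cdot> a = e" "t \<cdot> j = i'"
    using pushout_factor[OF po, of e i'] h e comm by auto
  have p'[simp]: "Tgt C p' = Tgt C p"
    using arg_cong[OF comm(2), of "Tgt C"] e by simp
  \<comment> \<open>Equality out of a pushout is tested on its two legs; on \<open>j\<close> both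
    sides vanish.\<close>
  have "p' \<cdot> t = q"
  proof (rule pushout_unique[OF po])
    show "(p' \<cdot> t) \<cdot> a = q \<cdot> a"
      using t(1-3) by (simp add: t(4) comm qa)
    show "(p' \<cdot> t) \<cdot> j = q \<cdot> j"
      using t(1-3) short_exactD(4)[OF jq(1)] short_exactD(4)[OF ip'] h by (simp add: t(5) jq(2))
  qed (use t(1-3) jq(2) in simp_all)
  then have "is_iso_arr C t"
    using ses_iso[OF jq(1) ip', of t] t by simp
  then show ?thesis
    using pushout_transport[OF po, of t] t by simp
qed

lemma emorE:
  assumes "emor C h g (i, p) (i', p')"
  obtains e y a x y' a' x' where "y \<in> Obj C" "a \<in> Obj C" "x \<in> Obj C" "y' \<in> Obj C" "a' \<in> Obj C" "x' \<in> Obj C"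
    "i \<in> Arr C" "Src C i = y" "Tgt C i = a" "p \<in> Arr C" "Src C p = a" "Tgt C p = x"
    "i' \<in> Arr C" "Src C i' = y'" "Tgt C i' = a'" "p' \<in> Arr C" "Src C p' = a'" "Tgt C p' = x'"
    "h \<in> Arr C" "Src C h = y" "Tgt C h = y'" "g \<in> Arr C" "Src C g = x" "Tgt C g = x'"
    "e \<in> Arr C" "Src C e = a" "Tgt C e = a'"
    "e \<cdot> i = i' \<cdot> h" "p' \<cdot> e = g \<cdot> p" "p \<cdot> i = HZero C y x" "p' \<cdot> i' = HZero C y' x'"
    "short_exact C (i, p)" "short_exact C (i', p')"
proof -
  have ip: "short_exact C (i, p)" and ip': "short_exact C (i', p')"
    using assms by (simp_all add: emor_def)
  note a = short_exactD[OF ip] and b = short_exactD[OF ip']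
  obtain e where e: "e \<in> Arr C" "Src C e = Tgt C i" "Tgt C e = Tgt C i'"
    "e \<cdot> i = i' \<cdot> h" "p' \<cdot> e = g \<cdot> p"
    using assms by (auto simp: emor_def)
  show thesis
    by (rule that[of "Src C i" "Tgt C i" "Tgt C p" "Src C i'" "Tgt C i'" "Tgt C p'" e])
      (use assms a b e in \<open>simp_all add: emor_def\<close>)
qed

lemma emor_shape:
  assumes "emor C h g \<epsilon> \<epsilon>'"
  shows "short_exact C \<epsilon>" "short_exact C \<epsilon>'" "h \<in> Arr C" "g \<in> Arr C"
    "Src C h = Src C (fst \<epsilon>)" "Tgt C h = Src C (fst \<epsilon>')"
    "Src C g = Tgt C (snd \<epsilon>)" "Tgt C g = Tgt C (snd \<epsilon>')"
  using assms by (auto simp: emor_def)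

lemma emor_Ident:
  assumes "short_exact C \<epsilon>"
  shows "emor C (Ident C (Src C (fst \<epsilon>))) (Ident C (Tgt C (snd \<epsilon>))) \<epsilon> \<epsilon>"
proof -
  obtain i p where \<epsilon>: "\<epsilon> = (i, p)"
    by (cases \<epsilon>)
  show ?thesis
    using short_exactD(1-3)[of i p] assms unfolding \<epsilon> emor_def
    by (auto intro!: bexI[of _ "Ident C (Tgt C i)"])
qed

lemma emor_trans:
  assumes "emor C h g \<epsilon> \<epsilon>'" "emor C k l \<epsilon>' \<epsilon>''"
  shows "emor C (k \<cdot> h) (l \<cdot> g) \<epsilon> \<epsilon>''"
proof -
  obtain i p i' p' i'' p'' where \<epsilon>: "\<epsilon> = (i, p)" "\<epsilon>' = (i', p')" "\<epsilon>'' = (i'', p'')"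
    by (metis surj_pair)
  obtain e where e: "e \<in> Arr C" "Src C e = Tgt C i" "Tgt C e = Tgt C i'"
    "e \<cdot> i = i' \<cdot> h" "p' \<cdot> e = g \<cdot> p"
    using assms(1) by (auto simp: emor_def \<epsilon>)
  obtain f where f: "f \<in> Arr C" "Src C f = Tgt C i'" "Tgt C f = Tgt C i''"
    "f \<cdot> i' = i'' \<cdot> k" "p'' \<cdot> f = l \<cdot> p'"
    using assms(2) by (auto simp: emor_def \<epsilon>)
  have s: "short_exact C (i, p)" "short_exact C (i', p')" "short_exact C (i'', p'')"
    and hg [simp]: "h \<in> Arr C" "Src C h = Src C i" "Tgt C h = Src C i'"
    "g \<in> Arr C" "Src C g = Tgt C p" "Tgt C g = Tgt C p'"
    "k \<in> Arr C" "Src C k = Src C i'" "Tgt C k = Src C i''"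
    "l \<in> Arr C" "Src C l = Tgt C p'" "Tgt C l = Tgt C p''"
    using assms by (auto simp: emor_def \<epsilon>)
  note [simp] = short_exactD(1-3)[OF s(1)] short_exactD(1-3)[OF s(2)] short_exactD(1-3)[OF s(3)]
  have "(f \<cdot> e) \<cdot> i = i'' \<cdot> (k \<cdot> h)"
    using e(1-3) f(1-3) by (simp add: e(4) Comp_reassoc[OF f(4)])
  moreover have "p'' \<cdot> (f \<cdot> e) = (l \<cdot> g) \<cdot> p"
    using e(1-3) f(1-3) by (simp add: e(5) Comp_reassoc[OF f(5)])
  ultimately show ?thesis
    using s e(1-3) f(1-3) unfolding emor_def \<epsilon>
    by (auto intro!: bexI[of _ "f \<cdot> e"])
qed

text \<open>The universal property of the pushout sequence \<open>\<epsilon>\<^sub>1\<close> of \<open>\<epsilon>\<close> along \<open>h\<close>.\<close>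

lemma emor_pushout_cancel:
  assumes "emor C (k \<cdot> h) g \<epsilon> \<epsilon>'" "emor C h (Ident C (Tgt C (snd \<epsilon>))) \<epsilon> \<epsilon>\<^sub>1"
    "k \<in> Hom C (Tgt C h) (Src C (fst \<epsilon>'))"
  shows "emor C k g \<epsilon>\<^sub>1 \<epsilon>'"
proof -
  obtain i p i' p' j q where \<epsilon>: "\<epsilon> = (i, p)" "\<epsilon>' = (i', p')" "\<epsilon>\<^sub>1 = (j, q)"
    by (metis surj_pair)
  obtain e where e: "e \<in> Arr C" "Src C e = Tgt C i" "Tgt C e = Tgt C i'"
    "e \<cdot> i = i' \<cdot> (k \<cdot> h)" "p' \<cdot> e = g \<cdot> p"
    using assms(1) by (auto simp: emor_def \<epsilon>)
  obtain f where f: "f \<in> Arr C" "Src C f = Tgt C i" "Tgt C f = Tgt C j"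
    "f \<cdot> i = j \<cdot> h" "q \<cdot> f = Ident C (Tgt C p) \<cdot> p"
    using assms(2) by (auto simp: emor_def \<epsilon>)
  have s: "short_exact C (i, p)" "short_exact C (j, q)" "short_exact C (i', p')"
    and hg [simp]: "h \<in> Arr C" "Src C h = Src C i" "Tgt C h = Src C j"
    "g \<in> Arr C" "Src C g = Tgt C p" "Tgt C g = Tgt C p'"
    "k \<in> Arr C" "Src C k = Src C j" "Tgt C k = Src C i'" "Tgt C q = Tgt C p"
    using assms short_exactD(2)[of i p] by (auto simp: emor_def \<epsilon>)
  note [simp] = short_exactD(1-3)[OF s(1)] short_exactD(1-3)[OF s(2)] short_exactD(1-3)[OF s(3)]
  have qf: "q \<cdot> f = p"
    using f(5) by simp
  have po: "is_pushout C i h f j"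
    by (rule pushout_of_ses_morphism[OF s(1,2)]) (use f(1-4) qf in simp_all)
  obtain t where t: "t \<in> Arr C" "Src C t = Tgt C f" "Tgt C t = Tgt C i'" "t \<cdot> f = e" "t \<cdot> j = i' \<cdot> k"
    using pushout_factor[OF po, of e "i' \<cdot> k"] e by auto
  \<comment> \<open>The left square commutes by the choice of \<open>t\<close>. The right one is
    tested on the two legs of the pushout, and along \<open>j\<close> both of its sides are
    zero.\<close>
  have "p' \<cdot> t = g \<cdot> q"
  proof (rule pushout_unique[OF po])
    show "(p' \<cdot> t) \<cdot> f = (g \<cdot> q) \<cdot> f"
      using t(1-3) e(5) f(1-3) by (simp add: t(4) qf)
    show "(p' \<cdot> t) \<cdot> j = (g \<cdot> q) \<cdot> j"
      using t(1-3) f(1-3) short_exactD(4)[OF s(2)] short_exactD(4)[OF s(3)]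
        Comp_reassoc[OF short_exactD(4)[OF s(3)], of k]
      by (simp add: t(5))
  qed (use t(1-3) f(1-3) in simp_all)
  then show ?thesis
    using t f(1-3) s unfolding emor_def \<epsilon> by auto
qed

text \<open>Reversing arrows exchanges the two ends, the two arrows of each sequence and the
  direction of the morphism, so facts about pushout sequences turn into facts about pullback
  sequences.\<close>

lemma emor_OpA: "emor (OpA C) g h (p, i) (p', i') \<longleftrightarrow> emor C h g (i', p') (i, p)"
  using short_exactD(3)[of i p] short_exactD(3)[of i' p']
  by (auto simp: emor_def Bex_def)

text \<open>Dual to the pushout rule: \<open>\<epsilon>\<^sub>1\<close> is a pullback of
  \<open>\<epsilon>\<close> along \<open>g\<close>, and a morphism into \<open>\<epsilon>\<close>
  whose right end factors through \<open>g\<close> lifts to it.\<close>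

lemma emor_pullback_cancel:
  assumes "emor C h (g \<cdot> l) \<epsilon>' \<epsilon>" "emor C (Ident C (Src C (fst \<epsilon>))) g \<epsilon>\<^sub>1 \<epsilon>"
    "l \<in> Hom C (Tgt C (snd \<epsilon>')) (Src C g)"
  shows "emor C h l \<epsilon>' \<epsilon>\<^sub>1"
proof -
  obtain i p i' p' j q where \<epsilon>: "\<epsilon> = (i, p)" "\<epsilon>' = (i', p')" "\<epsilon>\<^sub>1 = (j, q)"
    by (metis surj_pair)
  show ?thesis
    using abelian_category.emor_pushout_cancel[OF abelian_OpA, of l g h "(p, i)" "(p', i')" "(q, j)"] assms
    by (auto simp: \<epsilon> emor_OpA)
qed

text \<open>The short five lemma makes the middle arrow of a morphism with identity ends invertible,
  so the isomorphism demanded by \<open>ext_rel\<close> is automatic.\<close>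

lemma ext_rel_iff:
  "(\<epsilon>, \<epsilon>') \<in> ext_rel C \<longleftrightarrow> emor C (Ident C (Src C (fst \<epsilon>))) (Ident C (Tgt C (snd \<epsilon>))) \<epsilon> \<epsilon>'"
proof -
  obtain i p i' p' where \<epsilon>: "\<epsilon> = (i, p)" "\<epsilon>' = (i', p')"
    by (metis surj_pair)
  show ?thesis
  proof
    assume "(\<epsilon>, \<epsilon>') \<in> ext_rel C"
    then show "emor C (Ident C (Src C (fst \<epsilon>))) (Ident C (Tgt C (snd \<epsilon>))) \<epsilon> \<epsilon>'"
      using short_exactD(1-3)[of i p] short_exactD(1-3)[of i' p']
      by (auto simp: ext_rel_def \<epsilon> emor_def)
  next
    assume r: "emor C (Ident C (Src C (fst \<epsilon>))) (Ident C (Tgt C (snd \<epsilon>))) \<epsilon> \<epsilon>'"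
    then have s: "short_exact C (i, p)" "short_exact C (i', p')"
      by (simp_all add: emor_def \<epsilon>)
    obtain e where e: "e \<in> Arr C" "Src C e = Tgt C i" "Tgt C e = Tgt C i'"
      and "e \<cdot> i = i' \<cdot> Ident C (Src C i)" "p' \<cdot> e = Ident C (Tgt C p) \<cdot> p"
      using r by (auto simp: emor_def \<epsilon>)
    moreover note [simp] = short_exactD(1-3)[OF s(1)] short_exactD(1-3)[OF s(2)]
    moreover have "Src C i' = Src C i" "Tgt C p' = Tgt C p"
      using emor_shape(6,8)[OF r] by (simp_all add: \<epsilon>)
    ultimately have e': "e \<cdot> i = i'" "p' \<cdot> e = p" "Src C i' = Src C i" "Tgt C p' = Tgt C p"
      by simp_all
    have "is_iso_arr C e"
      by (rule ses_iso[OF s]) (use e e' in simp_all)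
    then show "(\<epsilon>, \<epsilon>') \<in> ext_rel C"
      using e e' s unfolding ext_rel_def \<epsilon> by auto
  qed
qed

text \<open>Once the right end is an identity, \<open>pushout_of_ses_morphism\<close> supplies the
  universal property from commutativity alone.\<close>

lemma pushout_ext_iff:
  "pushout_ext C h \<epsilon> \<epsilon>' \<longleftrightarrow> emor C h (Ident C (Tgt C (snd \<epsilon>))) \<epsilon> \<epsilon>'"
proof -
  obtain i p i' p' where \<epsilon>: "\<epsilon> = (i, p)" "\<epsilon>' = (i', p')"
    by (metis surj_pair)
  show ?thesis
  proof
    assume r: "pushout_ext C h \<epsilon> \<epsilon>'"
    then have s: "short_exact C (i, p)" "short_exact C (i', p')"
      by (simp_all add: pushout_ext_def \<epsilon>)
    note [simp] = short_exactD(1-3)[OF s(1)] short_exactD(1-3)[OF s(2)]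
    obtain e where e: "is_pushout C i h e i'" "p' \<cdot> e = p" "Tgt C p' = Tgt C p"
      using r by (auto simp: pushout_ext_def \<epsilon>)
    show "emor C h (Ident C (Tgt C (snd \<epsilon>))) \<epsilon> \<epsilon>'"
      using pushoutD[OF e(1)] e(2,3) s by (auto simp: emor_def \<epsilon> intro!: bexI[of _ e])
  next
    assume r: "emor C h (Ident C (Tgt C (snd \<epsilon>))) \<epsilon> \<epsilon>'"
    then have s: "short_exact C (i, p)" "short_exact C (i', p')"
      by (simp_all add: emor_def \<epsilon>)
    obtain e where e: "e \<in> Arr C" "Src C e = Tgt C i" "Tgt C e = Tgt C i'" "e \<cdot> i = i' \<cdot> h"
      and "p' \<cdot> e = Ident C (Tgt C p) \<cdot> p"
      using r by (auto simp: emor_def \<epsilon>)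
    moreover note [simp] = short_exactD(1-3)[OF s(1)] short_exactD(1-3)[OF s(2)]
    moreover have "h \<in> Hom C (Src C i) (Src C i')" "Tgt C p' = Tgt C p"
      using emor_shape(3,5,6,8)[OF r] by (simp_all add: \<epsilon>)
    ultimately have e': "p' \<cdot> e = p" "h \<in> Hom C (Src C i) (Src C i')" "Tgt C p' = Tgt C p"
      by simp_all
    have "is_pushout C i h e i'"
      by (rule pushout_of_ses_morphism[OF s]) (use e e' in simp_all)
    then show "pushout_ext C h \<epsilon> \<epsilon>'"
      using s e e' by (auto simp: pushout_ext_def \<epsilon>)
  qed
qed

lemma pullback_ext_OpA: "pushout_ext (OpA C) g (p, i) (p', i') \<longleftrightarrow> pullback_ext C g (i, p) (i', p')"
  by (auto simp: pushout_ext_def pullback_ext_def)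

lemma pullback_ext_iff:
  "pullback_ext C g \<epsilon> \<epsilon>' \<longleftrightarrow> emor C (Ident C (Src C (fst \<epsilon>))) g \<epsilon>' \<epsilon>"
proof -
  obtain i p i' p' where \<epsilon>: "\<epsilon> = (i, p)" "\<epsilon>' = (i', p')"
    by (metis surj_pair)
  show ?thesis
    using abelian_category.pushout_ext_iff[OF abelian_OpA, of g "(p, i)" "(p', i')"]
    by (simp add: \<epsilon> pullback_ext_OpA emor_OpA)
qed

lemma ex_pushout_ext:
  assumes "short_exact C \<epsilon>" "h \<in> Arr C" "Src C h = Src C (fst \<epsilon>)"
  obtains \<epsilon>' where "pushout_ext C h \<epsilon> \<epsilon>'"
proof -
  obtain i p where \<epsilon>: "\<epsilon> = (i, p)"
    by (cases \<epsilon>)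
  obtain e i' p' where "is_pushout C i h e i'" "short_exact C (i', p')" "Tgt C p' = Tgt C p" "p' \<cdot> e = p"
    by (rule ses_pushout[of i p h]) (use assms in \<open>simp_all add: \<epsilon>\<close>)
  then have "pushout_ext C h \<epsilon> (i', p')"
    using assms(1) unfolding pushout_ext_def \<epsilon> by blast
  then show thesis
    by (rule that)
qed

lemma ex_pullback_ext:
  assumes "short_exact C \<epsilon>" "g \<in> Arr C" "Tgt C g = Tgt C (snd \<epsilon>)"
  obtains \<epsilon>' where "pullback_ext C g \<epsilon> \<epsilon>'"
proof -
  obtain i p where \<epsilon>: "\<epsilon> = (i, p)"
    by (cases \<epsilon>)
  obtain q j where "pushout_ext (OpA C) g (p, i) (q, j)"
    by (rule abelian_category.ex_pushout_ext[OF abelian_OpA, of "(p, i)" g])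
      (use assms in \<open>auto simp: \<epsilon>\<close>)
  then show thesis
    using that by (simp add: \<epsilon> pullback_ext_OpA)
qed

end

section \<open>Extension classes\<close>

context abelian_category
begin

lemma ext_rel_refl: "short_exact C \<epsilon> \<Longrightarrow> (\<epsilon>, \<epsilon>) \<in> ext_rel C"
  unfolding ext_rel_iff by (rule emor_Ident)

lemma fst_snd_ses [simp]:
  assumes "short_exact C \<epsilon>"
  shows "fst \<epsilon> \<in> Arr C" "snd \<epsilon> \<in> Arr C"
  using assms short_exactD(1,2)[of "fst \<epsilon>" "snd \<epsilon>"] by simp_all

lemma ext_rel_ends:
  assumes "(\<epsilon>, \<epsilon>') \<in> ext_rel C"
  shows "Src C (fst \<epsilon>') = Src C (fst \<epsilon>)" "Tgt C (snd \<epsilon>') = Tgt C (snd \<epsilon>)"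
    "short_exact C \<epsilon>" "short_exact C \<epsilon>'"
  using assms by (auto simp: ext_rel_def)

text \<open>The given equivalence is a pushout along an identity; cancelling it from the identity
  morphism of \<open>\<epsilon>\<close> leaves a morphism in the reverse direction.\<close>

lemma ext_rel_sym:
  assumes "(\<epsilon>, \<epsilon>') \<in> ext_rel C"
  shows "(\<epsilon>', \<epsilon>) \<in> ext_rel C"
proof -
  note [simp] = ext_rel_ends[OF assms]
  have "emor C (Ident C (Src C (fst \<epsilon>)) \<cdot> Ident C (Src C (fst \<epsilon>))) (Ident C (Tgt C (snd \<epsilon>))) \<epsilon> \<epsilon>"
    using emor_Ident[of \<epsilon>] by simp
  then have "emor C (Ident C (Src C (fst \<epsilon>))) (Ident C (Tgt C (snd \<epsilon>))) \<epsilon>' \<epsilon>"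
    by (rule emor_pushout_cancel) (use assms ext_rel_iff in simp_all)
  then show ?thesis
    by (simp add: ext_rel_iff)
qed

lemma ext_rel_trans:
  assumes "(\<epsilon>, \<epsilon>') \<in> ext_rel C" "(\<epsilon>', \<epsilon>'') \<in> ext_rel C"
  shows "(\<epsilon>, \<epsilon>'') \<in> ext_rel C"
  using emor_trans[of _ _ \<epsilon> \<epsilon>' _ _ \<epsilon>''] assms ext_rel_ends[OF assms(1)] by (fastforce simp: ext_rel_iff)

lemma equiv_ext_rel: "equiv {\<epsilon>. short_exact C \<epsilon>} (ext_rel C)"
  by (intro equivI refl_onI symI transI)
    (auto intro: ext_rel_refl ext_rel_sym ext_rel_trans dest: ext_rel_ends)

lemma ext_class_eqI: "(\<epsilon>, \<epsilon>') \<in> ext_rel C \<Longrightarrow> ext_class C \<epsilon> = ext_class C \<epsilon>'"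
  by (rule equiv_class_eq[OF equiv_ext_rel])

lemma ext_class_eqD: "ext_class C \<epsilon> = ext_class C \<epsilon>' \<Longrightarrow> short_exact C \<epsilon>' \<Longrightarrow> (\<epsilon>, \<epsilon>') \<in> ext_rel C"
  using eq_equiv_class[OF _ equiv_ext_rel] by blast

lemma Ext1_carrier_iff:
  "c \<in> carrier (Ext1 C X Y) \<longleftrightarrow>
    (\<exists>\<epsilon>. short_exact C \<epsilon> \<and> Src C (fst \<epsilon>) = Y \<and> Tgt C (snd \<epsilon>) = X \<and> c = ext_class C \<epsilon>)"
  unfolding Ext1_def extensions_def quotient_def by auto

text \<open>A union over representatives and choices collapses to one class as soon as one choice
  exists and every choice is equivalent to it. \<open>R\<close> stands for the pushout or the
  pullback construction.\<close>

lemma ext_class_UN: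
  assumes "short_exact C \<epsilon>" "R \<epsilon> \<eta>"
    and "\<And>\<delta> \<delta>'. (\<epsilon>, \<delta>) \<in> ext_rel C \<Longrightarrow> R \<delta> \<delta>' \<Longrightarrow> (\<eta>, \<delta>') \<in> ext_rel C"
  shows "(\<Union>\<delta> \<in> ext_class C \<epsilon>. \<Union>\<delta>' \<in> {\<delta>'. R \<delta> \<delta>'}. ext_class C \<delta>') = ext_class C \<eta>"
proof -
  have "ext_class C \<delta>' = ext_class C \<eta>" if "\<delta> \<in> ext_class C \<epsilon>" "R \<delta> \<delta>'" for \<delta> \<delta>'
    using assms(3)[of \<delta> \<delta>'] that ext_class_eqI by blast
  moreover have "\<epsilon> \<in> ext_class C \<epsilon>"
    using ext_rel_refl[OF assms(1)] by blast
  ultimately show ?thesis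
    using assms(2) by blast
qed

lemma emor_ext_rel_source:
  assumes "emor C h g \<epsilon> \<epsilon>'" "(\<delta>, \<epsilon>) \<in> ext_rel C"
  shows "emor C h g \<delta> \<epsilon>'"
  using emor_trans[of _ _ \<delta> \<epsilon> h g \<epsilon>'] assms ext_rel_ends[OF assms(2)] emor_shape[OF assms(1)]
  by (fastforce simp: ext_rel_iff)

lemma emor_ext_rel_target:
  assumes "emor C h g \<epsilon> \<epsilon>'" "(\<epsilon>', \<delta>) \<in> ext_rel C"
  shows "emor C h g \<epsilon> \<delta>"
  using emor_trans[of h g \<epsilon> \<epsilon>' _ _ \<delta>] assms emor_shape[OF assms(1)]
  by (fastforce simp: ext_rel_iff)

text \<open>Both sequences are pushouts of \<open>\<epsilon>\<close> along \<open>h\<close>;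
  cancelling the first from the second leaves a morphism with identity ends.\<close>

lemma emor_pushout_unique:
  assumes "emor C h (Ident C (Tgt C (snd \<epsilon>))) \<epsilon> \<epsilon>'" "emor C h (Ident C (Tgt C (snd \<epsilon>))) \<epsilon> \<epsilon>''"
  shows "(\<epsilon>', \<epsilon>'') \<in> ext_rel C"
proof -
  note [simp] = emor_shape(1-3)[OF assms(1)] emor_shape(2)[OF assms(2)]
  have ends: "Tgt C (snd \<epsilon>') = Tgt C (snd \<epsilon>)" "Src C (fst \<epsilon>'') = Src C (fst \<epsilon>')"
    using emor_shape(8)[OF assms(1)] emor_shape(6)[OF assms(2)] emor_shape(6)[OF assms(1)] by simp_all
  have "emor C (Ident C (Src C (fst \<epsilon>')) \<cdot> h) (Ident C (Tgt C (snd \<epsilon>))) \<epsilon> \<epsilon>''"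
    using assms(2) emor_shape(6)[OF assms(1)] by simp
  then show ?thesis
    unfolding ext_rel_iff ends by (rule emor_pushout_cancel)
      (use assms(1) ends emor_shape(6)[OF assms(1)] in simp_all)
qed

lemma emor_pullback_unique:
  assumes "emor C (Ident C (Src C (fst \<epsilon>))) g \<epsilon>' \<epsilon>" "emor C (Ident C (Src C (fst \<epsilon>))) g \<epsilon>'' \<epsilon>"
  shows "(\<epsilon>', \<epsilon>'') \<in> ext_rel C"
proof -
  note [simp] = emor_shape(1,2,4)[OF assms(1)] emor_shape(1)[OF assms(2)]
  have ends: "Src C (fst \<epsilon>') = Src C (fst \<epsilon>)" "Tgt C (snd \<epsilon>'') = Tgt C (snd \<epsilon>')"
    using emor_shape(5)[OF assms(1)] emor_shape(7)[OF assms(2)] emor_shape(7)[OF assms(1)] by simp_all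
  have "emor C (Ident C (Src C (fst \<epsilon>))) (g \<cdot> Ident C (Tgt C (snd \<epsilon>'))) \<epsilon>' \<epsilon>"
    using assms(1) emor_shape(7)[OF assms(1)] ends(2) by simp
  then show ?thesis
    unfolding ext_rel_iff ends by (rule emor_pullback_cancel)
      (use assms(2) ends emor_shape(7)[OF assms(1)] in simp_all)
qed

text \<open>Another representative \<open>\<delta>\<close> is equivalent to
  \<open>\<epsilon>\<close>, so precomposing turns any pushout of \<open>\<delta>\<close> into a
  pushout of \<open>\<epsilon>\<close>, and these agree up to equivalence. A single morphism with
  left end \<open>h\<close> therefore computes the action on the whole class.\<close>

lemma ext_push_class:
  assumes "emor C h (Ident C (Tgt C (snd \<epsilon>))) \<epsilon> \<epsilon>'"
  shows "ext_push C h (ext_class C \<epsilon>) = ext_class C \<epsilon>'"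
  unfolding ext_push_def
proof (rule ext_class_UN)
  fix \<delta> \<delta>'
  assume \<delta>: "(\<epsilon>, \<delta>) \<in> ext_rel C" and "pushout_ext C h \<delta> \<delta>'"
  then have "emor C h (Ident C (Tgt C (snd \<epsilon>))) \<epsilon> \<delta>'"
    using emor_ext_rel_source ext_rel_ends(2)[OF \<delta>] by (metis pushout_ext_iff)
  then show "(\<epsilon>', \<delta>') \<in> ext_rel C"
    by (rule emor_pushout_unique[OF assms])
qed (use assms emor_shape(1)[OF assms] in \<open>simp_all add: pushout_ext_iff\<close>)

lemma ext_pull_class:
  assumes "emor C (Ident C (Src C (fst \<epsilon>))) g \<epsilon>' \<epsilon>"
  shows "ext_pull C g (ext_class C \<epsilon>) = ext_class C \<epsilon>'"
  unfolding ext_pull_def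
proof (rule ext_class_UN)
  fix \<delta> \<delta>'
  assume \<delta>: "(\<epsilon>, \<delta>) \<in> ext_rel C" and "pullback_ext C g \<delta> \<delta>'"
  then have "emor C (Ident C (Src C (fst \<epsilon>))) g \<delta>' \<epsilon>"
    using emor_ext_rel_target[OF _ ext_rel_sym[OF \<delta>]] ext_rel_ends(1)[OF \<delta>]
    by (metis pullback_ext_iff)
  then show "(\<epsilon>', \<delta>') \<in> ext_rel C"
    by (rule emor_pullback_unique[OF assms])
qed (use assms emor_shape(2)[OF assms] in \<open>simp_all add: pullback_ext_iff\<close>)

end


section \<open>Direct sums and Baer sums\<close>

text \<open>The diagonal matrix with entries \<open>f\<^sub>1\<close> and \<open>f\<^sub>2\<close>,
  written with the injections of the target biproduct and the projections of the source biproduct.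
  The bracketing matches the terms in \<open>baer_sum\<close>.\<close>

definition dsum_arr ::
  "('o, 'a, 'z) ab_category_scheme \<Rightarrow> 'a \<Rightarrow> 'a \<Rightarrow> 'a \<Rightarrow> 'a \<Rightarrow> 'a \<Rightarrow> 'a \<Rightarrow> 'a" where
  "dsum_arr C j\<^sub>1 j\<^sub>2 q\<^sub>1 q\<^sub>2 f\<^sub>1 f\<^sub>2 = j\<^sub>1 \<cdot>\<^bsub>C\<^esub> f\<^sub>1 \<cdot>\<^bsub>C\<^esub> q\<^sub>1 \<oplus>\<^bsub>C\<^esub> j\<^sub>2 \<cdot>\<^bsub>C\<^esub> f\<^sub>2 \<cdot>\<^bsub>C\<^esub> q\<^sub>2"

context preadditive_category
begin

lemma dsum_arr_simps:
  assumes "is_biproduct C x\<^sub>1 x\<^sub>2 j\<^sub>1 j\<^sub>2 q\<^sub>1 q\<^sub>2" "is_biproduct C y\<^sub>1 y\<^sub>2 k\<^sub>1 k\<^sub>2 r\<^sub>1 r\<^sub>2"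
    and "f\<^sub>1 \<in> Hom C x\<^sub>1 y\<^sub>1" "f\<^sub>2 \<in> Hom C x\<^sub>2 y\<^sub>2"
  shows "dsum_arr C k\<^sub>1 k\<^sub>2 q\<^sub>1 q\<^sub>2 f\<^sub>1 f\<^sub>2 \<in> Arr C" "Src C (dsum_arr C k\<^sub>1 k\<^sub>2 q\<^sub>1 q\<^sub>2 f\<^sub>1 f\<^sub>2) = Src C q\<^sub>1"
    "Tgt C (dsum_arr C k\<^sub>1 k\<^sub>2 q\<^sub>1 q\<^sub>2 f\<^sub>1 f\<^sub>2) = Tgt C k\<^sub>1"
    "r\<^sub>1 \<cdot> dsum_arr C k\<^sub>1 k\<^sub>2 q\<^sub>1 q\<^sub>2 f\<^sub>1 f\<^sub>2 = f\<^sub>1 \<cdot> q\<^sub>1" "r\<^sub>2 \<cdot> dsum_arr C k\<^sub>1 k\<^sub>2 q\<^sub>1 q\<^sub>2 f\<^sub>1 f\<^sub>2 = f\<^sub>2 \<cdot> q\<^sub>2"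
    "dsum_arr C k\<^sub>1 k\<^sub>2 q\<^sub>1 q\<^sub>2 f\<^sub>1 f\<^sub>2 \<cdot> j\<^sub>1 = k\<^sub>1 \<cdot> f\<^sub>1" "dsum_arr C k\<^sub>1 k\<^sub>2 q\<^sub>1 q\<^sub>2 f\<^sub>1 f\<^sub>2 \<cdot> j\<^sub>2 = k\<^sub>2 \<cdot> f\<^sub>2"
proof -
  note [simp] = assms(3,4)[unfolded in_Hom]
  obtain x where [simp]: "x\<^sub>1 \<in> Obj C" "x\<^sub>2 \<in> Obj C" "x \<in> Obj C"
    "j\<^sub>1 \<in> Arr C" "Src C j\<^sub>1 = x\<^sub>1" "Tgt C j\<^sub>1 = x" "j\<^sub>2 \<in> Arr C" "Src C j\<^sub>2 = x\<^sub>2" "Tgt C j\<^sub>2 = x"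
    "q\<^sub>1 \<in> Arr C" "Src C q\<^sub>1 = x" "Tgt C q\<^sub>1 = x\<^sub>1" "q\<^sub>2 \<in> Arr C" "Src C q\<^sub>2 = x" "Tgt C q\<^sub>2 = x\<^sub>2"
    and qj: "q\<^sub>1 \<cdot> j\<^sub>1 = Ident C x\<^sub>1" "q\<^sub>2 \<cdot> j\<^sub>2 = Ident C x\<^sub>2" "q\<^sub>2 \<cdot> j\<^sub>1 = HZero C x\<^sub>1 x\<^sub>2"
      "q\<^sub>1 \<cdot> j\<^sub>2 = HZero C x\<^sub>2 x\<^sub>1"
    using assms(1) by (rule biproductE)
  obtain y where [simp]: "y\<^sub>1 \<in> Obj C" "y\<^sub>2 \<in> Obj C" "y \<in> Obj C"
    "k\<^sub>1 \<in> Arr C" "Src C k\<^sub>1 = y\<^sub>1" "Tgt C k\<^sub>1 = y" "k\<^sub>2 \<in> Arr C" "Src C k\<^sub>2 = y\<^sub>2" "Tgt C k\<^sub>2 = y"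
    "r\<^sub>1 \<in> Arr C" "Src C r\<^sub>1 = y" "Tgt C r\<^sub>1 = y\<^sub>1" "r\<^sub>2 \<in> Arr C" "Src C r\<^sub>2 = y" "Tgt C r\<^sub>2 = y\<^sub>2"
    and rk: "r\<^sub>1 \<cdot> k\<^sub>1 = Ident C y\<^sub>1" "r\<^sub>2 \<cdot> k\<^sub>2 = Ident C y\<^sub>2" "r\<^sub>2 \<cdot> k\<^sub>1 = HZero C y\<^sub>1 y\<^sub>2"
      "r\<^sub>1 \<cdot> k\<^sub>2 = HZero C y\<^sub>2 y\<^sub>1"
    using assms(2) by (rule biproductE)
  show "dsum_arr C k\<^sub>1 k\<^sub>2 q\<^sub>1 q\<^sub>2 f\<^sub>1 f\<^sub>2 \<in> Arr C" "Src C (dsum_arr C k\<^sub>1 k\<^sub>2 q\<^sub>1 q\<^sub>2 f\<^sub>1 f\<^sub>2) = Src C q\<^sub>1"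
    "Tgt C (dsum_arr C k\<^sub>1 k\<^sub>2 q\<^sub>1 q\<^sub>2 f\<^sub>1 f\<^sub>2) = Tgt C k\<^sub>1"
    "r\<^sub>1 \<cdot> dsum_arr C k\<^sub>1 k\<^sub>2 q\<^sub>1 q\<^sub>2 f\<^sub>1 f\<^sub>2 = f\<^sub>1 \<cdot> q\<^sub>1" "r\<^sub>2 \<cdot> dsum_arr C k\<^sub>1 k\<^sub>2 q\<^sub>1 q\<^sub>2 f\<^sub>1 f\<^sub>2 = f\<^sub>2 \<cdot> q\<^sub>2"
    "dsum_arr C k\<^sub>1 k\<^sub>2 q\<^sub>1 q\<^sub>2 f\<^sub>1 f\<^sub>2 \<cdot> j\<^sub>1 = k\<^sub>1 \<cdot> f\<^sub>1" "dsum_arr C k\<^sub>1 k\<^sub>2 q\<^sub>1 q\<^sub>2 f\<^sub>1 f\<^sub>2 \<cdot> j\<^sub>2 = k\<^sub>2 \<cdot> f\<^sub>2"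
    by (simp_all add: dsum_arr_def qj rk rk[THEN Comp_reassoc])
qed

lemma dsum_arr_comp:
  assumes x: "is_biproduct C x\<^sub>1 x\<^sub>2 j\<^sub>1 j\<^sub>2 q\<^sub>1 q\<^sub>2" and y: "is_biproduct C y\<^sub>1 y\<^sub>2 k\<^sub>1 k\<^sub>2 r\<^sub>1 r\<^sub>2"
    and z: "is_biproduct C z\<^sub>1 z\<^sub>2 l\<^sub>1 l\<^sub>2 s\<^sub>1 s\<^sub>2"
    and f: "f\<^sub>1 \<in> Hom C x\<^sub>1 y\<^sub>1" "f\<^sub>2 \<in> Hom C x\<^sub>2 y\<^sub>2" and g: "g\<^sub>1 \<in> Hom C y\<^sub>1 z\<^sub>1" "g\<^sub>2 \<in> Hom C y\<^sub>2 z\<^sub>2"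
  shows "dsum_arr C l\<^sub>1 l\<^sub>2 r\<^sub>1 r\<^sub>2 g\<^sub>1 g\<^sub>2 \<cdot> dsum_arr C k\<^sub>1 k\<^sub>2 q\<^sub>1 q\<^sub>2 f\<^sub>1 f\<^sub>2 =
    dsum_arr C l\<^sub>1 l\<^sub>2 q\<^sub>1 q\<^sub>2 (g\<^sub>1 \<cdot> f\<^sub>1) (g\<^sub>2 \<cdot> f\<^sub>2)"
proof -
  note [simp] = f[unfolded in_Hom] g[unfolded in_Hom]
  note [simp] = dsum_arr_simps(1-3)[OF x y f]
  have eq: "r\<^sub>1 \<cdot> dsum_arr C k\<^sub>1 k\<^sub>2 q\<^sub>1 q\<^sub>2 f\<^sub>1 f\<^sub>2 = f\<^sub>1 \<cdot> q\<^sub>1" "r\<^sub>2 \<cdot> dsum_arr C k\<^sub>1 k\<^sub>2 q\<^sub>1 q\<^sub>2 f\<^sub>1 f\<^sub>2 = f\<^sub>2 \<cdot> q\<^sub>2"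
    by (rule dsum_arr_simps[OF x y f])+
  obtain xo where [simp]: "q\<^sub>1 \<in> Arr C" "Src C q\<^sub>1 = xo" "Tgt C q\<^sub>1 = x\<^sub>1" "q\<^sub>2 \<in> Arr C" "Src C q\<^sub>2 = xo" "Tgt C q\<^sub>2 = x\<^sub>2"
    using x by (rule biproductE)
  obtain yo where [simp]: "r\<^sub>1 \<in> Arr C" "Src C r\<^sub>1 = yo" "Tgt C r\<^sub>1 = y\<^sub>1" "r\<^sub>2 \<in> Arr C" "Src C r\<^sub>2 = yo" "Tgt C r\<^sub>2 = y\<^sub>2"
     "Tgt C k\<^sub>1 = yo"
    using y by (rule biproductE)
  obtain zo where [simp]: "l\<^sub>1 \<in> Arr C" "Src C l\<^sub>1 = z\<^sub>1" "Tgt C l\<^sub>1 = zo" "l\<^sub>2 \<in> Arr C" "Src C l\<^sub>2 = z\<^sub>2" "Tgt C l\<^sub>2 = zo"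
    using z by (rule biproductE)
  show ?thesis
    by (subst (1) dsum_arr_def, subst (2) dsum_arr_def) (simp add: eq)
qed

text \<open>Composing with the projections splits the problem into its two summands; the solutions
  found there are added up along the injections.\<close>

lemma dsum_kernel:
  assumes y: "is_biproduct C y\<^sub>1 y\<^sub>2 j\<^sub>1 j\<^sub>2 q\<^sub>1 q\<^sub>2" and a: "is_biproduct C a\<^sub>1 a\<^sub>2 k\<^sub>1 k\<^sub>2 r\<^sub>1 r\<^sub>2"
    and x: "is_biproduct C x\<^sub>1 x\<^sub>2 l\<^sub>1 l\<^sub>2 s\<^sub>1 s\<^sub>2"
    and i: "i\<^sub>1 \<in> Hom C y\<^sub>1 a\<^sub>1" "i\<^sub>2 \<in> Hom C y\<^sub>2 a\<^sub>2" and p: "p\<^sub>1 \<in> Hom C a\<^sub>1 x\<^sub>1" "p\<^sub>2 \<in> Hom C a\<^sub>2 x\<^sub>2"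
    and ker: "is_kernel C p\<^sub>1 i\<^sub>1" "is_kernel C p\<^sub>2 i\<^sub>2"
  shows "is_kernel C (dsum_arr C l\<^sub>1 l\<^sub>2 r\<^sub>1 r\<^sub>2 p\<^sub>1 p\<^sub>2) (dsum_arr C k\<^sub>1 k\<^sub>2 q\<^sub>1 q\<^sub>2 i\<^sub>1 i\<^sub>2)"
    (is "is_kernel C ?P ?I")
proof -
  note [simp] = i[unfolded in_Hom] p[unfolded in_Hom]
  obtain yo where [simp]: "y\<^sub>1 \<in> Obj C" "y\<^sub>2 \<in> Obj C" "yo \<in> Obj C"
    "j\<^sub>1 \<in> Arr C" "Src C j\<^sub>1 = y\<^sub>1" "Tgt C j\<^sub>1 = yo" "j\<^sub>2 \<in> Arr C" "Src C j\<^sub>2 = y\<^sub>2" "Tgt C j\<^sub>2 = yo"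
    "q\<^sub>1 \<in> Arr C" "Src C q\<^sub>1 = yo" "Tgt C q\<^sub>1 = y\<^sub>1" "q\<^sub>2 \<in> Arr C" "Src C q\<^sub>2 = yo" "Tgt C q\<^sub>2 = y\<^sub>2"
    using y by (rule biproductE)
  obtain ao where [simp]: "a\<^sub>1 \<in> Obj C" "a\<^sub>2 \<in> Obj C" "ao \<in> Obj C"
    "k\<^sub>1 \<in> Arr C" "Src C k\<^sub>1 = a\<^sub>1" "Tgt C k\<^sub>1 = ao" "k\<^sub>2 \<in> Arr C" "Src C k\<^sub>2 = a\<^sub>2" "Tgt C k\<^sub>2 = ao"
    "r\<^sub>1 \<in> Arr C" "Src C r\<^sub>1 = ao" "Tgt C r\<^sub>1 = a\<^sub>1" "r\<^sub>2 \<in> Arr C" "Src C r\<^sub>2 = ao" "Tgt C r\<^sub>2 = a\<^sub>2"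
    using a by (rule biproductE)
  obtain xo where [simp]: "x\<^sub>1 \<in> Obj C" "x\<^sub>2 \<in> Obj C" "xo \<in> Obj C"
    "l\<^sub>1 \<in> Arr C" "Src C l\<^sub>1 = x\<^sub>1" "Tgt C l\<^sub>1 = xo" "l\<^sub>2 \<in> Arr C" "Src C l\<^sub>2 = x\<^sub>2" "Tgt C l\<^sub>2 = xo"
    "s\<^sub>1 \<in> Arr C" "Src C s\<^sub>1 = xo" "Tgt C s\<^sub>1 = x\<^sub>1" "s\<^sub>2 \<in> Arr C" "Src C s\<^sub>2 = xo" "Tgt C s\<^sub>2 = x\<^sub>2"
    using x by (rule biproductE)
  note I = dsum_arr_simps[OF y a i] and P = dsum_arr_simps[OF a x p]
  note [simp] = I(1-3) P(1-3)
  note dec = biproduct_decomp(2)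
  have pi: "p\<^sub>1 \<cdot> i\<^sub>1 = HZero C y\<^sub>1 x\<^sub>1" "p\<^sub>2 \<cdot> i\<^sub>2 = HZero C y\<^sub>2 x\<^sub>2"
    using kernelD(4)[OF ker(1)] kernelD(4)[OF ker(2)] by simp_all
  show ?thesis
  proof (rule is_kernelI)
    show "is_mono C ?I"
    proof (rule is_monoI)
      fix g
      assume g: "g \<in> Arr C" "Tgt C g = Src C ?I" and Ig: "?I \<cdot> g = HZero C (Src C g) (Tgt C ?I)"
      have g' [simp]: "g \<in> Arr C" "Tgt C g = yo"
        using g by simp_all
      have "i\<^sub>1 \<cdot> (q\<^sub>1 \<cdot> g) = r\<^sub>1 \<cdot> (?I \<cdot> g)" "i\<^sub>2 \<cdot> (q\<^sub>2 \<cdot> g) = r\<^sub>2 \<cdot> (?I \<cdot> g)"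
        by (simp_all add: I(4,5)[THEN Comp_reassoc])
      then have "i\<^sub>1 \<cdot> (q\<^sub>1 \<cdot> g) = HZero C (Src C g) a\<^sub>1" "i\<^sub>2 \<cdot> (q\<^sub>2 \<cdot> g) = HZero C (Src C g) a\<^sub>2"
        by (simp_all add: Ig)
      then have "q\<^sub>1 \<cdot> g = HZero C (Src C g) y\<^sub>1" "q\<^sub>2 \<cdot> g = HZero C (Src C g) y\<^sub>2"
        using mono_zero[OF kernel_mono[OF ker(1)], of "q\<^sub>1 \<cdot> g"]
          mono_zero[OF kernel_mono[OF ker(2)], of "q\<^sub>2 \<cdot> g"] by simp_all
      then show "g = HZero C (Src C g) (Src C ?I)"
        using dec[OF y, of g] by simp
    qed simp
    show "?P \<cdot> ?I = HZero C (Src C ?I) (Tgt C ?P)"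
      unfolding dsum_arr_comp[OF y a x i p] pi by (simp add: dsum_arr_def)
    fix h
    assume h: "h \<in> Arr C" "Tgt C h = Src C ?P" and Ph: "?P \<cdot> h = HZero C (Src C h) (Tgt C ?P)"
    have h' [simp]: "h \<in> Arr C" "Tgt C h = ao"
      using h by simp_all
    have "p\<^sub>1 \<cdot> (r\<^sub>1 \<cdot> h) = s\<^sub>1 \<cdot> (?P \<cdot> h)" "p\<^sub>2 \<cdot> (r\<^sub>2 \<cdot> h) = s\<^sub>2 \<cdot> (?P \<cdot> h)"
      by (simp_all add: P(4,5)[THEN Comp_reassoc])
    then have ph: "p\<^sub>1 \<cdot> (r\<^sub>1 \<cdot> h) = HZero C (Src C h) x\<^sub>1" "p\<^sub>2 \<cdot> (r\<^sub>2 \<cdot> h) = HZero C (Src C h) x\<^sub>2"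
      by (simp_all add: Ph)
    obtain u\<^sub>1 where u1: "u\<^sub>1 \<in> Arr C" "Src C u\<^sub>1 = Src C (r\<^sub>1 \<cdot> h)" "Tgt C u\<^sub>1 = Src C i\<^sub>1" "i\<^sub>1 \<cdot> u\<^sub>1 = r\<^sub>1 \<cdot> h"
      by (rule kernel_factor[OF ker(1), of "r\<^sub>1 \<cdot> h"]) (simp_all add: ph)
    obtain u\<^sub>2 where u2: "u\<^sub>2 \<in> Arr C" "Src C u\<^sub>2 = Src C (r\<^sub>2 \<cdot> h)" "Tgt C u\<^sub>2 = Src C i\<^sub>2" "i\<^sub>2 \<cdot> u\<^sub>2 = r\<^sub>2 \<cdot> h"
      by (rule kernel_factor[OF ker(2), of "r\<^sub>2 \<cdot> h"]) (simp_all add: ph)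
    have [simp]: "u\<^sub>1 \<in> Arr C" "Src C u\<^sub>1 = Src C h" "Tgt C u\<^sub>1 = y\<^sub>1"
      "u\<^sub>2 \<in> Arr C" "Src C u\<^sub>2 = Src C h" "Tgt C u\<^sub>2 = y\<^sub>2"
      using u1(1-3) u2(1-3) by simp_all
    have "?I \<cdot> (j\<^sub>1 \<cdot> u\<^sub>1 \<oplus> j\<^sub>2 \<cdot> u\<^sub>2) = k\<^sub>1 \<cdot> (r\<^sub>1 \<cdot> h) \<oplus> k\<^sub>2 \<cdot> (r\<^sub>2 \<cdot> h)"
      by (simp add: I(6,7)[THEN Comp_reassoc] u1(4) u2(4))
    also have "\<dots> = h"
      using dec[OF a, of h] by simp
    finally show "\<exists>u\<in>Arr C. Src C u = Src C h \<and> Tgt C u = Src C ?I \<and> ?I \<cdot> u = h"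
      by (intro bexI[of _ "j\<^sub>1 \<cdot> u\<^sub>1 \<oplus> j\<^sub>2 \<cdot> u\<^sub>2"]) simp_all
  qed simp_all
qed

end

context abelian_category
begin

text \<open>The cokernel half is the kernel half in the opposite category, where injections and
  projections trade places.\<close>

lemma dsum_short_exact:
  assumes y: "is_biproduct C y\<^sub>1 y\<^sub>2 j\<^sub>1 j\<^sub>2 q\<^sub>1 q\<^sub>2" and a: "is_biproduct C a\<^sub>1 a\<^sub>2 k\<^sub>1 k\<^sub>2 r\<^sub>1 r\<^sub>2"
    and x: "is_biproduct C x\<^sub>1 x\<^sub>2 l\<^sub>1 l\<^sub>2 s\<^sub>1 s\<^sub>2"
    and i: "i\<^sub>1 \<in> Hom C y\<^sub>1 a\<^sub>1" "i\<^sub>2 \<in> Hom C y\<^sub>2 a\<^sub>2" and p: "p\<^sub>1 \<in> Hom C a\<^sub>1 x\<^sub>1" "p\<^sub>2 \<in> Hom C a\<^sub>2 x\<^sub>2"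
    and ses: "short_exact C (i\<^sub>1, p\<^sub>1)" "short_exact C (i\<^sub>2, p\<^sub>2)"
  shows "short_exact C (dsum_arr C k\<^sub>1 k\<^sub>2 q\<^sub>1 q\<^sub>2 i\<^sub>1 i\<^sub>2, dsum_arr C l\<^sub>1 l\<^sub>2 r\<^sub>1 r\<^sub>2 p\<^sub>1 p\<^sub>2)"
proof -
  have "is_kernel C (dsum_arr C l\<^sub>1 l\<^sub>2 r\<^sub>1 r\<^sub>2 p\<^sub>1 p\<^sub>2) (dsum_arr C k\<^sub>1 k\<^sub>2 q\<^sub>1 q\<^sub>2 i\<^sub>1 i\<^sub>2)"
    by (rule dsum_kernel[OF y a x i p]) (use ses in \<open>simp_all add: short_exactD\<close>)
  moreover have "is_kernel (OpA C) (dsum_arr (OpA C) q\<^sub>1 q\<^sub>2 k\<^sub>1 k\<^sub>2 i\<^sub>1 i\<^sub>2) (dsum_arr (OpA C) r\<^sub>1 r\<^sub>2 l\<^sub>1 l\<^sub>2 p\<^sub>1 p\<^sub>2)"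
    by (rule preadditive_category.dsum_kernel[OF preadditive_OpA, OF x[THEN is_biproduct_OpA]
          a[THEN is_biproduct_OpA] y[THEN is_biproduct_OpA]])
      (use ses i p in \<open>simp_all add: short_exactD\<close>)
  \<comment> \<open>The dual expression is the original one up to associativity of the triple
    composites.\<close>
  moreover have "dsum_arr (OpA C) q\<^sub>1 q\<^sub>2 k\<^sub>1 k\<^sub>2 i\<^sub>1 i\<^sub>2 = dsum_arr C k\<^sub>1 k\<^sub>2 q\<^sub>1 q\<^sub>2 i\<^sub>1 i\<^sub>2"
    using y a i unfolding is_biproduct_def by (auto simp: dsum_arr_def)
  moreover have "dsum_arr (OpA C) r\<^sub>1 r\<^sub>2 l\<^sub>1 l\<^sub>2 p\<^sub>1 p\<^sub>2 = dsum_arr C l\<^sub>1 l\<^sub>2 r\<^sub>1 r\<^sub>2 p\<^sub>1 p\<^sub>2"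
    using x a p unfolding is_biproduct_def by (auto simp: dsum_arr_def)
  ultimately show ?thesis
    by (simp add: short_exact_def)
qed

lemma baer_sum_iff:
  "baer_sum C (i\<^sub>1, p\<^sub>1) (i\<^sub>2, p\<^sub>2) \<epsilon> \<longleftrightarrow>
    (\<exists>j\<^sub>1 j\<^sub>2 q\<^sub>1 q\<^sub>2 k\<^sub>1 k\<^sub>2 r\<^sub>1 r\<^sub>2 l\<^sub>1 l\<^sub>2 s\<^sub>1 s\<^sub>2 \<delta>.
       is_biproduct C (Src C i\<^sub>1) (Src C i\<^sub>2) j\<^sub>1 j\<^sub>2 q\<^sub>1 q\<^sub>2 \<and>
       is_biproduct C (Tgt C i\<^sub>1) (Tgt C i\<^sub>2) k\<^sub>1 k\<^sub>2 r\<^sub>1 r\<^sub>2 \<and>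
       is_biproduct C (Tgt C p\<^sub>1) (Tgt C p\<^sub>2) l\<^sub>1 l\<^sub>2 s\<^sub>1 s\<^sub>2 \<and>
       pullback_ext C (l\<^sub>1 \<oplus> l\<^sub>2) (dsum_arr C k\<^sub>1 k\<^sub>2 q\<^sub>1 q\<^sub>2 i\<^sub>1 i\<^sub>2, dsum_arr C l\<^sub>1 l\<^sub>2 r\<^sub>1 r\<^sub>2 p\<^sub>1 p\<^sub>2) \<delta> \<and>
       pushout_ext C (q\<^sub>1 \<oplus> q\<^sub>2) \<delta> \<epsilon>)"
  by (simp add: baer_sum_def dsum_arr_def)

text \<open>The direct sum of the two middle arrows is a morphism of direct sums with diagonal ends
  \<open>H\<close> and \<open>G\<close>. These are compatible with diagonals and codiagonals, so one
  pullback and one pushout can be cancelled and the ends become \<open>h\<close> and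
  \<open>g\<close>. With identity ends this is well-definedness of the Baer sum; with ends
  \<open>\<rho> F\<close> and an identity it is additivity of \<open>Phi\<close>.\<close>

lemma baer_sum_emor:
  assumes "baer_sum C \<epsilon>\<^sub>1 \<epsilon>\<^sub>2 \<epsilon>" "baer_sum C \<eta>\<^sub>1 \<eta>\<^sub>2 \<eta>" "emor C h g \<epsilon>\<^sub>1 \<eta>\<^sub>1" "emor C h g \<epsilon>\<^sub>2 \<eta>\<^sub>2"
  shows "emor C h g \<epsilon> \<eta>"
proof -
  obtain i\<^sub>1 p\<^sub>1 i\<^sub>2 p\<^sub>2 i\<^sub>1' p\<^sub>1' i\<^sub>2' p\<^sub>2' where \<epsilon>:
    "\<epsilon>\<^sub>1 = (i\<^sub>1, p\<^sub>1)" "\<epsilon>\<^sub>2 = (i\<^sub>2, p\<^sub>2)" "\<eta>\<^sub>1 = (i\<^sub>1', p\<^sub>1')" "\<eta>\<^sub>2 = (i\<^sub>2', p\<^sub>2')"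
    by (metis surj_pair)
  obtain e\<^sub>1 y a\<^sub>1 x y' a\<^sub>1' x' where [simp]: "y \<in> Obj C" "a\<^sub>1 \<in> Obj C" "x \<in> Obj C" "y' \<in> Obj C" "a\<^sub>1' \<in> Obj C" "x' \<in> Obj C"
    "i\<^sub>1 \<in> Arr C" "Src C i\<^sub>1 = y" "Tgt C i\<^sub>1 = a\<^sub>1" "p\<^sub>1 \<in> Arr C" "Src C p\<^sub>1 = a\<^sub>1" "Tgt C p\<^sub>1 = x"
    "i\<^sub>1' \<in> Arr C" "Src C i\<^sub>1' = y'" "Tgt C i\<^sub>1' = a\<^sub>1'" "p\<^sub>1' \<in> Arr C" "Src C p\<^sub>1' = a\<^sub>1'" "Tgt C p\<^sub>1' = x'"
    "h \<in> Arr C" "Src C h = y" "Tgt C h = y'" "g \<in> Arr C" "Src C g = x" "Tgt C g = x'"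
    "e\<^sub>1 \<in> Arr C" "Src C e\<^sub>1 = a\<^sub>1" "Tgt C e\<^sub>1 = a\<^sub>1'"
    and e1: "e\<^sub>1 \<cdot> i\<^sub>1 = i\<^sub>1' \<cdot> h" "p\<^sub>1' \<cdot> e\<^sub>1 = g \<cdot> p\<^sub>1"
    using assms(3) unfolding \<epsilon> by (rule emorE)
  obtain e\<^sub>2 where "Src C i\<^sub>2 = Src C h" "Tgt C p\<^sub>2 = Src C g" "Src C i\<^sub>2' = Tgt C h" "Tgt C p\<^sub>2' = Tgt C g"
    and [simp]: "i\<^sub>2 \<in> Arr C" "p\<^sub>2 \<in> Arr C" "Src C p\<^sub>2 = Tgt C i\<^sub>2"
    "i\<^sub>2' \<in> Arr C" "p\<^sub>2' \<in> Arr C" "Src C p\<^sub>2' = Tgt C i\<^sub>2'"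
    "e\<^sub>2 \<in> Arr C" "Src C e\<^sub>2 = Tgt C i\<^sub>2" "Tgt C e\<^sub>2 = Tgt C i\<^sub>2'"
    and e2: "e\<^sub>2 \<cdot> i\<^sub>2 = i\<^sub>2' \<cdot> h" "p\<^sub>2' \<cdot> e\<^sub>2 = g \<cdot> p\<^sub>2"
    using assms(4) unfolding \<epsilon> by (rule emorE) metis
  then have [simp]: "Src C i\<^sub>2 = y" "Tgt C p\<^sub>2 = x" "Src C i\<^sub>2' = y'" "Tgt C p\<^sub>2' = x'"
    by simp_all
  obtain j\<^sub>1 j\<^sub>2 q\<^sub>1 q\<^sub>2 k\<^sub>1 k\<^sub>2 r\<^sub>1 r\<^sub>2 l\<^sub>1 l\<^sub>2 s\<^sub>1 s\<^sub>2 \<delta> where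
    Y: "is_biproduct C y y j\<^sub>1 j\<^sub>2 q\<^sub>1 q\<^sub>2" and A: "is_biproduct C a\<^sub>1 (Tgt C i\<^sub>2) k\<^sub>1 k\<^sub>2 r\<^sub>1 r\<^sub>2"
    and X: "is_biproduct C x x l\<^sub>1 l\<^sub>2 s\<^sub>1 s\<^sub>2"
    and \<delta>: "pullback_ext C (l\<^sub>1 \<oplus> l\<^sub>2) (dsum_arr C k\<^sub>1 k\<^sub>2 q\<^sub>1 q\<^sub>2 i\<^sub>1 i\<^sub>2, dsum_arr C l\<^sub>1 l\<^sub>2 r\<^sub>1 r\<^sub>2 p\<^sub>1 p\<^sub>2) \<delta>"
    and \<delta>\<epsilon>: "pushout_ext C (q\<^sub>1 \<oplus> q\<^sub>2) \<delta> \<epsilon>"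
    using assms(1) unfolding \<epsilon> baer_sum_iff by auto
  obtain j\<^sub>1' j\<^sub>2' q\<^sub>1' q\<^sub>2' k\<^sub>1' k\<^sub>2' r\<^sub>1' r\<^sub>2' l\<^sub>1' l\<^sub>2' s\<^sub>1' s\<^sub>2' \<delta>' where
    Y': "is_biproduct C y' y' j\<^sub>1' j\<^sub>2' q\<^sub>1' q\<^sub>2'" and A': "is_biproduct C a\<^sub>1' (Tgt C i\<^sub>2') k\<^sub>1' k\<^sub>2' r\<^sub>1' r\<^sub>2'"
    and X': "is_biproduct C x' x' l\<^sub>1' l\<^sub>2' s\<^sub>1' s\<^sub>2'"
    and \<delta>': "pullback_ext C (l\<^sub>1' \<oplus> l\<^sub>2') (dsum_arr C k\<^sub>1' k\<^sub>2' q\<^sub>1' q\<^sub>2' i\<^sub>1' i\<^sub>2', dsum_arr C l\<^sub>1' l\<^sub>2' r\<^sub>1' r\<^sub>2' p\<^sub>1' p\<^sub>2') \<delta>'"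
    and \<delta>\<eta>: "pushout_ext C (q\<^sub>1' \<oplus> q\<^sub>2') \<delta>' \<eta>"
    using assms(2) unfolding \<epsilon> baer_sum_iff by auto
  define D where "D = (dsum_arr C k\<^sub>1 k\<^sub>2 q\<^sub>1 q\<^sub>2 i\<^sub>1 i\<^sub>2, dsum_arr C l\<^sub>1 l\<^sub>2 r\<^sub>1 r\<^sub>2 p\<^sub>1 p\<^sub>2)"
  define D' where "D' = (dsum_arr C k\<^sub>1' k\<^sub>2' q\<^sub>1' q\<^sub>2' i\<^sub>1' i\<^sub>2', dsum_arr C l\<^sub>1' l\<^sub>2' r\<^sub>1' r\<^sub>2' p\<^sub>1' p\<^sub>2')"
  define H where "H = dsum_arr C j\<^sub>1' j\<^sub>2' q\<^sub>1 q\<^sub>2 h h"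
  define G where "G = dsum_arr C l\<^sub>1' l\<^sub>2' s\<^sub>1 s\<^sub>2 g g"
  define E where "E = dsum_arr C k\<^sub>1' k\<^sub>2' r\<^sub>1 r\<^sub>2 e\<^sub>1 e\<^sub>2"
  obtain yo where [simp]:
    "j\<^sub>1 \<in> Arr C" "Src C j\<^sub>1 = y" "Tgt C j\<^sub>1 = yo" "j\<^sub>2 \<in> Arr C" "Src C j\<^sub>2 = y" "Tgt C j\<^sub>2 = yo"
    "q\<^sub>1 \<in> Arr C" "Src C q\<^sub>1 = yo" "Tgt C q\<^sub>1 = y" "q\<^sub>2 \<in> Arr C" "Src C q\<^sub>2 = yo" "Tgt C q\<^sub>2 = y"
    using Y by (rule biproductE)
  obtain xo where [simp]:
    "l\<^sub>1 \<in> Arr C" "Src C l\<^sub>1 = x" "Tgt C l\<^sub>1 = xo" "l\<^sub>2 \<in> Arr C" "Src C l\<^sub>2 = x" "Tgt C l\<^sub>2 = xo"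
    "s\<^sub>1 \<in> Arr C" "Src C s\<^sub>1 = xo" "Tgt C s\<^sub>1 = x" "s\<^sub>2 \<in> Arr C" "Src C s\<^sub>2 = xo" "Tgt C s\<^sub>2 = x"
    using X by (rule biproductE)
  obtain ao where [simp]:
    "k\<^sub>1 \<in> Arr C" "Src C k\<^sub>1 = a\<^sub>1" "Tgt C k\<^sub>1 = ao" "k\<^sub>2 \<in> Arr C" "Src C k\<^sub>2 = Tgt C i\<^sub>2" "Tgt C k\<^sub>2 = ao"
    "r\<^sub>1 \<in> Arr C" "Src C r\<^sub>1 = ao" "Tgt C r\<^sub>1 = a\<^sub>1" "r\<^sub>2 \<in> Arr C" "Src C r\<^sub>2 = ao" "Tgt C r\<^sub>2 = Tgt C i\<^sub>2"
    using A by (rule biproductE)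
  obtain yo' where [simp]:
    "j\<^sub>1' \<in> Arr C" "Src C j\<^sub>1' = y'" "Tgt C j\<^sub>1' = yo'" "j\<^sub>2' \<in> Arr C" "Src C j\<^sub>2' = y'" "Tgt C j\<^sub>2' = yo'"
    "q\<^sub>1' \<in> Arr C" "Src C q\<^sub>1' = yo'" "Tgt C q\<^sub>1' = y'" "q\<^sub>2' \<in> Arr C" "Src C q\<^sub>2' = yo'" "Tgt C q\<^sub>2' = y'"
    using Y' by (rule biproductE)
  obtain xo' where [simp]:
    "l\<^sub>1' \<in> Arr C" "Src C l\<^sub>1' = x'" "Tgt C l\<^sub>1' = xo'" "l\<^sub>2' \<in> Arr C" "Src C l\<^sub>2' = x'" "Tgt C l\<^sub>2' = xo'"
    "s\<^sub>1' \<in> Arr C" "Src C s\<^sub>1' = xo'" "Tgt C s\<^sub>1' = x'" "s\<^sub>2' \<in> Arr C" "Src C s\<^sub>2' = xo'" "Tgt C s\<^sub>2' = x'"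
    using X' by (rule biproductE)
  obtain ao' where [simp]:
    "k\<^sub>1' \<in> Arr C" "Src C k\<^sub>1' = a\<^sub>1'" "Tgt C k\<^sub>1' = ao'" "k\<^sub>2' \<in> Arr C" "Src C k\<^sub>2' = Tgt C i\<^sub>2'" "Tgt C k\<^sub>2' = ao'"
    "r\<^sub>1' \<in> Arr C" "Src C r\<^sub>1' = ao'" "Tgt C r\<^sub>1' = a\<^sub>1'" "r\<^sub>2' \<in> Arr C" "Src C r\<^sub>2' = ao'" "Tgt C r\<^sub>2' = Tgt C i\<^sub>2'"
    using A' by (rule biproductE)
  have H [simp]: "H \<in> Arr C" "Src C H = yo" "Tgt C H = yo'" "q\<^sub>1' \<cdot> H = h \<cdot> q\<^sub>1" "q\<^sub>2' \<cdot> H = h \<cdot> q\<^sub>2"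
    using dsum_arr_simps[OF Y Y', of h h] by (simp_all add: H_def)
  have G [simp]: "G \<in> Arr C" "Src C G = xo" "Tgt C G = xo'" "G \<cdot> l\<^sub>1 = l\<^sub>1' \<cdot> g" "G \<cdot> l\<^sub>2 = l\<^sub>2' \<cdot> g"
    using dsum_arr_simps[OF X X', of g g] by (simp_all add: G_def)
  have E [simp]: "E \<in> Arr C" "Src C E = ao" "Tgt C E = ao'"
    using dsum_arr_simps[OF A A', of e\<^sub>1 e\<^sub>2] by (simp_all add: E_def)
  have DD [simp]: "Src C (fst D) = yo" "Tgt C (fst D) = ao" "Src C (fst D') = yo'" "Tgt C (fst D') = ao'"
    "Tgt C (snd D) = xo" "Tgt C (snd D') = xo'"
    using dsum_arr_simps[OF Y A, of i\<^sub>1 i\<^sub>2] dsum_arr_simps[OF Y' A', of i\<^sub>1' i\<^sub>2']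
      dsum_arr_simps[OF A X, of p\<^sub>1 p\<^sub>2] dsum_arr_simps[OF A' X', of p\<^sub>1' p\<^sub>2'] by (simp_all add: D_def D'_def)
  have \<delta>s: "emor C (Ident C yo) (l\<^sub>1 \<oplus> l\<^sub>2) \<delta> D" "emor C (q\<^sub>1 \<oplus> q\<^sub>2) (Ident C x) \<delta> \<epsilon>"
    "emor C (Ident C yo') (l\<^sub>1' \<oplus> l\<^sub>2') \<delta>' D'" "emor C (q\<^sub>1' \<oplus> q\<^sub>2') (Ident C x') \<delta>' \<eta>"
  proof -
    show *: "emor C (Ident C yo) (l\<^sub>1 \<oplus> l\<^sub>2) \<delta> D" "emor C (Ident C yo') (l\<^sub>1' \<oplus> l\<^sub>2') \<delta>' D'"
      using \<delta> \<delta>' by (simp_all add: pullback_ext_iff flip: D_def D'_def)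
    show "emor C (q\<^sub>1 \<oplus> q\<^sub>2) (Ident C x) \<delta> \<epsilon>" "emor C (q\<^sub>1' \<oplus> q\<^sub>2') (Ident C x') \<delta>' \<eta>"
      using \<delta>\<epsilon> \<delta>\<eta> emor_shape(7)[OF *(1)] emor_shape(7)[OF *(2)] by (simp_all add: pushout_ext_iff)
  qed
  \<comment> \<open>Diagonal arrows compose entrywise, so both squares reduce to those of the two
    given morphisms.\<close>
  have "E \<cdot> fst D = fst D' \<cdot> H" "snd D' \<cdot> E = G \<cdot> snd D"
    by (simp_all add: E_def D_def D'_def H_def G_def e1 e2 dsum_arr_comp[OF Y A A'] dsum_arr_comp[OF Y Y' A']
      dsum_arr_comp[OF A A' X'] dsum_arr_comp[OF A X X'])
  then have "emor C H G (fst D, snd D) (fst D', snd D')"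
    using emor_shape(2)[OF \<delta>s(1)] emor_shape(2)[OF \<delta>s(3)] unfolding emor_def prod.case
    by (intro conjI bexI[of _ E]) simp_all
  then have "emor C H G D D'"
    by simp
  from emor_trans[OF \<delta>s(1) this] have "emor C H (G \<cdot> (l\<^sub>1 \<oplus> l\<^sub>2)) \<delta> D'"
    by (simp del: Comp_HAdd)
  \<comment> \<open>Naturality of the diagonal: \<open>G\<close> after the diagonal of
    \<open>x\<close> is the diagonal of \<open>x'\<close> after \<open>g\<close>. The right end now
    factors as the pullback rule requires.\<close>
  then have "emor C H ((l\<^sub>1' \<oplus> l\<^sub>2') \<cdot> g) \<delta> D'"
    by simp
  then have "emor C H g \<delta> \<delta>'"
    by (rule emor_pullback_cancel) (use \<delta>s(3) emor_shape(7)[OF \<delta>s(1)] in simp_all)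
  from emor_trans[OF this \<delta>s(4)] have "emor C ((q\<^sub>1' \<oplus> q\<^sub>2') \<cdot> H) g \<delta> \<eta>"
    by (simp del: Comp_HAdd)
  \<comment> \<open>Naturality of the codiagonal, which puts the left end into the form that the
    pushout rule cancels.\<close>
  then have "emor C (h \<cdot> (q\<^sub>1 \<oplus> q\<^sub>2)) g \<delta> \<eta>"
    by simp
  then show ?thesis
    by (rule emor_pushout_cancel)
      (use \<delta>s(2) emor_shape(7)[OF \<delta>s(2)] emor_shape(6)[OF \<delta>s(4)] in simp_all)
qed

lemma ex_baer_sum:
  assumes "short_exact C \<epsilon>\<^sub>1" "short_exact C \<epsilon>\<^sub>2" "Src C (fst \<epsilon>\<^sub>1) = Src C (fst \<epsilon>\<^sub>2)"
    "Tgt C (snd \<epsilon>\<^sub>1) = Tgt C (snd \<epsilon>\<^sub>2)"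
  obtains \<epsilon> where "baer_sum C \<epsilon>\<^sub>1 \<epsilon>\<^sub>2 \<epsilon>" "short_exact C \<epsilon>" "Src C (fst \<epsilon>) = Src C (fst \<epsilon>\<^sub>1)"
    "Tgt C (snd \<epsilon>) = Tgt C (snd \<epsilon>\<^sub>1)"
proof -
  obtain i\<^sub>1 p\<^sub>1 i\<^sub>2 p\<^sub>2 where \<epsilon>: "\<epsilon>\<^sub>1 = (i\<^sub>1, p\<^sub>1)" "\<epsilon>\<^sub>2 = (i\<^sub>2, p\<^sub>2)"
    by (metis surj_pair)
  note s = assms(1,2)[unfolded \<epsilon>]
  define x where "x = Tgt C p\<^sub>2"
  define y where "y = Src C i\<^sub>2"
  have xy [simp]: "Tgt C p\<^sub>1 = x" "Tgt C p\<^sub>2 = x" "Src C i\<^sub>1 = y" "Src C i\<^sub>2 = y"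
    using assms by (simp_all add: \<epsilon> x_def y_def)
  note [simp] = short_exactD(1-3)[OF s(1)] short_exactD(1-3)[OF s(2)]
  have [simp]: "x \<in> Obj C" "y \<in> Obj C"
    using Tgt_Obj[of p\<^sub>1 x] Src_Obj[of i\<^sub>1 y] by simp_all
  obtain j\<^sub>1 j\<^sub>2 q\<^sub>1 q\<^sub>2 where Y: "is_biproduct C y y j\<^sub>1 j\<^sub>2 q\<^sub>1 q\<^sub>2"
    using has_biproducts[of y y] by auto
  obtain k\<^sub>1 k\<^sub>2 r\<^sub>1 r\<^sub>2 where A: "is_biproduct C (Tgt C i\<^sub>1) (Tgt C i\<^sub>2) k\<^sub>1 k\<^sub>2 r\<^sub>1 r\<^sub>2"
    using has_biproducts[of "Tgt C i\<^sub>1" "Tgt C i\<^sub>2"] by auto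
  obtain l\<^sub>1 l\<^sub>2 s\<^sub>1 s\<^sub>2 where X: "is_biproduct C x x l\<^sub>1 l\<^sub>2 s\<^sub>1 s\<^sub>2"
    using has_biproducts[of x x] by auto
  let ?D = "(dsum_arr C k\<^sub>1 k\<^sub>2 q\<^sub>1 q\<^sub>2 i\<^sub>1 i\<^sub>2, dsum_arr C l\<^sub>1 l\<^sub>2 r\<^sub>1 r\<^sub>2 p\<^sub>1 p\<^sub>2)"
  have D: "short_exact C ?D"
    by (rule dsum_short_exact[OF Y A X _ _ _ _ s]) simp_all
  obtain yo where [simp]: "yo \<in> Obj C" "q\<^sub>1 \<in> Arr C" "Src C q\<^sub>1 = yo" "Tgt C q\<^sub>1 = y" "q\<^sub>2 \<in> Arr C" "Src C q\<^sub>2 = yo" "Tgt C q\<^sub>2 = y"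
    using Y by (rule biproductE)
  obtain xo where [simp]: "l\<^sub>1 \<in> Arr C" "Src C l\<^sub>1 = x" "Tgt C l\<^sub>1 = xo" "l\<^sub>2 \<in> Arr C" "Src C l\<^sub>2 = x" "Tgt C l\<^sub>2 = xo"
    using X by (rule biproductE)
  note [simp] = dsum_arr_simps(2)[OF Y A, of i\<^sub>1 i\<^sub>2] dsum_arr_simps(3)[OF A X, of p\<^sub>1 p\<^sub>2]
  obtain \<delta> where \<delta>: "pullback_ext C (l\<^sub>1 \<oplus> l\<^sub>2) ?D \<delta>"
    by (rule ex_pullback_ext[OF D, of "l\<^sub>1 \<oplus> l\<^sub>2"]) simp_all
  note \<delta>' = emor_shape[OF \<delta>[unfolded pullback_ext_iff]]
  obtain \<epsilon> where \<epsilon>': "pushout_ext C (q\<^sub>1 \<oplus> q\<^sub>2) \<delta> \<epsilon>"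
    by (rule ex_pushout_ext[of \<delta> "q\<^sub>1 \<oplus> q\<^sub>2"]) (use \<delta>' in simp_all)
  note \<epsilon>'' = emor_shape[OF \<epsilon>'[unfolded pushout_ext_iff]]
  show thesis
  proof (rule that[of \<epsilon>])
    show "baer_sum C \<epsilon>\<^sub>1 \<epsilon>\<^sub>2 \<epsilon>"
      unfolding \<epsilon> baer_sum_iff xy using Y A X \<delta> \<epsilon>' by blast
  qed (use \<epsilon>'' \<delta>' in \<open>simp_all add: \<epsilon>\<close>)
qed

text \<open>\<open>baer_sum_emor\<close> with identity ends removes all choices at once: those of
  the representatives and those of the biproducts, the pullback and the pushout.\<close>

lemma Ext1_mult_class:
  assumes "baer_sum C \<epsilon>\<^sub>1 \<epsilon>\<^sub>2 \<epsilon>" "short_exact C \<epsilon>\<^sub>1" "short_exact C \<epsilon>\<^sub>2" "Src C (fst \<epsilon>\<^sub>1) = Src C (fst \<epsilon>\<^sub>2)"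
    "Tgt C (snd \<epsilon>\<^sub>1) = Tgt C (snd \<epsilon>\<^sub>2)"
  shows "ext_class C \<epsilon>\<^sub>1 \<otimes>\<^bsub>Ext1 C X Y\<^esub> ext_class C \<epsilon>\<^sub>2 = ext_class C \<epsilon>"
proof -
  have rel: "(\<epsilon>, \<delta>) \<in> ext_rel C"
    if "baer_sum C \<delta>\<^sub>1 \<delta>\<^sub>2 \<delta>" "(\<epsilon>\<^sub>1, \<delta>\<^sub>1) \<in> ext_rel C" "(\<epsilon>\<^sub>2, \<delta>\<^sub>2) \<in> ext_rel C" for \<delta>\<^sub>1 \<delta>\<^sub>2 \<delta>
  proof -
    have "emor C (Ident C (Src C (fst \<epsilon>\<^sub>1))) (Ident C (Tgt C (snd \<epsilon>\<^sub>1))) \<epsilon> \<delta>"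
      by (rule baer_sum_emor[OF assms(1) that(1)]) (use that(2,3) assms(4,5) in \<open>simp_all add: ext_rel_iff\<close>)
    from this emor_shape(5,7)[OF this] show ?thesis
      using assms(2) by (simp add: ext_rel_iff)
  qed
  have "ext_class C \<epsilon>\<^sub>1 \<otimes>\<^bsub>Ext1 C X Y\<^esub> ext_class C \<epsilon>\<^sub>2 =
    (\<Union>\<delta>\<^sub>1 \<in> ext_class C \<epsilon>\<^sub>1. \<Union>\<delta>\<^sub>2 \<in> ext_class C \<epsilon>\<^sub>2. \<Union>\<delta> \<in> {\<delta>. baer_sum C \<delta>\<^sub>1 \<delta>\<^sub>2 \<delta>}. ext_class C \<delta>)"
    by (simp add: Ext1_def)
  moreover have "ext_class C \<delta> = ext_class C \<epsilon>"
    if "\<delta>\<^sub>1 \<in> ext_class C \<epsilon>\<^sub>1" "\<delta>\<^sub>2 \<in> ext_class C \<epsilon>\<^sub>2" "baer_sum C \<delta>\<^sub>1 \<delta>\<^sub>2 \<delta>" for \<delta>\<^sub>1 \<delta>\<^sub>2 \<delta>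
    using rel[OF that(3)] that(1,2) ext_class_eqI by blast
  moreover have "\<epsilon>\<^sub>1 \<in> ext_class C \<epsilon>\<^sub>1" "\<epsilon>\<^sub>2 \<in> ext_class C \<epsilon>\<^sub>2"
    using assms(2,3) ext_rel_refl by blast+
  ultimately show ?thesis
    using assms(1) by blast
qed


text \<open>Both sequences are equivalent to the one that is pulled back along \<open>u\<close> from the left exact
  sequence \<open>j, m\<close>; the pullback of \<open>m\<close> is epi because \<open>q\<close> factors through it.\<close>

lemma ext_rel_of_common_kernel:
  assumes mj: "is_kernel C m j" and u0: "u \<in> Arr C" "Tgt C u = Tgt C m"
    and ses: "short_exact C (i, q)" "short_exact C (i', q')"
    and q: "Tgt C q = Src C u" "Tgt C q' = Src C u"
    and v: "v \<in> Hom C (Tgt C i) (Src C m)" "v' \<in> Hom C (Tgt C i') (Src C m)"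
    and vi: "v \<cdot> i = j" "v' \<cdot> i' = j" and mv: "m \<cdot> v = u \<cdot> q" "m \<cdot> v' = u \<cdot> q'"
  shows "((i, q), (i', q')) \<in> ext_rel C"
proof -
  note m [simp] = kernelD[OF mj] and [simp] = u0
  \<comment> \<open>A pullback of \<open>m\<close> along \<open>u\<close>, kept in the form of a
    pushout in \<open>OpA C\<close> so that the factorization rules for pushouts apply to
    it.\<close>
  obtain f g where "is_pushout (OpA C) m u f g"
    by (rule abelian_category.ex_pushout[OF abelian_OpA, of m u]) simp_all
  then have pb: "is_pushout (OpA C) m u f g" .
  note D = category.pushoutD[OF preadditive_category.axioms(1)[OF preadditive_OpA], OF pb, simplified]
  note factor = category.pushout_factor[OF preadditive_category.axioms(1)[OF preadditive_OpA], OF pb, simplified]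
  note unique = category.pushout_unique[OF preadditive_category.axioms(1)[OF preadditive_OpA], OF pb, simplified]
  define y where "y = Src C j"
  have [simp]: "Src C j = y" "y \<in> Obj C"
    using kernelD(2)[OF mj] by (simp_all add: y_def)
  have D' [simp]: "f \<in> Arr C" "g \<in> Arr C" "Tgt C f = Src C m" "Tgt C g = Src C u" "Src C f = Src C g"
    and comm: "m \<cdot> f = u \<cdot> g"
    using D by simp_all
  obtain k where k [simp]: "k \<in> Arr C" "Tgt C k = Src C g" "Src C k = y"
    and fk: "f \<cdot> k = j" and gk: "g \<cdot> k = HZero C y (Src C u)"
    by (rule factor[of j "HZero C y (Src C u)"]) simp_all
  \<comment> \<open>Pulling back does not change the kernel: if \<open>g\<close> kills
    \<open>w\<close>, then \<open>m\<close> kills \<open>f \<cdot> w\<close>, which therefore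
    factors through \<open>j\<close>, and the factorization is compared with \<open>w\<close> on the
    two legs of the pullback.\<close>
  have ker: "is_kernel C g k"
  proof (rule is_kernelI)
    show "is_mono C k"
      by (rule mono_of_comp[of f]) (simp_all add: fk kernel_mono[OF mj])
    fix w
    assume w: "w \<in> Arr C" "Tgt C w = Src C g" "g \<cdot> w = HZero C (Src C w) (Tgt C g)"
    have "m \<cdot> (f \<cdot> w) = u \<cdot> (g \<cdot> w)"
      using w(1,2) by (simp add: Comp_reassoc[OF comm])
    then have *: "m \<cdot> (f \<cdot> w) = HZero C (Src C w) (Tgt C m)"
      using w(1) by (simp add: w(3))
    obtain s where s: "s \<in> Arr C" "Src C s = Src C (f \<cdot> w)" "Tgt C s = Src C j" "j \<cdot> s = f \<cdot> w"
      by (rule kernel_factor[OF mj, of "f \<cdot> w"]) (use w * in simp_all)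
    have s' [simp]: "s \<in> Arr C" "Src C s = Src C w" "Tgt C s = y"
      using s(1-3) w by simp_all
    have "k \<cdot> s = w"
      by (rule unique) (use w in \<open>simp_all add: Comp_reassoc[OF fk] Comp_reassoc[OF gk] s(4)\<close>)
    then show "\<exists>s\<in>Arr C. Src C s = Src C w \<and> Tgt C s = Src C k \<and> k \<cdot> s = w"
      by (intro bexI[of _ s]) simp_all
  qed (simp_all add: gk)
  \<comment> \<open>Proved for a generic sequence, so that it applies to both given ones; the pulled
    back sequence is the middle term of the final transitivity.\<close>
  have "((a, b), (k, g)) \<in> ext_rel C"
    if ab: "short_exact C (a, b)" "Tgt C b = Src C u" and w: "w \<in> Hom C (Tgt C a) (Src C m)"
      and wa: "w \<cdot> a = j" and mw: "m \<cdot> w = u \<cdot> b" for a b w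
  proof -
    note [simp] = short_exactD(1-3)[OF ab(1)] ab(2) w[unfolded in_Hom]
    have [simp]: "Src C a = y"
      using arg_cong[OF wa, of "Src C"] by simp
    obtain t where t [simp]: "t \<in> Arr C" "Tgt C t = Src C g" "Src C t = Tgt C a"
      and ft: "f \<cdot> t = w" and gt: "g \<cdot> t = b"
      by (rule factor[of w b]) (simp_all add: mw)
    have "t \<cdot> a = k"
      by (rule unique) (simp_all add: Comp_reassoc[OF ft] Comp_reassoc[OF gt] wa fk gk short_exactD(4)[OF ab(1)])
    moreover have "is_epi C g"
      by (rule epi_of_comp[of _ t]) (simp_all add: gt short_exactD(6)[OF ab(1)])
    then have kg: "short_exact C (k, g)"
      using ker by (rule short_exactI(2))
    ultimately show ?thesis
      unfolding ext_rel_iff emor_def using gt ab(1) kg by (auto intro!: bexI[of _ t])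
  qed
  from this[OF ses(1) q(1) v(1) vi(1) mv(1)] this[OF ses(2) q(2) v(2) vi(2) mv(2)]
  show ?thesis
    using ext_rel_sym ext_rel_trans by blast
qed

end

section \<open>Functor categories\<close>

text \<open>A common normal form for the operations of \<open>FunCat\<close>: two such terms with
  the same ends are equal once their components agree on \<open>Obj S\<close>, since the value
  outside is cut off by \<open>restrict\<close>.\<close>

definition ntr :: "('s, 't, 'z) category_scheme \<Rightarrow> ('s, 't, 'o, 'a) ftor \<Rightarrow> ('s, 't, 'o, 'a) ftor
    \<Rightarrow> ('s \<Rightarrow> 'a) \<Rightarrow> ('s, 't, 'o, 'a) ntrans" where
  "ntr S F G c = \<lparr>nsrc = F, ntgt = G, ncomp = restrict c (Obj S)\<rparr>"

lemma ntr_simps [simp]: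
  "nsrc (ntr S F G c) = F" "ntgt (ntr S F G c) = G" "s \<in> Obj S \<Longrightarrow> ncomp (ntr S F G c) s = c s"
  by (simp_all add: ntr_def)

lemma FunCat_simps [simp]:
  "Src (FunCat S B) = nsrc" "Tgt (FunCat S B) = ntgt"
  "Ident (FunCat S B) F = ntr S F F (\<lambda>s. Ident B (omap F s))"
  "\<tau> \<cdot>\<^bsub>FunCat S B\<^esub> \<sigma> = ntr S (nsrc \<sigma>) (ntgt \<tau>) (\<lambda>s. ncomp \<tau> s \<cdot>\<^bsub>B\<^esub> ncomp \<sigma> s)"
  "\<sigma> \<oplus>\<^bsub>FunCat S B\<^esub> \<tau> = ntr S (nsrc \<sigma>) (ntgt \<sigma>) (\<lambda>s. ncomp \<sigma> s \<oplus>\<^bsub>B\<^esub> ncomp \<tau> s)"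
  "HZero (FunCat S B) F G = ntr S F G (\<lambda>s. HZero B (omap F s) (omap G s))"
  by (simp_all add: FunCat_def ntr_def Let_def)

lemma Obj_FunCat:
  "F \<in> Obj (FunCat S B) \<longleftrightarrow>
    is_functor S B F \<and> omap F \<in> extensional (Obj S) \<and> amap F \<in> extensional (Arr S)"
  by (simp add: FunCat_def Let_def)

lemma Arr_FunCat:
  "\<tau> \<in> Arr (FunCat S B) \<longleftrightarrow> nsrc \<tau> \<in> Obj (FunCat S B) \<and> ntgt \<tau> \<in> Obj (FunCat S B) \<and>
    ncomp \<tau> \<in> extensional (Obj S) \<and>
    (\<forall>s \<in> Obj S. ncomp \<tau> s \<in> Hom B (omap (nsrc \<tau>) s) (omap (ntgt \<tau>) s)) \<and>
    (\<forall>f \<in> Arr S. ncomp \<tau> (Tgt S f) \<cdot>\<^bsub>B\<^esub> amap (nsrc \<tau>) f = amap (ntgt \<tau>) f \<cdot>\<^bsub>B\<^esub> ncomp \<tau> (Src S f))"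
  by (simp add: FunCat_def Let_def)

lemma Arr_FunCat_objs [simp]:
  "\<tau> \<in> Arr (FunCat S B) \<Longrightarrow> nsrc \<tau> \<in> Obj (FunCat S B)"
  "\<tau> \<in> Arr (FunCat S B) \<Longrightarrow> ntgt \<tau> \<in> Obj (FunCat S B)"
  by (simp_all add: Arr_FunCat)

lemma Obj_FunCatD:
  assumes "F \<in> Obj (FunCat S B)"
  shows "s \<in> Obj S \<Longrightarrow> omap F s \<in> Obj B"
    and "f \<in> Arr S \<Longrightarrow> amap F f \<in> Arr B"
    and "f \<in> Arr S \<Longrightarrow> Src B (amap F f) = omap F (Src S f)"
    and "f \<in> Arr S \<Longrightarrow> Tgt B (amap F f) = omap F (Tgt S f)"
    and "s \<in> Obj S \<Longrightarrow> amap F (Ident S s) = Ident B (omap F s)"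
    and "f \<in> Arr S \<Longrightarrow> g \<in> Arr S \<Longrightarrow> Tgt S f = Src S g \<Longrightarrow>
      amap F (g \<cdot>\<^bsub>S\<^esub> f) = amap F g \<cdot>\<^bsub>B\<^esub> amap F f"
  using assms unfolding Obj_FunCat is_functor_def by auto

lemma Obj_FunCatI:
  assumes "\<And>s. s \<in> Obj S \<Longrightarrow> o' s \<in> Obj B"
    and "\<And>f. f \<in> Arr S \<Longrightarrow> a f \<in> Hom B (o' (Src S f)) (o' (Tgt S f))"
    and "\<And>s. s \<in> Obj S \<Longrightarrow> a (Ident S s) = Ident B (o' s)"
    and "\<And>f g. f \<in> Arr S \<Longrightarrow> g \<in> Arr S \<Longrightarrow> Tgt S f = Src S g \<Longrightarrow> a (g \<cdot>\<^bsub>S\<^esub> f) = a g \<cdot>\<^bsub>B\<^esub> a f"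
    and "category S"
  shows "\<lparr>omap = restrict o' (Obj S), amap = restrict a (Arr S)\<rparr> \<in> Obj (FunCat S B)"
proof -
  interpret category S by fact
  show ?thesis
    using assms(1-4) by (simp add: Obj_FunCat is_functor_def)
qed

lemma Arr_FunCatD:
  assumes "\<tau> \<in> Arr (FunCat S B)" "s \<in> Obj S"
  shows "ncomp \<tau> s \<in> Arr B" "Src B (ncomp \<tau> s) = omap (nsrc \<tau>) s" "Tgt B (ncomp \<tau> s) = omap (ntgt \<tau>) s"
  using assms unfolding Arr_FunCat by auto

lemma naturality:
  "\<tau> \<in> Arr (FunCat S B) \<Longrightarrow> f \<in> Arr S \<Longrightarrow>
    ncomp \<tau> (Tgt S f) \<cdot>\<^bsub>B\<^esub> amap (nsrc \<tau>) f = amap (ntgt \<tau>) f \<cdot>\<^bsub>B\<^esub> ncomp \<tau> (Src S f)"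
  unfolding Arr_FunCat by blast

lemma ntrans_eqI:
  assumes "\<sigma> \<in> Arr (FunCat S B)" "\<tau> \<in> Arr (FunCat S B)" "nsrc \<sigma> = nsrc \<tau>" "ntgt \<sigma> = ntgt \<tau>"
    and "\<And>s. s \<in> Obj S \<Longrightarrow> ncomp \<sigma> s = ncomp \<tau> s"
  shows "\<sigma> = \<tau>"
proof -
  have "ncomp \<sigma> = ncomp \<tau>"
    using assms(1,2,5) unfolding Arr_FunCat by (metis extensionalityI)
  then show ?thesis
    using assms(3,4) by simp
qed

lemma ntr_eqI:
  assumes "\<tau> \<in> Arr (FunCat S B)" "nsrc \<tau> = F" "ntgt \<tau> = G" "\<And>s. s \<in> Obj S \<Longrightarrow> c s = ncomp \<tau> s"
  shows "ntr S F G c = \<tau>"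
proof -
  have "restrict c (Obj S) = ncomp \<tau>"
    using assms(1,4) unfolding Arr_FunCat by (auto intro: extensionalityI[of _ "Obj S"])
  then show ?thesis
    using assms(2,3) by (simp add: ntr_def)
qed

lemma ntr_cong:
  "(\<And>s. s \<in> Obj S \<Longrightarrow> c s = d s) \<Longrightarrow> ntr S F G c = ntr S F G d"
  by (auto simp: ntr_def restrict_def)

text \<open>\<open>FunCat (Op S) (OpA B)\<close> has the same objects as \<open>FunCat S B\<close> but its transformations carry the
  opposite source and target; along \<open>swap_ntrans\<close>, statements about kernels and monomorphisms give
  those about cokernels and epimorphisms.\<close>

definition swap_ntrans :: "('s, 't, 'o, 'a) ntrans \<Rightarrow> ('s, 't, 'o, 'a) ntrans" where
  "swap_ntrans \<tau> = \<lparr>nsrc = ntgt \<tau>, ntgt = nsrc \<tau>, ncomp = ncomp \<tau>\<rparr>"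

lemma swap_ntrans_simps [simp]:
  "nsrc (swap_ntrans \<tau>) = ntgt \<tau>" "ntgt (swap_ntrans \<tau>) = nsrc \<tau>" "ncomp (swap_ntrans \<tau>) = ncomp \<tau>"
  "swap_ntrans (swap_ntrans \<tau>) = \<tau>" "swap_ntrans (ntr S F G c) = ntr S G F c"
  by (simp_all add: swap_ntrans_def ntr_def)

lemma Op_simps [simp]:
  "Obj (Op C) = Obj C" "Arr (Op C) = Arr C" "Src (Op C) = Tgt C" "Tgt (Op C) = Src C"
  "Ident (Op C) = Ident C" "Comp (Op C) g f = f \<cdot>\<^bsub>C\<^esub> g"
  by (auto simp: Op_def)

lemma (in category) category_Op: "category (Op C)"
  by unfold_locales auto

lemma ntr_Op [simp]: "ntr (Op S) = ntr S"
  by (simp add: ntr_def fun_eq_iff)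

lemma Obj_FunCat_dual: "Obj (FunCat (Op S) (OpA B)) = Obj (FunCat S B)"
  unfolding set_eq_iff Obj_FunCat is_functor_def by auto

lemma Arr_FunCat_dual:
  "\<tau> \<in> Arr (FunCat (Op S) (OpA B)) \<longleftrightarrow> swap_ntrans \<tau> \<in> Arr (FunCat S B)"
  unfolding Arr_FunCat Obj_FunCat_dual by auto

lemma swap_ntrans_eq_iff: "swap_ntrans \<sigma> = \<tau> \<longleftrightarrow> \<sigma> = swap_ntrans \<tau>"
  by (metis swap_ntrans_simps(4))

lemma is_epi_FunCat_dual:
  assumes "is_epi (FunCat S B) \<tau>"
  shows "is_mono (FunCat (Op S) (OpA B)) (swap_ntrans \<tau>)"
  unfolding is_mono_def
proof (intro conjI ballI impI)
  let ?D = "FunCat (Op S) (OpA B)"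
  show "swap_ntrans \<tau> \<in> Arr ?D"
    using assms by (simp add: is_epi_def Arr_FunCat_dual)
  fix W g h
  assume "W \<in> Obj ?D" "g \<in> Hom ?D W (Src ?D (swap_ntrans \<tau>))" "h \<in> Hom ?D W (Src ?D (swap_ntrans \<tau>))"
    and eq: "swap_ntrans \<tau> \<cdot>\<^bsub>?D\<^esub> g = swap_ntrans \<tau> \<cdot>\<^bsub>?D\<^esub> h"
  then have "W \<in> Obj (FunCat S B)" "swap_ntrans g \<in> Hom (FunCat S B) (ntgt \<tau>) W"
    "swap_ntrans h \<in> Hom (FunCat S B) (ntgt \<tau>) W"
    by (simp_all add: Obj_FunCat_dual Arr_FunCat_dual)
  moreover have "swap_ntrans g \<cdot>\<^bsub>FunCat S B\<^esub> \<tau> = swap_ntrans h \<cdot>\<^bsub>FunCat S B\<^esub> \<tau>"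
    using arg_cong[OF eq, of swap_ntrans] by simp
  ultimately have "swap_ntrans g = swap_ntrans h"
    using assms unfolding is_epi_def FunCat_simps by blast
  then show "g = h"
    by (metis swap_ntrans_simps(4))
qed

lemma is_kernel_FunCat_dual:
  assumes "is_kernel (FunCat (Op S) (OpA B)) \<tau> \<kappa>"
  shows "is_cokernel (FunCat S B) (swap_ntrans \<tau>) (swap_ntrans \<kappa>)"
  unfolding is_cokernel_def
proof (intro conjI ballI impI)
  let ?D = "FunCat (Op S) (OpA B)" and ?Fn = "FunCat S B"
  note k = assms[unfolded is_kernel_def]
  show "swap_ntrans \<tau> \<in> Arr ?Fn" "swap_ntrans \<kappa> \<in> Arr ?Fn"
    using k by (simp_all add: Arr_FunCat_dual)
  show "Src ?Fn (swap_ntrans \<kappa>) = Tgt ?Fn (swap_ntrans \<tau>)"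
    using k by simp
  have "\<tau> \<cdot>\<^bsub>?D\<^esub> \<kappa> = HZero ?D (Src ?D \<kappa>) (Tgt ?D \<tau>)"
    using k by blast
  from arg_cong[OF this, of swap_ntrans]
  show "swap_ntrans \<kappa> \<cdot>\<^bsub>?Fn\<^esub> swap_ntrans \<tau> = HZero ?Fn (Src ?Fn (swap_ntrans \<tau>)) (Tgt ?Fn (swap_ntrans \<kappa>))"
    by simp
  fix W h
  assume W: "W \<in> Obj ?Fn" and h: "h \<in> Hom ?Fn (Tgt ?Fn (swap_ntrans \<tau>)) W"
    and eq: "h \<cdot>\<^bsub>?Fn\<^esub> swap_ntrans \<tau> = HZero ?Fn (Src ?Fn (swap_ntrans \<tau>)) W"
  have "W \<in> Obj ?D" "swap_ntrans h \<in> Hom ?D W (Src ?D \<tau>)"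
    "\<tau> \<cdot>\<^bsub>?D\<^esub> swap_ntrans h = HZero ?D W (Tgt ?D \<tau>)"
    using W h arg_cong[OF eq, of swap_ntrans] by (simp_all add: Obj_FunCat_dual Arr_FunCat_dual)
  then obtain u where u: "u \<in> Hom ?D W (Src ?D \<kappa>)" "\<kappa> \<cdot>\<^bsub>?D\<^esub> u = swap_ntrans h"
    and un: "\<And>v. v \<in> Hom ?D W (Src ?D \<kappa>) \<Longrightarrow> \<kappa> \<cdot>\<^bsub>?D\<^esub> v = swap_ntrans h \<Longrightarrow> v = u"
    using k by blast
  have hu: "swap_ntrans (\<kappa> \<cdot>\<^bsub>?D\<^esub> u) = h"
    unfolding u(2) by simp
  show "\<exists>!u. u \<in> Hom ?Fn (Tgt ?Fn (swap_ntrans \<kappa>)) W \<and> u \<cdot>\<^bsub>?Fn\<^esub> swap_ntrans \<kappa> = h"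
  proof (rule ex1I[of _ "swap_ntrans u"])
    show "swap_ntrans u \<in> Hom ?Fn (Tgt ?Fn (swap_ntrans \<kappa>)) W \<and> swap_ntrans u \<cdot>\<^bsub>?Fn\<^esub> swap_ntrans \<kappa> = h"
      using u(1) hu by (simp add: Arr_FunCat_dual)
    fix v
    assume v: "v \<in> Hom ?Fn (Tgt ?Fn (swap_ntrans \<kappa>)) W \<and> v \<cdot>\<^bsub>?Fn\<^esub> swap_ntrans \<kappa> = h"
    have "\<kappa> \<cdot>\<^bsub>?D\<^esub> swap_ntrans v = swap_ntrans (v \<cdot>\<^bsub>?Fn\<^esub> swap_ntrans \<kappa>)"
      by simp
    also have "\<dots> = swap_ntrans h"
      by (rule arg_cong[OF conjunct2[OF v]])
    finally have "\<kappa> \<cdot>\<^bsub>?D\<^esub> swap_ntrans v = swap_ntrans h" .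
    moreover have "swap_ntrans v \<in> Hom ?D W (Src ?D \<kappa>)"
      using v by (simp add: Arr_FunCat_dual)
    ultimately have "swap_ntrans v = u"
      by (intro un)
    then show "v = swap_ntrans u"
      by (simp add: swap_ntrans_eq_iff)
  qed
qed

section \<open>The functor category over an abelian category is abelian\<close>

locale functor_category = S: category S + B: abelian_category B
  for S :: "('s, 't, 'z) category_scheme" and B :: "('o, 'a, 'y) ab_category_scheme"
begin

lemmas [simp] = Obj_FunCatD[of _ S B] Arr_FunCatD[of _ S B]

lemma ntr_Arr:
  assumes "F \<in> Obj (FunCat S B)" "G \<in> Obj (FunCat S B)"
    and "\<And>s. s \<in> Obj S \<Longrightarrow> c s \<in> Hom B (omap F s) (omap G s)"
    and "\<And>f. f \<in> Arr S \<Longrightarrow> c (Tgt S f) \<cdot>\<^bsub>B\<^esub> amap F f = amap G f \<cdot>\<^bsub>B\<^esub> c (Src S f)"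
  shows "ntr S F G c \<in> Arr (FunCat S B)"
  using assms unfolding Arr_FunCat by (simp add: ntr_def)

lemma ntr_comp_Arr:
  assumes "\<sigma> \<in> Arr (FunCat S B)" "\<tau> \<in> Arr (FunCat S B)" "ntgt \<sigma> = nsrc \<tau>"
  shows "ntr S (nsrc \<sigma>) (ntgt \<tau>) (\<lambda>s. ncomp \<tau> s \<cdot>\<^bsub>B\<^esub> ncomp \<sigma> s) \<in> Arr (FunCat S B)"
proof (rule ntr_Arr)
  fix f
  assume [simp]: "f \<in> Arr S"
  note [simp] = assms
  have "ncomp \<tau> (Tgt S f) \<cdot>\<^bsub>B\<^esub> (ncomp \<sigma> (Tgt S f) \<cdot>\<^bsub>B\<^esub> amap (nsrc \<sigma>) f) =
    (ncomp \<tau> (Tgt S f) \<cdot>\<^bsub>B\<^esub> amap (nsrc \<tau>) f) \<cdot>\<^bsub>B\<^esub> ncomp \<sigma> (Src S f)"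
    by (subst naturality) simp_all
  also have "\<dots> = amap (ntgt \<tau>) f \<cdot>\<^bsub>B\<^esub> (ncomp \<tau> (Src S f) \<cdot>\<^bsub>B\<^esub> ncomp \<sigma> (Src S f))"
    by (subst naturality) simp_all
  finally show "(ncomp \<tau> (Tgt S f) \<cdot>\<^bsub>B\<^esub> ncomp \<sigma> (Tgt S f)) \<cdot>\<^bsub>B\<^esub> amap (nsrc \<sigma>) f =
    amap (ntgt \<tau>) f \<cdot>\<^bsub>B\<^esub> (ncomp \<tau> (Src S f) \<cdot>\<^bsub>B\<^esub> ncomp \<sigma> (Src S f))"
    by simp
qed (use assms in simp_all)

sublocale Fn: category "FunCat S B"
proof
  fix f x y
  assume "f \<in> Hom (FunCat S B) x y"
  then show "f \<cdot>\<^bsub>FunCat S B\<^esub> Ident (FunCat S B) x = f" "Ident (FunCat S B) y \<cdot>\<^bsub>FunCat S B\<^esub> f = f"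
    by (auto intro!: ntr_eqI[of f S B])
next
  fix f g h w x y z
  assume "f \<in> Hom (FunCat S B) w x" "g \<in> Hom (FunCat S B) x y" "h \<in> Hom (FunCat S B) y z"
  then show "h \<cdot>\<^bsub>FunCat S B\<^esub> g \<cdot>\<^bsub>FunCat S B\<^esub> f = h \<cdot>\<^bsub>FunCat S B\<^esub> (g \<cdot>\<^bsub>FunCat S B\<^esub> f)"
    by (auto intro!: ntr_cong)
qed (auto intro!: ntr_Arr ntr_comp_Arr)

lemma ntr_add_Arr:
  assumes "\<sigma> \<in> Arr (FunCat S B)" "\<tau> \<in> Arr (FunCat S B)" "nsrc \<sigma> = nsrc \<tau>" "ntgt \<sigma> = ntgt \<tau>"
  shows "ntr S (nsrc \<sigma>) (ntgt \<sigma>) (\<lambda>s. ncomp \<sigma> s \<oplus>\<^bsub>B\<^esub> ncomp \<tau> s) \<in> Arr (FunCat S B)"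
  using assms naturality[OF assms(1)] naturality[OF assms(2)] by (intro ntr_Arr) simp_all

lemma ntr_zero_Arr:
  assumes "F \<in> Obj (FunCat S B)" "G \<in> Obj (FunCat S B)"
  shows "ntr S F G (\<lambda>s. HZero B (omap F s) (omap G s)) \<in> Arr (FunCat S B)"
  using assms by (intro ntr_Arr) simp_all

text \<open>Negatives chosen objectwise are natural: adding the naturality square of
  \<open>\<tau>\<close> makes both sides of the desired square zero, and the added term is
  cancelled.\<close>

lemma ex_neg_ntrans:
  assumes [simp]: "\<tau> \<in> Arr (FunCat S B)"
  obtains \<sigma> where "\<sigma> \<in> Arr (FunCat S B)" "nsrc \<sigma> = nsrc \<tau>" "ntgt \<sigma> = ntgt \<tau>"
    "\<And>s. s \<in> Obj S \<Longrightarrow> ncomp \<sigma> s \<oplus>\<^bsub>B\<^esub> ncomp \<tau> s = HZero B (omap (nsrc \<tau>) s) (omap (ntgt \<tau>) s)"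
proof -
  have "\<exists>n. n \<in> Arr B \<and> Src B n = omap (nsrc \<tau>) s \<and> Tgt B n = omap (ntgt \<tau>) s \<and>
    n \<oplus>\<^bsub>B\<^esub> ncomp \<tau> s = HZero B (omap (nsrc \<tau>) s) (omap (ntgt \<tau>) s)" if "s \<in> Obj S" for s
    by (rule B.ex_neg[of "ncomp \<tau> s"]) (use that in auto)
  then obtain n where [simp]: "\<And>s. s \<in> Obj S \<Longrightarrow> n s \<in> Arr B" "\<And>s. s \<in> Obj S \<Longrightarrow> Src B (n s) = omap (nsrc \<tau>) s"
    "\<And>s. s \<in> Obj S \<Longrightarrow> Tgt B (n s) = omap (ntgt \<tau>) s"
    and n: "\<And>s. s \<in> Obj S \<Longrightarrow> n s \<oplus>\<^bsub>B\<^esub> ncomp \<tau> s = HZero B (omap (nsrc \<tau>) s) (omap (ntgt \<tau>) s)"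
    by metis
  have "ntr S (nsrc \<tau>) (ntgt \<tau>) n \<in> Arr (FunCat S B)"
  proof (rule ntr_Arr)
    fix f
    assume [simp]: "f \<in> Arr S"
    show "n (Tgt S f) \<cdot>\<^bsub>B\<^esub> amap (nsrc \<tau>) f = amap (ntgt \<tau>) f \<cdot>\<^bsub>B\<^esub> n (Src S f)"
    proof (rule B.HAdd_right_cancel[of _ "ncomp \<tau> (Tgt S f) \<cdot>\<^bsub>B\<^esub> amap (nsrc \<tau>) f"])
      have "n (Tgt S f) \<cdot>\<^bsub>B\<^esub> amap (nsrc \<tau>) f \<oplus>\<^bsub>B\<^esub> ncomp \<tau> (Tgt S f) \<cdot>\<^bsub>B\<^esub> amap (nsrc \<tau>) f =
        (n (Tgt S f) \<oplus>\<^bsub>B\<^esub> ncomp \<tau> (Tgt S f)) \<cdot>\<^bsub>B\<^esub> amap (nsrc \<tau>) f"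
        by simp
      also have "\<dots> = amap (ntgt \<tau>) f \<cdot>\<^bsub>B\<^esub> (n (Src S f) \<oplus>\<^bsub>B\<^esub> ncomp \<tau> (Src S f))"
        by (simp add: n del: B.Comp_HAdd)
      also have "\<dots> = amap (ntgt \<tau>) f \<cdot>\<^bsub>B\<^esub> n (Src S f) \<oplus>\<^bsub>B\<^esub> ncomp \<tau> (Tgt S f) \<cdot>\<^bsub>B\<^esub> amap (nsrc \<tau>) f"
        by (simp add: naturality)
      finally show "n (Tgt S f) \<cdot>\<^bsub>B\<^esub> amap (nsrc \<tau>) f \<oplus>\<^bsub>B\<^esub> ncomp \<tau> (Tgt S f) \<cdot>\<^bsub>B\<^esub> amap (nsrc \<tau>) f =
        amap (ntgt \<tau>) f \<cdot>\<^bsub>B\<^esub> n (Src S f) \<oplus>\<^bsub>B\<^esub> ncomp \<tau> (Tgt S f) \<cdot>\<^bsub>B\<^esub> amap (nsrc \<tau>) f" .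
    qed simp_all
  qed simp_all
  then show thesis
    using that[of "ntr S (nsrc \<tau>) (ntgt \<tau>) n"] n by simp
qed

sublocale Fn: preadditive_category "FunCat S B"
proof (intro preadditive_category.intro preadditive_category_axioms.intro Fn.category_axioms, goal_cases)
  case (1 F G)
  show ?case
  proof (rule comm_groupI, goal_cases)
    case (6 \<tau>)
    then have \<tau>: "\<tau> \<in> Arr (FunCat S B)" "nsrc \<tau> = F" "ntgt \<tau> = G"
      by simp_all
    obtain \<sigma> where "\<sigma> \<in> Arr (FunCat S B)" "nsrc \<sigma> = nsrc \<tau>" "ntgt \<sigma> = ntgt \<tau>"
      "\<And>s. s \<in> Obj S \<Longrightarrow> ncomp \<sigma> s \<oplus>\<^bsub>B\<^esub> ncomp \<tau> s = HZero B (omap (nsrc \<tau>) s) (omap (ntgt \<tau>) s)"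
      using ex_neg_ntrans[OF \<tau>(1)] by blast
    then show ?case
      using \<tau> by (auto intro!: bexI[of _ \<sigma>] ntr_cong)
  qed (use 1 in \<open>auto intro!: ntr_add_Arr ntr_zero_Arr ntr_cong ntr_eqI[of _ S B] B.HAdd_assoc B.HAdd_commute\<close>)
qed (auto intro!: ntr_cong)

text \<open>Factorizations exist at each object. They form a natural transformation because
  naturality can be tested after the mono \<open>ncomp \<kappa> (Tgt S f)\<close>.\<close>

lemma is_kernel_objectwise:
  assumes \<tau> [simp]: "\<tau> \<in> Arr (FunCat S B)" and \<kappa> [simp]: "\<kappa> \<in> Arr (FunCat S B)" "ntgt \<kappa> = nsrc \<tau>"
    and ker: "\<And>s. s \<in> Obj S \<Longrightarrow> is_kernel B (ncomp \<tau> s) (ncomp \<kappa> s)"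
  shows "is_kernel (FunCat S B) \<tau> \<kappa>"
proof (rule Fn.is_kernelI)
  show "\<tau> \<cdot>\<^bsub>FunCat S B\<^esub> \<kappa> = HZero (FunCat S B) (Src (FunCat S B) \<kappa>) (Tgt (FunCat S B) \<tau>)"
    using B.kernelD(4)[OF ker] by (auto intro!: ntr_cong)
  show "is_mono (FunCat S B) \<kappa>"
    unfolding is_mono_def
  proof (intro conjI ballI impI)
    fix W g h
    assume gh: "g \<in> Hom (FunCat S B) W (Src (FunCat S B) \<kappa>)" "h \<in> Hom (FunCat S B) W (Src (FunCat S B) \<kappa>)"
      and eq: "\<kappa> \<cdot>\<^bsub>FunCat S B\<^esub> g = \<kappa> \<cdot>\<^bsub>FunCat S B\<^esub> h"
    show "g = h"
    proof (rule ntrans_eqI)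
      fix s
      assume s: "s \<in> Obj S"
      have "ncomp \<kappa> s \<cdot>\<^bsub>B\<^esub> ncomp g s = ncomp \<kappa> s \<cdot>\<^bsub>B\<^esub> ncomp h s"
        using arg_cong[OF eq, of "\<lambda>\<tau>. ncomp \<tau> s"] s by simp
      then show "ncomp g s = ncomp h s"
        by (rule B.mono_cancel[OF B.kernel_mono[OF ker[OF s]]]) (use gh s in simp_all)
    qed (use gh in auto)
  qed simp
  fix h
  assume h0: "h \<in> Arr (FunCat S B)" "Tgt (FunCat S B) h = Src (FunCat S B) \<tau>"
    and eq: "\<tau> \<cdot>\<^bsub>FunCat S B\<^esub> h = HZero (FunCat S B) (Src (FunCat S B) h) (Tgt (FunCat S B) \<tau>)"
  then have h [simp]: "h \<in> Arr (FunCat S B)" "ntgt h = nsrc \<tau>"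
    by simp_all
  have "\<exists>u. u \<in> Arr B \<and> Src B u = omap (nsrc h) s \<and> Tgt B u = omap (nsrc \<kappa>) s \<and> ncomp \<kappa> s \<cdot>\<^bsub>B\<^esub> u = ncomp h s"
    if s: "s \<in> Obj S" for s
  proof -
    have "ncomp \<tau> s \<cdot>\<^bsub>B\<^esub> ncomp h s = HZero B (omap (nsrc h) s) (omap (ntgt \<tau>) s)"
      using arg_cong[OF eq, of "\<lambda>\<tau>. ncomp \<tau> s"] s by simp
    then show ?thesis
      using B.kernel_factor[OF ker[OF s], of "ncomp h s"] s by (metis Arr_FunCatD h \<tau> \<kappa>)
  qed
  then obtain u where [simp]: "\<And>s. s \<in> Obj S \<Longrightarrow> u s \<in> Arr B" "\<And>s. s \<in> Obj S \<Longrightarrow> Src B (u s) = omap (nsrc h) s"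
    "\<And>s. s \<in> Obj S \<Longrightarrow> Tgt B (u s) = omap (nsrc \<kappa>) s"
    and u: "\<And>s. s \<in> Obj S \<Longrightarrow> ncomp \<kappa> s \<cdot>\<^bsub>B\<^esub> u s = ncomp h s"
    by metis
  have "ntr S (nsrc h) (nsrc \<kappa>) u \<in> Arr (FunCat S B)"
  proof (rule ntr_Arr)
    fix f
    assume [simp]: "f \<in> Arr S"
    show "u (Tgt S f) \<cdot>\<^bsub>B\<^esub> amap (nsrc h) f = amap (nsrc \<kappa>) f \<cdot>\<^bsub>B\<^esub> u (Src S f)"
    proof (rule B.mono_cancel[OF B.kernel_mono[OF ker]])
      show "ncomp \<kappa> (Tgt S f) \<cdot>\<^bsub>B\<^esub> (u (Tgt S f) \<cdot>\<^bsub>B\<^esub> amap (nsrc h) f) =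
        ncomp \<kappa> (Tgt S f) \<cdot>\<^bsub>B\<^esub> (amap (nsrc \<kappa>) f \<cdot>\<^bsub>B\<^esub> u (Src S f))"
        by (simp add: B.Comp_reassoc[OF u] naturality B.Comp_reassoc[OF naturality[of \<kappa> S B f]] u)
    qed simp_all
  qed simp_all
  then show "\<exists>u\<in>Arr (FunCat S B). Src (FunCat S B) u = Src (FunCat S B) h \<and>
    Tgt (FunCat S B) u = Src (FunCat S B) \<kappa> \<and> \<kappa> \<cdot>\<^bsub>FunCat S B\<^esub> u = h"
    by (intro bexI[of _ "ntr S (nsrc h) (nsrc \<kappa>) u"]) (auto intro!: ntr_eqI[of h S B] simp: u)
qed simp_all

text \<open>Kernels chosen at each object become a functor: an arrow of \<open>S\<close> acts by the
  induced factorization, and the functor laws follow by cancelling the monos \<open>k s\<close>. The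
  objectwise property is exported because \<open>is_kernel\<close> in the functor category speaks of
  whole transformations only.\<close>

lemma ex_objectwise_kernel:
  assumes [simp]: "\<tau> \<in> Arr (FunCat S B)"
  obtains \<kappa> where "\<kappa> \<in> Arr (FunCat S B)" "ntgt \<kappa> = nsrc \<tau>"
    "\<And>s. s \<in> Obj S \<Longrightarrow> is_kernel B (ncomp \<tau> s) (ncomp \<kappa> s)"
proof -
  have "\<exists>k. is_kernel B (ncomp \<tau> s) k" if "s \<in> Obj S" for s
    using that by (intro B.has_kernels) simp
  then obtain k where ker: "\<And>s. s \<in> Obj S \<Longrightarrow> is_kernel B (ncomp \<tau> s) (k s)"
    by metis
  note mono = B.kernel_mono[OF ker]
  have k [simp]: "\<And>s. s \<in> Obj S \<Longrightarrow> k s \<in> Arr B" "\<And>s. s \<in> Obj S \<Longrightarrow> Tgt B (k s) = omap (nsrc \<tau>) s"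
    and \<tau>k: "\<And>s. s \<in> Obj S \<Longrightarrow> ncomp \<tau> s \<cdot>\<^bsub>B\<^esub> k s = HZero B (Src B (k s)) (omap (ntgt \<tau>) s)"
    using B.kernelD[OF ker] by simp_all
  have "\<exists>a. a \<in> Arr B \<and> Src B a = Src B (k (Src S f)) \<and> Tgt B a = Src B (k (Tgt S f)) \<and>
    k (Tgt S f) \<cdot>\<^bsub>B\<^esub> a = amap (nsrc \<tau>) f \<cdot>\<^bsub>B\<^esub> k (Src S f)" if [simp]: "f \<in> Arr S" for f
  proof -
    have "ncomp \<tau> (Tgt S f) \<cdot>\<^bsub>B\<^esub> (amap (nsrc \<tau>) f \<cdot>\<^bsub>B\<^esub> k (Src S f)) =
      amap (ntgt \<tau>) f \<cdot>\<^bsub>B\<^esub> (ncomp \<tau> (Src S f) \<cdot>\<^bsub>B\<^esub> k (Src S f))"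
      by (simp add: B.Comp_reassoc[OF naturality[of \<tau> S B f]])
    also have "\<dots> = HZero B (Src B (k (Src S f))) (omap (ntgt \<tau>) (Tgt S f))"
      by (simp add: \<tau>k)
    finally have *: "ncomp \<tau> (Tgt S f) \<cdot>\<^bsub>B\<^esub> (amap (nsrc \<tau>) f \<cdot>\<^bsub>B\<^esub> k (Src S f)) =
      HZero B (Src B (k (Src S f))) (omap (ntgt \<tau>) (Tgt S f))" .
    show ?thesis
      by (rule B.kernel_factor[OF ker[of "Tgt S f"], of "amap (nsrc \<tau>) f \<cdot>\<^bsub>B\<^esub> k (Src S f)"])
        (use * in \<open>auto intro: exI\<close>)
  qed
  then obtain a where [simp]: "\<And>f. f \<in> Arr S \<Longrightarrow> a f \<in> Arr B" "\<And>f. f \<in> Arr S \<Longrightarrow> Src B (a f) = Src B (k (Src S f))"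
    "\<And>f. f \<in> Arr S \<Longrightarrow> Tgt B (a f) = Src B (k (Tgt S f))"
    and a: "\<And>f. f \<in> Arr S \<Longrightarrow> k (Tgt S f) \<cdot>\<^bsub>B\<^esub> a f = amap (nsrc \<tau>) f \<cdot>\<^bsub>B\<^esub> k (Src S f)"
    by metis
  define K where "K = \<lparr>omap = restrict (\<lambda>s. Src B (k s)) (Obj S), amap = restrict a (Arr S)\<rparr>"
  have K: "K \<in> Obj (FunCat S B)"
    unfolding K_def
  proof (rule Obj_FunCatI)
    fix s
    assume [simp]: "s \<in> Obj S"
    show "a (Ident S s) = Ident B (Src B (k s))"
      by (rule B.mono_cancel[OF mono, of s]) (use a[of "Ident S s"] in simp_all)
  next
    fix f g
    assume [simp]: "f \<in> Arr S" "g \<in> Arr S" "Tgt S f = Src S g"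
    show "a (g \<cdot>\<^bsub>S\<^esub> f) = a g \<cdot>\<^bsub>B\<^esub> a f"
    proof (rule B.mono_cancel[OF mono, of "Tgt S g"])
      show "k (Tgt S g) \<cdot>\<^bsub>B\<^esub> a (g \<cdot>\<^bsub>S\<^esub> f) = k (Tgt S g) \<cdot>\<^bsub>B\<^esub> (a g \<cdot>\<^bsub>B\<^esub> a f)"
        using a[of "g \<cdot>\<^bsub>S\<^esub> f"] a[of f] by (simp add: B.Comp_reassoc[OF a])
    qed simp_all
  qed (simp_all add: S.category_axioms)
  have "ntr S K (nsrc \<tau>) k \<in> Arr (FunCat S B)"
    using K by (intro ntr_Arr) (simp_all add: K_def a)
  then show thesis
    using ker by (intro that[of "ntr S K (nsrc \<tau>) k"]) simp_all
qed

text \<open>Being mono refers to arrows from whole functors, not from objects of \<open>B\<close>.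
  The objectwise kernel gives access to the components: \<open>\<tau>\<close> kills
  \<open>\<kappa>\<close>, so \<open>\<kappa> = 0\<close>, and an arrow whose kernel is zero is
  mono.\<close>

lemma mono_objectwise:
  assumes \<tau>: "is_mono (FunCat S B) \<tau>" and s: "s \<in> Obj S"
  shows "is_mono B (ncomp \<tau> s)"
proof -
  note [simp] = Fn.mono_Arr[OF \<tau>]
  obtain \<kappa> where \<kappa>: "\<kappa> \<in> Arr (FunCat S B)" "ntgt \<kappa> = nsrc \<tau>"
    and ker: "\<And>s. s \<in> Obj S \<Longrightarrow> is_kernel B (ncomp \<tau> s) (ncomp \<kappa> s)"
    using ex_objectwise_kernel[of \<tau>] by auto
  have "\<kappa> = HZero (FunCat S B) (nsrc \<kappa>) (nsrc \<tau>)"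
    using Fn.mono_zero[OF \<tau>, of \<kappa>] \<kappa> Fn.kernelD(4)[OF is_kernel_objectwise[OF _ \<kappa> ker]] by simp
  then have "ncomp \<kappa> s = ncomp (HZero (FunCat S B) (nsrc \<kappa>) (nsrc \<tau>)) s"
    by (rule arg_cong)
  then have *: "ncomp \<kappa> s = HZero B (omap (nsrc \<kappa>) s) (omap (nsrc \<tau>) s)"
    using s by simp
  show ?thesis
  proof (rule B.is_monoI)
    fix g
    assume g: "g \<in> Arr B" "Tgt B g = Src B (ncomp \<tau> s)" "ncomp \<tau> s \<cdot>\<^bsub>B\<^esub> g = HZero B (Src B g) (Tgt B (ncomp \<tau> s))"
    obtain u where u: "u \<in> Arr B" "Src B u = Src B g" "Tgt B u = Src B (ncomp \<kappa> s)" "ncomp \<kappa> s \<cdot>\<^bsub>B\<^esub> u = g"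
      using B.kernel_factor[OF ker[OF s] g] by blast
    have "ncomp \<kappa> s \<cdot>\<^bsub>B\<^esub> u = HZero B (Src B g) (Src B (ncomp \<tau> s))"
      unfolding * using u(1-3) s \<kappa> g(1) by simp
    then show "g = HZero B (Src B g) (Src B (ncomp \<tau> s))"
      using u(4) by simp
  qed (use s in simp)
qed

lemma dual_functor_category: "functor_category (Op S) (OpA B)"
  by (intro functor_category.intro S.category_Op B.abelian_OpA)

lemma is_cokernel_objectwise:
  assumes "\<tau> \<in> Arr (FunCat S B)" "\<gamma> \<in> Arr (FunCat S B)" "nsrc \<gamma> = ntgt \<tau>"
    and "\<And>s. s \<in> Obj S \<Longrightarrow> is_cokernel B (ncomp \<tau> s) (ncomp \<gamma> s)"
  shows "is_cokernel (FunCat S B) \<tau> \<gamma>"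
  using is_kernel_FunCat_dual[OF functor_category.is_kernel_objectwise[OF dual_functor_category,
        of "swap_ntrans \<tau>" "swap_ntrans \<gamma>"]] assms by (simp add: Arr_FunCat_dual)

lemma ex_objectwise_cokernel:
  assumes "\<tau> \<in> Arr (FunCat S B)"
  obtains \<gamma> where "\<gamma> \<in> Arr (FunCat S B)" "nsrc \<gamma> = ntgt \<tau>"
    "\<And>s. s \<in> Obj S \<Longrightarrow> is_cokernel B (ncomp \<tau> s) (ncomp \<gamma> s)"
proof -
  obtain \<kappa> where \<kappa>: "\<kappa> \<in> Arr (FunCat (Op S) (OpA B))" "ntgt \<kappa> = nsrc (swap_ntrans \<tau>)"
    "\<And>s. s \<in> Obj (Op S) \<Longrightarrow> is_kernel (OpA B) (ncomp (swap_ntrans \<tau>) s) (ncomp \<kappa> s)"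
    using functor_category.ex_objectwise_kernel[OF dual_functor_category, of "swap_ntrans \<tau>"] assms
    by (auto simp: Arr_FunCat_dual)
  moreover have "swap_ntrans \<kappa> \<in> Arr (FunCat S B)"
    using \<kappa>(1) by (simp add: Arr_FunCat_dual)
  ultimately show thesis
    using that[of "swap_ntrans \<kappa>"] by simp
qed

lemma epi_objectwise:
  assumes "is_epi (FunCat S B) \<tau>" and "s \<in> Obj S"
  shows "is_epi B (ncomp \<tau> s)"
  using functor_category.mono_objectwise[OF dual_functor_category is_epi_FunCat_dual[OF assms(1)], of s] assms(2)
  by simp

lemma ex_objectwise_biproduct:
  assumes [simp]: "F \<in> Obj (FunCat S B)" "G \<in> Obj (FunCat S B)"
  shows "\<exists>j\<^sub>1 j\<^sub>2 q\<^sub>1 q\<^sub>2. is_biproduct (FunCat S B) F G j\<^sub>1 j\<^sub>2 q\<^sub>1 q\<^sub>2"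
proof -
  have "\<exists>j\<^sub>1 j\<^sub>2 q\<^sub>1 q\<^sub>2. is_biproduct B (omap F s) (omap G s) j\<^sub>1 j\<^sub>2 q\<^sub>1 q\<^sub>2" if "s \<in> Obj S" for s
    using that by (intro B.has_biproducts) simp_all
  then obtain j\<^sub>1 j\<^sub>2 q\<^sub>1 q\<^sub>2 where bp: "\<And>s. s \<in> Obj S \<Longrightarrow> is_biproduct B (omap F s) (omap G s) (j\<^sub>1 s) (j\<^sub>2 s) (q\<^sub>1 s) (q\<^sub>2 s)"
    by metis
  define z where "z s = Tgt B (j\<^sub>1 s)" for s
  have [simp]: "z s \<in> Obj B"
    "j\<^sub>1 s \<in> Arr B" "Src B (j\<^sub>1 s) = omap F s" "Tgt B (j\<^sub>1 s) = z s"
    "j\<^sub>2 s \<in> Arr B" "Src B (j\<^sub>2 s) = omap G s" "Tgt B (j\<^sub>2 s) = z s"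
    "q\<^sub>1 s \<in> Arr B" "Src B (q\<^sub>1 s) = z s" "Tgt B (q\<^sub>1 s) = omap F s"
    "q\<^sub>2 s \<in> Arr B" "Src B (q\<^sub>2 s) = z s" "Tgt B (q\<^sub>2 s) = omap G s"
    and qj: "q\<^sub>1 s \<cdot>\<^bsub>B\<^esub> j\<^sub>1 s = Ident B (omap F s)" "q\<^sub>2 s \<cdot>\<^bsub>B\<^esub> j\<^sub>2 s = Ident B (omap G s)"
      "q\<^sub>2 s \<cdot>\<^bsub>B\<^esub> j\<^sub>1 s = HZero B (omap F s) (omap G s)"
      "q\<^sub>1 s \<cdot>\<^bsub>B\<^esub> j\<^sub>2 s = HZero B (omap G s) (omap F s)"
    and jq: "j\<^sub>1 s \<cdot>\<^bsub>B\<^esub> q\<^sub>1 s \<oplus>\<^bsub>B\<^esub> j\<^sub>2 s \<cdot>\<^bsub>B\<^esub> q\<^sub>2 s = Ident B (z s)"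
    if "s \<in> Obj S" for s
    by (rule B.biproductE[OF bp[OF that]]; simp add: z_def)+
  note qj' = qj[THEN B.Comp_reassoc]
  \<comment> \<open>The direct sum of \<open>amap F f\<close> and \<open>amap G f\<close>, bracketed
    to the right as the simp rules for composition normalise it.\<close>
  define a where "a f = j\<^sub>1 (Tgt S f) \<cdot>\<^bsub>B\<^esub> (amap F f \<cdot>\<^bsub>B\<^esub> q\<^sub>1 (Src S f)) \<oplus>\<^bsub>B\<^esub> j\<^sub>2 (Tgt S f) \<cdot>\<^bsub>B\<^esub> (amap G f \<cdot>\<^bsub>B\<^esub> q\<^sub>2 (Src S f))" for f
  have a [simp]: "a f \<in> Arr B" "Src B (a f) = z (Src S f)" "Tgt B (a f) = z (Tgt S f)" if "f \<in> Arr S" for f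
    using that by (simp_all add: a_def)
  define Z where "Z = \<lparr>omap = restrict z (Obj S), amap = restrict a (Arr S)\<rparr>"
  have Z [simp]: "Z \<in> Obj (FunCat S B)"
    unfolding Z_def by (rule Obj_FunCatI) (simp_all add: S.category_axioms, simp_all add: a_def jq qj')
  have [simp]: "s \<in> Obj S \<Longrightarrow> omap Z s = z s" "f \<in> Arr S \<Longrightarrow> amap Z f = a f" for s f
    by (simp_all add: Z_def)
  have [simp]: "ntr S F Z j\<^sub>1 \<in> Arr (FunCat S B)" "ntr S G Z j\<^sub>2 \<in> Arr (FunCat S B)"
    "ntr S Z F q\<^sub>1 \<in> Arr (FunCat S B)" "ntr S Z G q\<^sub>2 \<in> Arr (FunCat S B)"
    by (intro ntr_Arr; simp add: a_def qj qj')+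
  have "is_biproduct (FunCat S B) F G (ntr S F Z j\<^sub>1) (ntr S G Z j\<^sub>2) (ntr S Z F q\<^sub>1) (ntr S Z G q\<^sub>2)"
    unfolding is_biproduct_def by (auto intro!: bexI[of _ Z] ntr_cong simp: qj jq)
  then show ?thesis
    by blast
qed

text \<open>For the constant diagram at a zero object the identity is a zero arrow, and composing
  with this identity shows that every arrow into or out of the diagram is zero.\<close>

lemma ex_objectwise_zero: "\<exists>Z. is_zero_obj (FunCat S B) Z"
proof -
  obtain z where z: "is_zero_obj B z"
    using B.has_zero_obj by blast
  then have [simp]: "z \<in> Obj B"
    by (simp add: is_zero_obj_def)
  define Z where "Z = \<lparr>omap = restrict (\<lambda>s. z) (Obj S), amap = restrict (\<lambda>f. Ident B z) (Arr S)\<rparr>"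
  have Z [simp]: "Z \<in> Obj (FunCat S B)"
    unfolding Z_def by (rule Obj_FunCatI) (simp_all add: S.category_axioms)
  have "HZero B z z = Ident B z"
    using z unfolding is_zero_obj_def by (metis B.HZero_simps B.Ident_simps in_Hom)
  then have zero: "Ident (FunCat S B) Z = HZero (FunCat S B) Z Z"
    by (auto intro!: ntr_cong simp: Z_def)
  show ?thesis
    unfolding is_zero_obj_def
  proof (intro exI[of _ Z] conjI ballI)
    fix F
    assume F [simp]: "F \<in> Obj (FunCat S B)"
    have "\<tau> = HZero (FunCat S B) Z F" if \<tau>: "\<tau> \<in> Hom (FunCat S B) Z F" for \<tau>
      using Fn.Comp_Ident(1)[of \<tau> Z] Fn.Comp_HZero(1)[of \<tau> Z F Z] \<tau> unfolding zero by auto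
    then show "\<exists>!\<tau>. \<tau> \<in> Hom (FunCat S B) Z F"
      using Fn.HZero_simps[OF Z F] by (intro ex1I[of _ "HZero (FunCat S B) Z F"]) (auto simp del: FunCat_simps(6))
    have "\<tau> = HZero (FunCat S B) F Z" if \<tau>: "\<tau> \<in> Hom (FunCat S B) F Z" for \<tau>
      using Fn.Comp_Ident(2)[of \<tau> Z] Fn.Comp_HZero(2)[of \<tau> F Z Z] \<tau> unfolding zero by auto
    then show "\<exists>!\<tau>. \<tau> \<in> Hom (FunCat S B) F Z"
      using Fn.HZero_simps[OF F Z] by (intro ex1I[of _ "HZero (FunCat S B) F Z"]) (auto simp del: FunCat_simps(6))
  qed simp
qed

sublocale Fn: abelian_category "FunCat S B"
proof (unfold_locales, goal_cases)
  case 1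
  show ?case
    by (rule ex_objectwise_zero)
next
  case (2 F G)
  then show ?case
    by (rule ex_objectwise_biproduct)
next
  case (3 \<tau>)
  show ?case
    using ex_objectwise_kernel[OF 3] is_kernel_objectwise[OF 3] by metis
next
  case (4 \<tau>)
  show ?case
    using ex_objectwise_cokernel[OF 4] is_cokernel_objectwise[OF 4] by metis
next
  case (5 \<tau>)
  note \<tau> = Fn.mono_Arr[OF 5]
  obtain \<gamma> where \<gamma>: "\<gamma> \<in> Arr (FunCat S B)" "nsrc \<gamma> = ntgt \<tau>"
    "\<And>s. s \<in> Obj S \<Longrightarrow> is_cokernel B (ncomp \<tau> s) (ncomp \<gamma> s)"
    using ex_objectwise_cokernel[OF \<tau>] by blast
  \<comment> \<open>At each object the mono \<open>\<tau>\<close> is the kernel of its cokernel, and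
    objectwise kernels are kernels.\<close>
  then have "is_kernel (FunCat S B) \<gamma> \<tau>"
    using \<tau> B.mono_kernel_of_cokernel[OF mono_objectwise[OF 5]] by (intro is_kernel_objectwise) auto
  then show ?case
    by blast
next
  case (6 \<tau>)
  note \<tau> = Fn.epi_Arr[OF 6]
  obtain \<kappa> where \<kappa>: "\<kappa> \<in> Arr (FunCat S B)" "ntgt \<kappa> = nsrc \<tau>"
    "\<And>s. s \<in> Obj S \<Longrightarrow> is_kernel B (ncomp \<tau> s) (ncomp \<kappa> s)"
    using ex_objectwise_kernel[OF \<tau>] by blast
  then have "is_cokernel (FunCat S B) \<kappa> \<tau>"
    using \<tau> B.epi_cokernel_of_kernel[OF epi_objectwise[OF 6]] by (intro is_cokernel_objectwise) auto
  then show ?case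
    by blast
qed

lemma short_exact_objectwise:
  assumes "\<iota> \<in> Arr (FunCat S B)" "\<pi> \<in> Arr (FunCat S B)" "ntgt \<iota> = nsrc \<pi>"
    and "\<And>s. s \<in> Obj S \<Longrightarrow> short_exact B (ncomp \<iota> s, ncomp \<pi> s)"
  shows "short_exact (FunCat S B) (\<iota>, \<pi>)"
  using assms is_kernel_objectwise[of \<pi> \<iota>] is_cokernel_objectwise[of \<iota> \<pi>]
  by (simp add: short_exact_def)

end

section \<open>Constant diagrams and limits\<close>

lemma Const_simps:
  "omap (Const S B) X = \<lparr>omap = restrict (\<lambda>s. X) (Obj S), amap = restrict (\<lambda>f. Ident B X) (Arr S)\<rparr>"
  "amap (Const S B) f = ntr S (omap (Const S B) (Src B f)) (omap (Const S B) (Tgt B f)) (\<lambda>s. f)"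
  by (simp_all add: Const_def Let_def ntr_def)

lemma Const_apply [simp]:
  "s \<in> Obj S \<Longrightarrow> omap (omap (Const S B) X) s = X"
  "f \<in> Arr S \<Longrightarrow> amap (omap (Const S B) X) f = Ident B X"
  "s \<in> Obj S \<Longrightarrow> ncomp (amap (Const S B) g) s = g"
  by (simp_all add: Const_simps)

context functor_category
begin

abbreviation "Fun \<equiv> FunCat S B"
abbreviation "\<K> \<equiv> omap (Const S B)"
abbreviation "\<k> \<equiv> amap (Const S B)"

lemma Const_Obj [simp]: "X \<in> Obj B \<Longrightarrow> \<K> X \<in> Obj Fun"
  unfolding Const_simps by (rule Obj_FunCatI) (simp_all add: S.category_axioms)

lemma Const_Arr [simp]:
  assumes "f \<in> Arr B"
  shows "\<k> f \<in> Arr Fun" "Src Fun (\<k> f) = \<K> (Src B f)" "Tgt Fun (\<k> f) = \<K> (Tgt B f)"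
proof -
  show "\<k> f \<in> Arr Fun"
    unfolding Const_simps(2) using assms by (intro ntr_Arr) simp_all
qed (simp_all add: Const_simps(2))

lemma Const_functorial:
  shows "X \<in> Obj B \<Longrightarrow> \<k> (Ident B X) = Ident Fun (\<K> X)"
    and "f \<in> Arr B \<Longrightarrow> g \<in> Arr B \<Longrightarrow> Tgt B f = Src B g \<Longrightarrow> \<k> (g \<cdot>\<^bsub>B\<^esub> f) = \<k> g \<cdot>\<^bsub>Fun\<^esub> \<k> f"
    and "f \<in> Arr B \<Longrightarrow> g \<in> Arr B \<Longrightarrow> Src B f = Src B g \<Longrightarrow> Tgt B f = Tgt B g \<Longrightarrow>
      \<k> (f \<oplus>\<^bsub>B\<^esub> g) = \<k> f \<oplus>\<^bsub>Fun\<^esub> \<k> g"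
    and "X \<in> Obj B \<Longrightarrow> Y \<in> Obj B \<Longrightarrow> \<k> (HZero B X Y) = HZero Fun (\<K> X) (\<K> Y)"
  by (auto simp: Const_simps(2) intro!: ntr_cong)

end

text \<open>From here on arrows of \<open>FunCat S B\<close> are handled through its abelian
  structure; unfolding them into components would keep the locale rules from matching.\<close>

declare FunCat_simps [simp del]

section \<open>Exactness and additivity of constant diagrams\<close>

context functor_category
begin

lemma Const_short_exact:
  assumes "short_exact B (i, p)"
  shows "short_exact Fun (\<k> i, \<k> p)"
proof (rule short_exact_objectwise)
  note [simp] = B.short_exactD(1-3)[OF assms]
  show "\<k> i \<in> Arr Fun" "\<k> p \<in> Arr Fun"
    by simp_all
  show "ntgt (\<k> i) = nsrc (\<k> p)"
    using Const_Arr(2)[of p] Const_Arr(3)[of i] by (simp add: FunCat_simps)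
qed (use assms in simp)

definition Const_ses :: "'a \<times> 'a \<Rightarrow> ('s, 't, 'o, 'a) ntrans \<times> ('s, 't, 'o, 'a) ntrans" where
  "Const_ses \<epsilon> = map_prod \<k> \<k> \<epsilon>"

lemma Const_ses_simps [simp]:
  "fst (Const_ses \<epsilon>) = \<k> (fst \<epsilon>)" "snd (Const_ses \<epsilon>) = \<k> (snd \<epsilon>)"
  by (simp_all add: Const_ses_def)

lemma Const_ses_short_exact [simp]: "short_exact B \<epsilon> \<Longrightarrow> short_exact Fun (Const_ses \<epsilon>)"
  using Const_short_exact[of "fst \<epsilon>" "snd \<epsilon>"] by (simp add: Const_ses_def map_prod_def case_prod_beta)

lemma Const_emor:
  assumes "emor B h g \<epsilon> \<epsilon>'"
  shows "emor Fun (\<k> h) (\<k> g) (Const_ses \<epsilon>) (Const_ses \<epsilon>')"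
proof -
  obtain i p i' p' where \<epsilon>: "\<epsilon> = (i, p)" "\<epsilon>' = (i', p')"
    by (metis surj_pair)
  obtain e y a x y' a' x' where [simp]: "i \<in> Arr B" "Src B i = y" "Tgt B i = a" "p \<in> Arr B" "Src B p = a" "Tgt B p = x"
    "i' \<in> Arr B" "Src B i' = y'" "Tgt B i' = a'" "p' \<in> Arr B" "Src B p' = a'" "Tgt B p' = x'"
    "h \<in> Arr B" "Src B h = y" "Tgt B h = y'" "g \<in> Arr B" "Src B g = x" "Tgt B g = x'"
    "e \<in> Arr B" "Src B e = a" "Tgt B e = a'"
    and e: "e \<cdot>\<^bsub>B\<^esub> i = i' \<cdot>\<^bsub>B\<^esub> h" "p' \<cdot>\<^bsub>B\<^esub> e = g \<cdot>\<^bsub>B\<^esub> p"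
    and ses: "short_exact B (i, p)" "short_exact B (i', p')"
    using assms unfolding \<epsilon> by (rule B.emorE)
  have "\<k> e \<cdot>\<^bsub>Fun\<^esub> \<k> i = \<k> i' \<cdot>\<^bsub>Fun\<^esub> \<k> h" "\<k> p' \<cdot>\<^bsub>Fun\<^esub> \<k> e = \<k> g \<cdot>\<^bsub>Fun\<^esub> \<k> p"
    by (simp_all add: e flip: Const_functorial)
  then show ?thesis
    using Const_short_exact[OF ses(1)] Const_short_exact[OF ses(2)]
    unfolding emor_def \<epsilon> Const_ses_def map_prod_def prod.case
    by (intro conjI bexI[of _ "\<k> e"]) simp_all
qed

lemma Const_biproduct:
  assumes "is_biproduct B x y j\<^sub>1 j\<^sub>2 q\<^sub>1 q\<^sub>2"
  shows "is_biproduct Fun (\<K> x) (\<K> y) (\<k> j\<^sub>1) (\<k> j\<^sub>2) (\<k> q\<^sub>1) (\<k> q\<^sub>2)"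
proof -
  obtain z where [simp]: "x \<in> Obj B" "y \<in> Obj B" "z \<in> Obj B"
    "j\<^sub>1 \<in> Arr B" "Src B j\<^sub>1 = x" "Tgt B j\<^sub>1 = z" "j\<^sub>2 \<in> Arr B" "Src B j\<^sub>2 = y" "Tgt B j\<^sub>2 = z"
    "q\<^sub>1 \<in> Arr B" "Src B q\<^sub>1 = z" "Tgt B q\<^sub>1 = x" "q\<^sub>2 \<in> Arr B" "Src B q\<^sub>2 = z" "Tgt B q\<^sub>2 = y"
    and eq: "q\<^sub>1 \<cdot>\<^bsub>B\<^esub> j\<^sub>1 = Ident B x" "q\<^sub>2 \<cdot>\<^bsub>B\<^esub> j\<^sub>2 = Ident B y" "q\<^sub>2 \<cdot>\<^bsub>B\<^esub> j\<^sub>1 = HZero B x y"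
      "q\<^sub>1 \<cdot>\<^bsub>B\<^esub> j\<^sub>2 = HZero B y x" "j\<^sub>1 \<cdot>\<^bsub>B\<^esub> q\<^sub>1 \<oplus>\<^bsub>B\<^esub> j\<^sub>2 \<cdot>\<^bsub>B\<^esub> q\<^sub>2 = Ident B z"
    using assms by (rule B.biproductE)
  note fc = Const_functorial
  have "\<k> q\<^sub>1 \<cdot>\<^bsub>Fun\<^esub> \<k> j\<^sub>1 = Ident Fun (\<K> x)" "\<k> q\<^sub>2 \<cdot>\<^bsub>Fun\<^esub> \<k> j\<^sub>2 = Ident Fun (\<K> y)"
    "\<k> q\<^sub>2 \<cdot>\<^bsub>Fun\<^esub> \<k> j\<^sub>1 = HZero Fun (\<K> x) (\<K> y)" "\<k> q\<^sub>1 \<cdot>\<^bsub>Fun\<^esub> \<k> j\<^sub>2 = HZero Fun (\<K> y) (\<K> x)"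
    "\<k> j\<^sub>1 \<cdot>\<^bsub>Fun\<^esub> \<k> q\<^sub>1 \<oplus>\<^bsub>Fun\<^esub> \<k> j\<^sub>2 \<cdot>\<^bsub>Fun\<^esub> \<k> q\<^sub>2 = Ident Fun (\<K> z)"
    using eq[THEN arg_cong, of \<k>] by (simp_all add: fc)
  then show ?thesis
    unfolding is_biproduct_def by (intro conjI bexI[of _ "\<K> z"]) simp_all
qed

lemma Const_dsum_arr:
  assumes "is_biproduct B x\<^sub>1 x\<^sub>2 j\<^sub>1 j\<^sub>2 q\<^sub>1 q\<^sub>2" "is_biproduct B y\<^sub>1 y\<^sub>2 k\<^sub>1 k\<^sub>2 r\<^sub>1 r\<^sub>2"
    and "f\<^sub>1 \<in> Hom B x\<^sub>1 y\<^sub>1" "f\<^sub>2 \<in> Hom B x\<^sub>2 y\<^sub>2"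
  shows "\<k> (dsum_arr B k\<^sub>1 k\<^sub>2 q\<^sub>1 q\<^sub>2 f\<^sub>1 f\<^sub>2) = dsum_arr Fun (\<k> k\<^sub>1) (\<k> k\<^sub>2) (\<k> q\<^sub>1) (\<k> q\<^sub>2) (\<k> f\<^sub>1) (\<k> f\<^sub>2)"
proof -
  obtain x where [simp]: "q\<^sub>1 \<in> Arr B" "Src B q\<^sub>1 = x" "Tgt B q\<^sub>1 = x\<^sub>1" "q\<^sub>2 \<in> Arr B" "Src B q\<^sub>2 = x" "Tgt B q\<^sub>2 = x\<^sub>2"
    using assms(1) by (rule B.biproductE)
  obtain y where [simp]: "k\<^sub>1 \<in> Arr B" "Src B k\<^sub>1 = y\<^sub>1" "Tgt B k\<^sub>1 = y" "k\<^sub>2 \<in> Arr B" "Src B k\<^sub>2 = y\<^sub>2" "Tgt B k\<^sub>2 = y"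
    using assms(2) by (rule B.biproductE)
  show ?thesis
    using assms(3,4) by (simp add: dsum_arr_def Const_functorial)
qed

text \<open>\<open>Const\<close> is additive and respects morphisms of short exact sequences. It
  preserves the pullback and the pushout in a Baer sum because these are morphisms of sequences with
  an identity end; biproducts and diagonal arrows are preserved by additivity.\<close>

lemma Const_baer_sum:
  assumes "baer_sum B \<epsilon>\<^sub>1 \<epsilon>\<^sub>2 \<epsilon>" "short_exact B \<epsilon>\<^sub>1" "short_exact B \<epsilon>\<^sub>2" "Src B (fst \<epsilon>\<^sub>1) = Src B (fst \<epsilon>\<^sub>2)"
    "Tgt B (snd \<epsilon>\<^sub>1) = Tgt B (snd \<epsilon>\<^sub>2)"
  shows "baer_sum Fun (Const_ses \<epsilon>\<^sub>1) (Const_ses \<epsilon>\<^sub>2) (Const_ses \<epsilon>)"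
proof -
  obtain i\<^sub>1 p\<^sub>1 i\<^sub>2 p\<^sub>2 where \<epsilon>: "\<epsilon>\<^sub>1 = (i\<^sub>1, p\<^sub>1)" "\<epsilon>\<^sub>2 = (i\<^sub>2, p\<^sub>2)"
    by (metis surj_pair)
  note s = assms(2,3)[unfolded \<epsilon>]
  note [simp] = B.short_exactD(1-3)[OF s(1)] B.short_exactD(1-3)[OF s(2)]
  define x where "x = Tgt B p\<^sub>2"
  define y where "y = Src B i\<^sub>2"
  have xy [simp]: "Tgt B p\<^sub>1 = x" "Tgt B p\<^sub>2 = x" "Src B i\<^sub>1 = y" "Src B i\<^sub>2 = y"
    using assms(4,5) by (simp_all add: \<epsilon> x_def y_def)
  obtain j\<^sub>1 j\<^sub>2 q\<^sub>1 q\<^sub>2 k\<^sub>1 k\<^sub>2 r\<^sub>1 r\<^sub>2 l\<^sub>1 l\<^sub>2 s\<^sub>1 s\<^sub>2 \<delta> where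
    Y: "is_biproduct B y y j\<^sub>1 j\<^sub>2 q\<^sub>1 q\<^sub>2" and A: "is_biproduct B (Tgt B i\<^sub>1) (Tgt B i\<^sub>2) k\<^sub>1 k\<^sub>2 r\<^sub>1 r\<^sub>2"
    and X: "is_biproduct B x x l\<^sub>1 l\<^sub>2 s\<^sub>1 s\<^sub>2"
    and \<delta>: "pullback_ext B (l\<^sub>1 \<oplus>\<^bsub>B\<^esub> l\<^sub>2) (dsum_arr B k\<^sub>1 k\<^sub>2 q\<^sub>1 q\<^sub>2 i\<^sub>1 i\<^sub>2, dsum_arr B l\<^sub>1 l\<^sub>2 r\<^sub>1 r\<^sub>2 p\<^sub>1 p\<^sub>2) \<delta>"
    and \<delta>\<epsilon>: "pushout_ext B (q\<^sub>1 \<oplus>\<^bsub>B\<^esub> q\<^sub>2) \<delta> \<epsilon>"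
    using assms(1) unfolding \<epsilon> B.baer_sum_iff xy by blast
  let ?D = "(dsum_arr B k\<^sub>1 k\<^sub>2 q\<^sub>1 q\<^sub>2 i\<^sub>1 i\<^sub>2, dsum_arr B l\<^sub>1 l\<^sub>2 r\<^sub>1 r\<^sub>2 p\<^sub>1 p\<^sub>2)"
  obtain yo where [simp]: "q\<^sub>1 \<in> Arr B" "Src B q\<^sub>1 = yo" "Tgt B q\<^sub>1 = y" "q\<^sub>2 \<in> Arr B" "Src B q\<^sub>2 = yo" "Tgt B q\<^sub>2 = y"
    using Y by (rule B.biproductE)
  obtain xo where [simp]: "l\<^sub>1 \<in> Arr B" "Src B l\<^sub>1 = x" "Tgt B l\<^sub>1 = xo" "l\<^sub>2 \<in> Arr B" "Src B l\<^sub>2 = x" "Tgt B l\<^sub>2 = xo"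
    using X by (rule B.biproductE)
  note \<delta>' = \<delta>[unfolded B.pullback_ext_iff] and \<delta>\<epsilon>' = \<delta>\<epsilon>[unfolded B.pushout_ext_iff]
  have d1: "Src B (fst ?D) = yo" "fst ?D \<in> Arr B"
    using B.dsum_arr_simps(1,2)[OF Y A, of i\<^sub>1 i\<^sub>2] by simp_all
  have d2: "Src B (l\<^sub>1 \<oplus>\<^bsub>B\<^esub> l\<^sub>2) = Tgt B (snd \<delta>)" "snd \<delta> \<in> Arr B"
    using B.emor_shape(1,7)[OF \<delta>'] by simp_all
  have KD: "Const_ses ?D = (dsum_arr Fun (\<k> k\<^sub>1) (\<k> k\<^sub>2) (\<k> q\<^sub>1) (\<k> q\<^sub>2) (\<k> i\<^sub>1) (\<k> i\<^sub>2),
    dsum_arr Fun (\<k> l\<^sub>1) (\<k> l\<^sub>2) (\<k> r\<^sub>1) (\<k> r\<^sub>2) (\<k> p\<^sub>1) (\<k> p\<^sub>2))"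
    by (simp add: Const_ses_def Const_dsum_arr[OF Y A] Const_dsum_arr[OF A X])
  have "\<k> (Ident B yo) = Ident Fun (Src Fun (fst (Const_ses ?D)))"
    using d1 B.Src_Obj[of q\<^sub>1 yo] by (simp add: Const_functorial)
  then have "pullback_ext Fun (\<k> l\<^sub>1 \<oplus>\<^bsub>Fun\<^esub> \<k> l\<^sub>2) (Const_ses ?D) (Const_ses \<delta>)"
    using Const_emor[OF \<delta>'] d1 unfolding Fn.pullback_ext_iff by (simp add: Const_functorial)
  moreover have "\<k> (Ident B (Tgt B (snd \<delta>))) = Ident Fun (Tgt Fun (snd (Const_ses \<delta>)))"
    using d2 by (simp add: Const_functorial)
  then have "pushout_ext Fun (\<k> q\<^sub>1 \<oplus>\<^bsub>Fun\<^esub> \<k> q\<^sub>2) (Const_ses \<delta>) (Const_ses \<epsilon>)"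
    using Const_emor[OF \<delta>\<epsilon>'] unfolding Fn.pushout_ext_iff by (simp add: Const_functorial)
  moreover have "is_biproduct Fun (Src Fun (\<k> i\<^sub>1)) (Src Fun (\<k> i\<^sub>2)) (\<k> j\<^sub>1) (\<k> j\<^sub>2) (\<k> q\<^sub>1) (\<k> q\<^sub>2)"
    "is_biproduct Fun (Tgt Fun (\<k> i\<^sub>1)) (Tgt Fun (\<k> i\<^sub>2)) (\<k> k\<^sub>1) (\<k> k\<^sub>2) (\<k> r\<^sub>1) (\<k> r\<^sub>2)"
    "is_biproduct Fun (Tgt Fun (\<k> p\<^sub>1)) (Tgt Fun (\<k> p\<^sub>2)) (\<k> l\<^sub>1) (\<k> l\<^sub>2) (\<k> s\<^sub>1) (\<k> s\<^sub>2)"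
    using Const_biproduct[OF Y] Const_biproduct[OF A] Const_biproduct[OF X] by simp_all
  ultimately show ?thesis
    unfolding \<epsilon> KD unfolding Const_ses_def map_prod_simp Fn.baer_sum_iff
    by (intro exI conjI) assumption+
qed

end

section \<open>The limit functor and its left exactness\<close>

locale complete_functor_category = functor_category +
  assumes complete: "complete_for S B"
begin

abbreviation "\<L> \<equiv> omap (Lim S B)"
abbreviation "\<l> \<equiv> amap (Lim S B)"
abbreviation "\<rho> \<equiv> lim_proj S B"

lemma is_limit_Lim:
  assumes "F \<in> Obj Fun"
  shows "is_limit S B F (\<L> F) (\<rho> F)"
proof -
  obtain L r where "is_limit S B F L r"
    using complete assms unfolding complete_for_def by blast
  \<comment> \<open>The paired form matches the pattern under \<open>SOME\<close> in
    \<open>lim_cone\<close>.\<close>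
  then have "case (L, r) of (L, r) \<Rightarrow> is_limit S B F L r"
    by simp
  then have "case lim_cone S B F of (L, r) \<Rightarrow> is_limit S B F L r"
    unfolding lim_cone_def by (rule someI)
  then show ?thesis
    by (simp add: Lim_def lim_proj_def case_prod_beta Let_def)
qed

lemma lim_simps [simp]:
  assumes "F \<in> Obj Fun"
  shows "\<L> F \<in> Obj B" "\<rho> F \<in> Arr Fun" "Src Fun (\<rho> F) = \<K> (\<L> F)" "Tgt Fun (\<rho> F) = F"
  using is_limit_Lim[OF assms] by (simp_all add: is_limit_def)

lemma lim_ex1:
  assumes "F \<in> Obj Fun" "X \<in> Obj B" "\<sigma> \<in> Arr Fun" "Src Fun \<sigma> = \<K> X" "Tgt Fun \<sigma> = F"
  shows "\<exists>!u. u \<in> Hom B X (\<L> F) \<and> \<rho> F \<cdot>\<^bsub>Fun\<^esub> \<k> u = \<sigma>"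
proof -
  have "\<sigma> \<in> Hom Fun (\<K> X) F"
    using assms by simp
  then show ?thesis
    using is_limit_Lim[OF assms(1)] assms(2) unfolding is_limit_def by blast
qed

lemma lim_lift:
  assumes "F \<in> Obj Fun" "X \<in> Obj B" "\<sigma> \<in> Arr Fun" "Src Fun \<sigma> = \<K> X" "Tgt Fun \<sigma> = F"
  obtains u where "u \<in> Arr B" "Src B u = X" "Tgt B u = \<L> F" "\<rho> F \<cdot>\<^bsub>Fun\<^esub> \<k> u = \<sigma>"
  using lim_ex1[OF assms] unfolding in_Hom by blast

lemma lim_unique:
  assumes "F \<in> Obj Fun" "u \<in> Arr B" "v \<in> Arr B" "Src B u = Src B v" "Tgt B u = \<L> F" "Tgt B v = \<L> F"
    "\<rho> F \<cdot>\<^bsub>Fun\<^esub> \<k> u = \<rho> F \<cdot>\<^bsub>Fun\<^esub> \<k> v"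
  shows "u = v"
proof -
  have "\<exists>!w. w \<in> Hom B (Src B v) (\<L> F) \<and> \<rho> F \<cdot>\<^bsub>Fun\<^esub> \<k> w = \<rho> F \<cdot>\<^bsub>Fun\<^esub> \<k> v"
    using assms(1-6) by (intro lim_ex1) simp_all
  then show ?thesis
    using assms(2-7) unfolding in_Hom by blast
qed

lemma Lim_Arr:
  assumes [simp]: "\<tau> \<in> Arr Fun"
  shows "\<l> \<tau> \<in> Arr B" "Src B (\<l> \<tau>) = \<L> (Src Fun \<tau>)" "Tgt B (\<l> \<tau>) = \<L> (Tgt Fun \<tau>)"
    "\<rho> (Tgt Fun \<tau>) \<cdot>\<^bsub>Fun\<^esub> \<k> (\<l> \<tau>) = \<tau> \<cdot>\<^bsub>Fun\<^esub> \<rho> (Src Fun \<tau>)"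
proof -
  let ?P = "\<lambda>u. u \<in> Hom B (\<L> (Src Fun \<tau>)) (\<L> (Tgt Fun \<tau>)) \<and>
    \<rho> (Tgt Fun \<tau>) \<cdot>\<^bsub>Fun\<^esub> \<k> u = \<tau> \<cdot>\<^bsub>Fun\<^esub> \<rho> (Src Fun \<tau>)"
  have "\<l> \<tau> = (THE u. ?P u)"
    by (simp add: Lim_def Let_def FunCat_simps(1,2))
  moreover have "\<exists>!u. ?P u"
    by (rule lim_ex1) simp_all
  ultimately have "?P (\<l> \<tau>)"
    using theI'[of ?P] by simp
  then show "\<l> \<tau> \<in> Arr B" "Src B (\<l> \<tau>) = \<L> (Src Fun \<tau>)" "Tgt B (\<l> \<tau>) = \<L> (Tgt Fun \<tau>)"
    "\<rho> (Tgt Fun \<tau>) \<cdot>\<^bsub>Fun\<^esub> \<k> (\<l> \<tau>) = \<tau> \<cdot>\<^bsub>Fun\<^esub> \<rho> (Src Fun \<tau>)"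
    unfolding in_Hom by blast+
qed

declare Lim_Arr(1-3) [simp]

lemma Lim_eqI:
  assumes "\<tau> \<in> Arr Fun" "u \<in> Arr B" "Src B u = \<L> (Src Fun \<tau>)" "Tgt B u = \<L> (Tgt Fun \<tau>)"
    "\<rho> (Tgt Fun \<tau>) \<cdot>\<^bsub>Fun\<^esub> \<k> u = \<tau> \<cdot>\<^bsub>Fun\<^esub> \<rho> (Src Fun \<tau>)"
  shows "\<l> \<tau> = u"
  by (rule lim_unique[of "Tgt Fun \<tau>"]) (use assms Lim_Arr[OF assms(1)] in simp_all)

lemma Lim_comp:
  assumes \<sigma> [simp]: "\<sigma> \<in> Arr Fun" and \<tau> [simp]: "\<tau> \<in> Arr Fun" and st [simp]: "Tgt Fun \<sigma> = Src Fun \<tau>"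
  shows "\<l> (\<tau> \<cdot>\<^bsub>Fun\<^esub> \<sigma>) = \<l> \<tau> \<cdot>\<^bsub>B\<^esub> \<l> \<sigma>"
  using Lim_Arr(4)[OF \<sigma>]
  by (intro Lim_eqI) (simp_all add: Const_functorial Fn.Comp_reassoc[OF Lim_Arr(4)[OF \<tau>]])

lemma Lim_functor: "is_functor Fun B (Lim S B)"
  unfolding is_functor_def
proof (intro conjI ballI impI)
  fix F
  assume "F \<in> Obj Fun"
  then show "\<l> (Ident Fun F) = Ident B (\<L> F)"
    by (intro Lim_eqI) (simp_all add: Const_functorial)
qed (simp_all add: Lim_comp)

lemma Lim_additive:
  assumes \<sigma> [simp]: "\<sigma> \<in> Arr Fun" and \<tau> [simp]: "\<tau> \<in> Arr Fun"
    and st [simp]: "Src Fun \<sigma> = Src Fun \<tau>" "Tgt Fun \<sigma> = Tgt Fun \<tau>"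
  shows "\<l> (\<sigma> \<oplus>\<^bsub>Fun\<^esub> \<tau>) = \<l> \<sigma> \<oplus>\<^bsub>B\<^esub> \<l> \<tau>"
  using Lim_Arr(4)[OF \<sigma>] Lim_Arr(4)[OF \<tau>]
  by (intro Lim_eqI) (simp_all add: Const_functorial)

text \<open>Right adjoints preserve kernels. Concretely, if \<open>\<l> \<pi>\<close> kills
  \<open>h\<close>, then \<open>\<pi>\<close> kills the transpose
  \<open>\<rho> G \<cdot> \<k> h\<close>, which factors through \<open>\<iota>\<close>; the factor
  has a constant source and transposes back to the required arrow.\<close>

lemma Lim_kernel:
  assumes ker: "is_kernel Fun \<pi> \<iota>"
  shows "is_kernel B (\<l> \<pi>) (\<l> \<iota>)"
proof -
  define F where "F = Src Fun \<iota>"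
  define G where "G = Src Fun \<pi>"
  define H where "H = Tgt Fun \<pi>"
  have \<iota> [simp]: "\<pi> \<in> Arr Fun" "\<iota> \<in> Arr Fun" "Tgt Fun \<iota> = G" "Src Fun \<iota> = F" "Src Fun \<pi> = G" "Tgt Fun \<pi> = H"
    and \<pi>\<iota>: "\<pi> \<cdot>\<^bsub>Fun\<^esub> \<iota> = HZero Fun F H"
    using Fn.kernelD[OF ker] by (simp_all add: F_def G_def H_def)
  have [simp]: "F \<in> Obj Fun" "G \<in> Obj Fun" "H \<in> Obj Fun"
    using \<iota> Fn.Src_Obj Fn.Tgt_Obj by blast+
  have L\<iota>: "\<rho> G \<cdot>\<^bsub>Fun\<^esub> \<k> (\<l> \<iota>) = \<iota> \<cdot>\<^bsub>Fun\<^esub> \<rho> F" and L\<pi>: "\<rho> H \<cdot>\<^bsub>Fun\<^esub> \<k> (\<l> \<pi>) = \<pi> \<cdot>\<^bsub>Fun\<^esub> \<rho> G"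
    using Lim_Arr(4)[of \<iota>] Lim_Arr(4)[of \<pi>] by simp_all
  show ?thesis
  proof (rule B.is_kernelI)
    show "\<l> \<pi> \<cdot>\<^bsub>B\<^esub> \<l> \<iota> = HZero B (Src B (\<l> \<iota>)) (Tgt B (\<l> \<pi>))"
      by (rule lim_unique[of H])
        (simp_all add: Const_functorial Fn.Comp_reassoc[OF L\<pi>] L\<iota> Fn.Comp_reassoc[OF \<pi>\<iota>])
    show "is_mono B (\<l> \<iota>)"
      unfolding is_mono_def
    proof (intro conjI ballI impI)
      fix W g h
      assume gh: "g \<in> Hom B W (Src B (\<l> \<iota>))" "h \<in> Hom B W (Src B (\<l> \<iota>))" and eq: "\<l> \<iota> \<cdot>\<^bsub>B\<^esub> g = \<l> \<iota> \<cdot>\<^bsub>B\<^esub> h"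
      then have [simp]: "g \<in> Arr B" "Src B g = W" "Tgt B g = \<L> F" "h \<in> Arr B" "Src B h = W" "Tgt B h = \<L> F"
        by simp_all
      have "\<iota> \<cdot>\<^bsub>Fun\<^esub> (\<rho> F \<cdot>\<^bsub>Fun\<^esub> \<k> g) = \<rho> G \<cdot>\<^bsub>Fun\<^esub> \<k> (\<l> \<iota> \<cdot>\<^bsub>B\<^esub> g)"
        by (simp add: Const_functorial Fn.Comp_reassoc[OF L\<iota>])
      also have "\<dots> = \<iota> \<cdot>\<^bsub>Fun\<^esub> (\<rho> F \<cdot>\<^bsub>Fun\<^esub> \<k> h)"
        unfolding eq by (simp add: Const_functorial Fn.Comp_reassoc[OF L\<iota>])
      finally have "\<rho> F \<cdot>\<^bsub>Fun\<^esub> \<k> g = \<rho> F \<cdot>\<^bsub>Fun\<^esub> \<k> h"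
        by (rule Fn.mono_cancel[OF Fn.kernel_mono[OF ker]]) simp_all
      then show "g = h"
        by (intro lim_unique[of F g h]) simp_all
    qed simp
    fix h
    assume h0: "h \<in> Arr B" "Tgt B h = Src B (\<l> \<pi>)" and eq: "\<l> \<pi> \<cdot>\<^bsub>B\<^esub> h = HZero B (Src B h) (Tgt B (\<l> \<pi>))"
    define W where "W = Src B h"
    have h [simp]: "h \<in> Arr B" "Tgt B h = \<L> G" "Src B h = W"
      using h0 by (simp_all add: W_def)
    have [simp]: "W \<in> Obj B"
      using h B.Src_Obj by blast
    have "\<pi> \<cdot>\<^bsub>Fun\<^esub> (\<rho> G \<cdot>\<^bsub>Fun\<^esub> \<k> h) = \<rho> H \<cdot>\<^bsub>Fun\<^esub> \<k> (\<l> \<pi> \<cdot>\<^bsub>B\<^esub> h)"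
      by (simp add: Const_functorial Fn.Comp_reassoc[OF L\<pi>])
    also have "\<dots> = HZero Fun (\<K> W) H"
      unfolding eq by (simp add: Const_functorial)
    finally have *: "\<pi> \<cdot>\<^bsub>Fun\<^esub> (\<rho> G \<cdot>\<^bsub>Fun\<^esub> \<k> h) = HZero Fun (\<K> W) H" .
    obtain \<sigma> where \<sigma>: "\<sigma> \<in> Arr Fun" "Src Fun \<sigma> = Src Fun (\<rho> G \<cdot>\<^bsub>Fun\<^esub> \<k> h)" "Tgt Fun \<sigma> = Src Fun \<iota>"
      "\<iota> \<cdot>\<^bsub>Fun\<^esub> \<sigma> = \<rho> G \<cdot>\<^bsub>Fun\<^esub> \<k> h"
      by (rule Fn.kernel_factor[OF ker, of "\<rho> G \<cdot>\<^bsub>Fun\<^esub> \<k> h"]) (use * in simp_all)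
    obtain u where u [simp]: "u \<in> Arr B" "Src B u = W" "Tgt B u = \<L> F" and \<rho>u: "\<rho> F \<cdot>\<^bsub>Fun\<^esub> \<k> u = \<sigma>"
      by (rule lim_lift[of F W \<sigma>]) (use \<sigma> in simp_all)
    have "\<l> \<iota> \<cdot>\<^bsub>B\<^esub> u = h"
      by (rule lim_unique[of G]) (simp_all add: Const_functorial Fn.Comp_reassoc[OF L\<iota>] \<rho>u \<sigma>(4))
    then show "\<exists>u\<in>Arr B. Src B u = Src B h \<and> Tgt B u = Src B (\<l> \<iota>) \<and> \<l> \<iota> \<cdot>\<^bsub>B\<^esub> u = h"
      by (intro bexI[of _ u]) simp_all
  qed simp_all
qed

text \<open>Additivity and preservation of kernels are already established, so what is left of
  exactness is that the last arrow stays epi.\<close>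

lemma exact_Lim_iff:
  "exact_functor Fun B (Lim S B) \<longleftrightarrow> (\<forall>\<iota> \<pi>. short_exact Fun (\<iota>, \<pi>) \<longrightarrow> is_epi B (\<l> \<pi>))"
proof
  assume "exact_functor Fun B (Lim S B)"
  then show "\<forall>\<iota> \<pi>. short_exact Fun (\<iota>, \<pi>) \<longrightarrow> is_epi B (\<l> \<pi>)"
    unfolding exact_functor_def using B.short_exactD(6) by blast
next
  assume "\<forall>\<iota> \<pi>. short_exact Fun (\<iota>, \<pi>) \<longrightarrow> is_epi B (\<l> \<pi>)"
  then have "short_exact B (\<l> \<iota>, \<l> \<pi>)" if "short_exact Fun (\<iota>, \<pi>)" for \<iota> \<pi>
    using that B.short_exactI(2) Lim_kernel Fn.short_exactD(7) by blast
  then show "exact_functor Fun B (Lim S B)"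
    unfolding exact_functor_def using Lim_functor Lim_additive by blast
qed


section \<open>The comparison maps\<close>

text \<open>Transposition along the adjunction between constant diagrams and limits turns a morphism out of
  a constant sequence into a morphism into the left exact sequence of limits.\<close>

lemma emor_adjunct:
  assumes em: "emor Fun (\<rho> (Src Fun \<iota>)) \<phi> (Const_ses (i, q)) (\<iota>, \<pi>)"
    and ses: "short_exact B (i, q)" and i: "Src B i = \<L> (Src Fun \<iota>)"
    and u0: "u \<in> Arr B" "Src B u = Tgt B q" "Tgt B u = \<L> (Tgt Fun \<pi>)" "\<rho> (Tgt Fun \<pi>) \<cdot>\<^bsub>Fun\<^esub> \<k> u = \<phi>"
  obtains v where "v \<in> Arr B" "Src B v = Tgt B i" "Tgt B v = \<L> (Src Fun \<pi>)"
    "v \<cdot>\<^bsub>B\<^esub> i = \<l> \<iota>" "\<l> \<pi> \<cdot>\<^bsub>B\<^esub> v = u \<cdot>\<^bsub>B\<^esub> q"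
proof -
  define F where "F = Src Fun \<iota>"
  define G where "G = Src Fun \<pi>"
  define H where "H = Tgt Fun \<pi>"
  define A where "A = Tgt B i"
  define X where "X = Tgt B q"
  have "short_exact Fun (\<iota>, \<pi>)"
    using Fn.emor_shape(2)[OF em] .
  then have \<iota> [simp]: "\<pi> \<in> Arr Fun" "\<iota> \<in> Arr Fun" "Tgt Fun \<iota> = G" "Src Fun \<iota> = F" "Src Fun \<pi> = G" "Tgt Fun \<pi> = H"
    using Fn.short_exactD(1-3)[of \<iota> \<pi>] by (simp_all add: F_def G_def H_def)
  have [simp]: "F \<in> Obj Fun" "G \<in> Obj Fun" "H \<in> Obj Fun"
    using \<iota> Fn.Src_Obj Fn.Tgt_Obj by blast+
  have [simp]: "i \<in> Arr B" "q \<in> Arr B" "Src B i = \<L> F" "Tgt B i = A" "Src B q = A" "Tgt B q = X"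
    using B.short_exactD(1-3)[OF ses] i by (simp_all add: A_def X_def)
  have [simp]: "A \<in> Obj B" "X \<in> Obj B"
    using B.Tgt_Obj[of i A] B.Tgt_Obj[of q X] by simp_all
  have [simp]: "u \<in> Arr B" "Src B u = X" "Tgt B u = \<L> H" and \<rho>u: "\<rho> H \<cdot>\<^bsub>Fun\<^esub> \<k> u = \<phi>"
    using u0 by simp_all
  obtain a where a [simp]: "a \<in> Arr Fun" "Src Fun a = \<K> A" "Tgt Fun a = G"
    and ai: "a \<cdot>\<^bsub>Fun\<^esub> \<k> i = \<iota> \<cdot>\<^bsub>Fun\<^esub> \<rho> F" and \<pi>a: "\<pi> \<cdot>\<^bsub>Fun\<^esub> a = \<phi> \<cdot>\<^bsub>Fun\<^esub> \<k> q"
    using em by (auto simp: emor_def Const_ses_def)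
  \<comment> \<open>\<open>v\<close> is the transpose of the middle arrow \<open>a\<close>. Both
    required equations compare arrows into a limit and are tested after its universal cone.\<close>
  obtain v where v [simp]: "v \<in> Arr B" "Src B v = A" "Tgt B v = \<L> G" and \<rho>v: "\<rho> G \<cdot>\<^bsub>Fun\<^esub> \<k> v = a"
    by (rule lim_lift[of G A a]) simp_all
  have L\<iota>: "\<rho> G \<cdot>\<^bsub>Fun\<^esub> \<k> (\<l> \<iota>) = \<iota> \<cdot>\<^bsub>Fun\<^esub> \<rho> F" and L\<pi>: "\<rho> H \<cdot>\<^bsub>Fun\<^esub> \<k> (\<l> \<pi>) = \<pi> \<cdot>\<^bsub>Fun\<^esub> \<rho> G"
    using Lim_Arr(4)[of \<iota>] Lim_Arr(4)[of \<pi>] by simp_all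
  have "v \<cdot>\<^bsub>B\<^esub> i = \<l> \<iota>"
    by (rule lim_unique[of G]) (simp_all add: Const_functorial Fn.Comp_reassoc[OF \<rho>v] ai L\<iota>)
  moreover have "\<l> \<pi> \<cdot>\<^bsub>B\<^esub> v = u \<cdot>\<^bsub>B\<^esub> q"
    by (rule lim_unique[of H])
      (simp_all add: Const_functorial Fn.Comp_reassoc[OF L\<pi>] \<rho>v \<pi>a Fn.Comp_reassoc[OF \<rho>u])
  ultimately show thesis
    using that[of v] by simp
qed

lemma Phi_eq:
  "Phi S B F c = (\<Union>\<epsilon> \<in> c. \<Union>\<epsilon>' \<in> {\<epsilon>'. pushout_ext Fun (\<rho> F) (Const_ses \<epsilon>) \<epsilon>'}. ext_class Fun \<epsilon>')"
  unfolding Phi_def Const_ses_def by (simp add: case_prod_beta map_prod_def)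

text \<open>Equivalent sequences have equivalent constant sequences, and pushouts along
  \<open>\<rho> F\<close> are unique up to equivalence. So \<open>Phi\<close> is computed by any
  single morphism with left end \<open>\<rho> F\<close> and identity right end.\<close>

lemma Phi_class:
  assumes em: "emor Fun (\<rho> F) (Ident Fun (\<K> (Tgt B (snd \<epsilon>)))) (Const_ses \<epsilon>) \<eta>" and ses: "short_exact B \<epsilon>"
  shows "Phi S B F (ext_class B \<epsilon>) = ext_class Fun \<eta>"
proof -
  have "ext_class Fun \<delta>' = ext_class Fun \<eta>"
    if \<delta>: "\<delta> \<in> ext_class B \<epsilon>" and \<delta>': "pushout_ext Fun (\<rho> F) (Const_ses \<delta>) \<delta>'" for \<delta> \<delta>'
  proof -
    have r: "(\<epsilon>, \<delta>) \<in> ext_rel B"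
      using \<delta> by simp
    note [simp] = B.ext_rel_ends[OF r]
    have 1: "emor Fun (\<rho> F) (Ident Fun (\<K> (Tgt B (snd \<epsilon>)))) (Const_ses \<delta>) \<delta>'"
      using \<delta>' by (simp add: Fn.pushout_ext_iff)
    have "emor Fun (\<k> (Ident B (Src B (fst \<epsilon>)))) (\<k> (Ident B (Tgt B (snd \<epsilon>)))) (Const_ses \<epsilon>) (Const_ses \<delta>)"
      using r Const_emor unfolding B.ext_rel_iff by blast
    then have "(Const_ses \<epsilon>, Const_ses \<delta>) \<in> ext_rel Fun"
      by (simp add: Fn.ext_rel_iff Const_functorial)
    then have "emor Fun (\<rho> F) (Ident Fun (\<K> (Tgt B (snd \<epsilon>)))) (Const_ses \<epsilon>) \<delta>'"
      by (rule Fn.emor_ext_rel_source[OF 1])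
    then have "(\<eta>, \<delta>') \<in> ext_rel Fun"
      using Fn.emor_pushout_unique[of "\<rho> F" "Const_ses \<epsilon>" \<eta> \<delta>'] em by simp
    then show ?thesis
      by (rule Fn.ext_class_eqI[symmetric])
  qed
  moreover have "\<epsilon> \<in> ext_class B \<epsilon>" "pushout_ext Fun (\<rho> F) (Const_ses \<epsilon>) \<eta>"
    using B.ext_rel_refl[OF ses] em ses by (simp_all add: Fn.pushout_ext_iff)
  ultimately show ?thesis
    unfolding Phi_eq by blast
qed

lemma Phi_ex:
  assumes [simp]: "F \<in> Obj Fun" and ses: "short_exact B \<epsilon>" "Src B (fst \<epsilon>) = \<L> F"
  obtains \<eta> where "emor Fun (\<rho> F) (Ident Fun (\<K> (Tgt B (snd \<epsilon>)))) (Const_ses \<epsilon>) \<eta>"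
    "short_exact Fun \<eta>" "Src Fun (fst \<eta>) = F" "Tgt Fun (snd \<eta>) = \<K> (Tgt B (snd \<epsilon>))"
    "Phi S B F (ext_class B \<epsilon>) = ext_class Fun \<eta>"
proof -
  note [simp] = ses
  obtain \<eta> where "pushout_ext Fun (\<rho> F) (Const_ses \<epsilon>) \<eta>"
    by (rule Fn.ex_pushout_ext[of "Const_ses \<epsilon>" "\<rho> F"]) simp_all
  then have *: "emor Fun (\<rho> F) (Ident Fun (\<K> (Tgt B (snd \<epsilon>)))) (Const_ses \<epsilon>) \<eta>"
    by (simp add: Fn.pushout_ext_iff)
  show thesis
    using that[of \<eta>] * Fn.emor_shape[OF *] Phi_class[OF *] by simp
qed

text \<open>The constant sequence of a Baer sum is a Baer sum of constant sequences. The two pushout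
  morphisms have the same ends, so by \<open>baer_sum_emor\<close> they induce one to the sum of the
  images, and its ends identify that sum as the image of the sum.\<close>

lemma Phi_hom:
  assumes F [simp]: "F \<in> Obj Fun"
  shows "Phi S B F \<in> hom (Ext1 B X (\<L> F)) (Ext1 Fun (\<K> X) F)"
proof (rule homI)
  fix c
  assume "c \<in> carrier (Ext1 B X (\<L> F))"
  then obtain \<epsilon> where \<epsilon>: "short_exact B \<epsilon>" "Src B (fst \<epsilon>) = \<L> F" "Tgt B (snd \<epsilon>) = X" "c = ext_class B \<epsilon>"
    unfolding B.Ext1_carrier_iff by blast
  obtain \<eta> where "short_exact Fun \<eta>" "Src Fun (fst \<eta>) = F" "Tgt Fun (snd \<eta>) = \<K> X"
    "Phi S B F (ext_class B \<epsilon>) = ext_class Fun \<eta>"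
    using Phi_ex[OF F \<epsilon>(1,2)] \<epsilon>(3) by metis
  then show "Phi S B F c \<in> carrier (Ext1 Fun (\<K> X) F)"
    unfolding Fn.Ext1_carrier_iff \<epsilon>(4) by blast
next
  fix c d
  assume "c \<in> carrier (Ext1 B X (\<L> F))" "d \<in> carrier (Ext1 B X (\<L> F))"
  then obtain \<epsilon>\<^sub>1 \<epsilon>\<^sub>2 where \<epsilon>\<^sub>1: "short_exact B \<epsilon>\<^sub>1" "Src B (fst \<epsilon>\<^sub>1) = \<L> F" "Tgt B (snd \<epsilon>\<^sub>1) = X" "c = ext_class B \<epsilon>\<^sub>1"
    and \<epsilon>\<^sub>2: "short_exact B \<epsilon>\<^sub>2" "Src B (fst \<epsilon>\<^sub>2) = \<L> F" "Tgt B (snd \<epsilon>\<^sub>2) = X" "d = ext_class B \<epsilon>\<^sub>2"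
    unfolding B.Ext1_carrier_iff by metis
  note [simp] = \<epsilon>\<^sub>1(1-3) \<epsilon>\<^sub>2(1-3)
  obtain \<epsilon> where bs: "baer_sum B \<epsilon>\<^sub>1 \<epsilon>\<^sub>2 \<epsilon>" and [simp]: "short_exact B \<epsilon>" "Src B (fst \<epsilon>) = \<L> F" "Tgt B (snd \<epsilon>) = X"
    by (rule B.ex_baer_sum[of \<epsilon>\<^sub>1 \<epsilon>\<^sub>2]) simp_all
  obtain \<eta>\<^sub>1 where \<eta>\<^sub>1: "emor Fun (\<rho> F) (Ident Fun (\<K> X)) (Const_ses \<epsilon>\<^sub>1) \<eta>\<^sub>1"
    and [simp]: "short_exact Fun \<eta>\<^sub>1" "Src Fun (fst \<eta>\<^sub>1) = F" "Tgt Fun (snd \<eta>\<^sub>1) = \<K> X"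
    by (rule Phi_ex[OF F, of \<epsilon>\<^sub>1]) simp_all
  obtain \<eta>\<^sub>2 where \<eta>\<^sub>2: "emor Fun (\<rho> F) (Ident Fun (\<K> X)) (Const_ses \<epsilon>\<^sub>2) \<eta>\<^sub>2"
    and [simp]: "short_exact Fun \<eta>\<^sub>2" "Src Fun (fst \<eta>\<^sub>2) = F" "Tgt Fun (snd \<eta>\<^sub>2) = \<K> X"
    by (rule Phi_ex[OF F, of \<epsilon>\<^sub>2]) simp_all
  obtain \<eta> where bs': "baer_sum Fun \<eta>\<^sub>1 \<eta>\<^sub>2 \<eta>"
    by (rule Fn.ex_baer_sum[of \<eta>\<^sub>1 \<eta>\<^sub>2]) simp_all
  have "emor Fun (\<rho> F) (Ident Fun (\<K> X)) (Const_ses \<epsilon>) \<eta>"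
    by (rule Fn.baer_sum_emor[OF Const_baer_sum[OF bs] bs' \<eta>\<^sub>1 \<eta>\<^sub>2]) simp_all
  then have "Phi S B F (ext_class B \<epsilon>) = ext_class Fun \<eta>"
    by (intro Phi_class) simp_all
  moreover have "ext_class B \<epsilon> = c \<otimes>\<^bsub>Ext1 B X (\<L> F)\<^esub> d"
    unfolding \<epsilon>\<^sub>1(4) \<epsilon>\<^sub>2(4) by (rule B.Ext1_mult_class[OF bs, symmetric]) simp_all
  moreover have "ext_class Fun \<eta> = Phi S B F c \<otimes>\<^bsub>Ext1 Fun (\<K> X) F\<^esub> Phi S B F d"
  proof -
    have "Phi S B F c = ext_class Fun \<eta>\<^sub>1" "Phi S B F d = ext_class Fun \<eta>\<^sub>2"
      unfolding \<epsilon>\<^sub>1(4) \<epsilon>\<^sub>2(4) using \<eta>\<^sub>1 \<eta>\<^sub>2 by (auto intro!: Phi_class)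
    then show ?thesis
      using Fn.Ext1_mult_class[OF bs', of "\<K> X" F] by simp
  qed
  ultimately show "Phi S B F (c \<otimes>\<^bsub>Ext1 B X (\<L> F)\<^esub> d) = Phi S B F c \<otimes>\<^bsub>Ext1 Fun (\<K> X) F\<^esub> Phi S B F d"
    by simp
qed

text \<open>Applying \<open>Const\<close> to the pullback morphism and continuing to
  \<open>\<eta>\<close> gives a morphism with left end \<open>\<rho> F\<close>. Cancelling the
  pushout of \<open>Const_ses \<epsilon>'\<close> leaves one from \<open>\<eta>'\<close> to
  \<open>\<eta>\<close> with identity left end, that is, a pullback along \<open>\<k> g\<close>. The
  first claim allows naturality in the other variable to be applied afterwards.\<close>

lemma Phi_natural_left:
  assumes F [simp]: "F \<in> Obj Fun" and g [simp]: "g \<in> Arr B" and c: "c \<in> carrier (Ext1 B (Tgt B g) (\<L> F))"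
  shows "ext_pull B g c \<in> carrier (Ext1 B (Src B g) (\<L> F))"
    and "Phi S B F (ext_pull B g c) = ext_pull Fun (\<k> g) (Phi S B F c)"
proof -
  obtain \<epsilon> where [simp]: "short_exact B \<epsilon>" "Src B (fst \<epsilon>) = \<L> F" "Tgt B (snd \<epsilon>) = Tgt B g" and c: "c = ext_class B \<epsilon>"
    using c unfolding B.Ext1_carrier_iff by blast
  obtain \<epsilon>' where "pullback_ext B g \<epsilon> \<epsilon>'"
    by (rule B.ex_pullback_ext[of \<epsilon> g]) simp_all
  then have \<epsilon>': "emor B (Ident B (\<L> F)) g \<epsilon>' \<epsilon>"
    by (simp add: B.pullback_ext_iff)
  have [simp]: "short_exact B \<epsilon>'" "Src B (fst \<epsilon>') = \<L> F" "Tgt B (snd \<epsilon>') = Src B g"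
    using B.emor_shape[OF \<epsilon>'] by simp_all
  have pull: "ext_pull B g c = ext_class B \<epsilon>'"
    unfolding c using \<epsilon>' by (intro B.ext_pull_class) simp
  show "ext_pull B g c \<in> carrier (Ext1 B (Src B g) (\<L> F))"
    unfolding B.Ext1_carrier_iff pull by (intro exI[of _ \<epsilon>']) simp
  obtain \<eta> where \<eta>: "emor Fun (\<rho> F) (Ident Fun (\<K> (Tgt B g))) (Const_ses \<epsilon>) \<eta>"
    and [simp]: "short_exact Fun \<eta>" "Src Fun (fst \<eta>) = F" "Phi S B F c = ext_class Fun \<eta>"
    unfolding c by (rule Phi_ex[OF F, of \<epsilon>]) simp_all
  obtain \<eta>' where \<eta>': "emor Fun (\<rho> F) (Ident Fun (\<K> (Src B g))) (Const_ses \<epsilon>') \<eta>'"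
    and [simp]: "Src Fun (fst \<eta>') = F" "Phi S B F (ext_class B \<epsilon>') = ext_class Fun \<eta>'"
    by (rule Phi_ex[OF F, of \<epsilon>']) simp_all
  have "emor Fun (\<k> (Ident B (\<L> F))) (\<k> g) (Const_ses \<epsilon>') (Const_ses \<epsilon>)"
    using \<epsilon>' by (rule Const_emor)
  from Fn.emor_trans[OF this \<eta>] have "emor Fun (Ident Fun F \<cdot>\<^bsub>Fun\<^esub> \<rho> F) (\<k> g) (Const_ses \<epsilon>') \<eta>"
    by (simp add: Const_functorial)
  then have "emor Fun (Ident Fun F) (\<k> g) \<eta>' \<eta>"
    by (rule Fn.emor_pushout_cancel) (use \<eta>' in simp_all)
  then show "Phi S B F (ext_pull B g c) = ext_pull Fun (\<k> g) (Phi S B F c)"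
    using Fn.ext_pull_class[of \<eta> "\<k> g" \<eta>'] by (simp add: pull)
qed

text \<open>The defining equation of \<open>\<l> \<tau>\<close> rewrites the left end
  \<open>\<rho> G \<cdot> \<k> (\<l> \<tau>)\<close> as \<open>\<tau> \<cdot> \<rho> F\<close>.
  Cancelling the pushout along \<open>\<rho> F\<close> leaves a morphism from \<open>\<eta>\<close>
  to \<open>\<eta>'\<close> with left end \<open>\<tau>\<close> and identity right end, that is, a
  pushout along \<open>\<tau>\<close>.\<close>

lemma Phi_natural_right:
  assumes \<tau> [simp]: "\<tau> \<in> Arr Fun" and X: "c \<in> carrier (Ext1 B X (\<L> (Src Fun \<tau>)))"
  shows "Phi S B (Tgt Fun \<tau>) (ext_push B (\<l> \<tau>) c) = ext_push Fun \<tau> (Phi S B (Src Fun \<tau>) c)"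
proof -
  define F where "F = Src Fun \<tau>"
  define G where "G = Tgt Fun \<tau>"
  have [simp]: "Src Fun \<tau> = F" "Tgt Fun \<tau> = G"
    by (simp_all add: F_def G_def)
  have F [simp]: "F \<in> Obj Fun" and G [simp]: "G \<in> Obj Fun"
    using Fn.Src_Obj'[OF \<tau>] Fn.Tgt_Obj'[OF \<tau>] by simp_all
  obtain \<epsilon> where [simp]: "short_exact B \<epsilon>" "Src B (fst \<epsilon>) = \<L> F" "Tgt B (snd \<epsilon>) = X" and c: "c = ext_class B \<epsilon>"
    using X unfolding B.Ext1_carrier_iff by auto
  have [simp]: "X \<in> Obj B"
    using B.Tgt_Obj[of "snd \<epsilon>" X] by simp
  obtain \<epsilon>' where "pushout_ext B (\<l> \<tau>) \<epsilon> \<epsilon>'"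
    by (rule B.ex_pushout_ext[of \<epsilon> "\<l> \<tau>"]) simp_all
  then have \<epsilon>': "emor B (\<l> \<tau>) (Ident B X) \<epsilon> \<epsilon>'"
    by (simp add: B.pushout_ext_iff)
  have [simp]: "short_exact B \<epsilon>'" "Src B (fst \<epsilon>') = \<L> G" "Tgt B (snd \<epsilon>') = X"
    using B.emor_shape[OF \<epsilon>'] by simp_all
  have push: "ext_push B (\<l> \<tau>) c = ext_class B \<epsilon>'"
    unfolding c using \<epsilon>' by (intro B.ext_push_class) simp
  obtain \<eta> where \<eta>: "emor Fun (\<rho> F) (Ident Fun (\<K> X)) (Const_ses \<epsilon>) \<eta>"
    and [simp]: "Tgt Fun (snd \<eta>) = \<K> X" "Phi S B F c = ext_class Fun \<eta>"
    unfolding c by (rule Phi_ex[OF F, of \<epsilon>]) simp_all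
  obtain \<eta>' where \<eta>': "emor Fun (\<rho> G) (Ident Fun (\<K> X)) (Const_ses \<epsilon>') \<eta>'"
    and [simp]: "Src Fun (fst \<eta>') = G" "Phi S B G (ext_class B \<epsilon>') = ext_class Fun \<eta>'"
    by (rule Phi_ex[OF G, of \<epsilon>']) simp_all
  have "emor Fun (\<k> (\<l> \<tau>)) (\<k> (Ident B X)) (Const_ses \<epsilon>) (Const_ses \<epsilon>')"
    using \<epsilon>' by (rule Const_emor)
  from Fn.emor_trans[OF this \<eta>'] have "emor Fun (\<tau> \<cdot>\<^bsub>Fun\<^esub> \<rho> F) (Ident Fun (\<K> X)) (Const_ses \<epsilon>) \<eta>'"
    using Lim_Arr(4)[OF \<tau>] by (simp add: Const_functorial)
  then have "emor Fun \<tau> (Ident Fun (\<K> X)) \<eta> \<eta>'"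
    by (rule Fn.emor_pushout_cancel) (use \<eta> in simp_all)
  then show ?thesis
    using Fn.ext_push_class[of \<tau> \<eta> \<eta>'] by (simp add: push)
qed

section \<open>Injectivity and surjectivity of the comparison maps\<close>

lemma Phi_inj:
  assumes F [simp]: "F \<in> Obj Fun"
  shows "inj_on (Phi S B F) (carrier (Ext1 B X (\<L> F)))"
proof (rule inj_onI)
  fix c d
  assume "c \<in> carrier (Ext1 B X (\<L> F))" "d \<in> carrier (Ext1 B X (\<L> F))" and eq: "Phi S B F c = Phi S B F d"
  then obtain i\<^sub>1 q\<^sub>1 i\<^sub>2 q\<^sub>2 where \<epsilon>\<^sub>1: "short_exact B (i\<^sub>1, q\<^sub>1)" "Src B i\<^sub>1 = \<L> F" "Tgt B q\<^sub>1 = X" "c = ext_class B (i\<^sub>1, q\<^sub>1)"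
    and \<epsilon>\<^sub>2: "short_exact B (i\<^sub>2, q\<^sub>2)" "Src B i\<^sub>2 = \<L> F" "Tgt B q\<^sub>2 = X" "d = ext_class B (i\<^sub>2, q\<^sub>2)"
    unfolding B.Ext1_carrier_iff by (metis prod.collapse)
  note [simp] = B.short_exactD(1-3)[OF \<epsilon>\<^sub>1(1)] B.short_exactD(1-3)[OF \<epsilon>\<^sub>2(1)] \<epsilon>\<^sub>1(2,3) \<epsilon>\<^sub>2(2,3)
  have X [simp]: "X \<in> Obj B"
    using B.Tgt_Obj[of q\<^sub>1 X] by simp
  obtain \<eta>\<^sub>1 where \<eta>\<^sub>1: "emor Fun (\<rho> F) (Ident Fun (\<K> X)) (Const_ses (i\<^sub>1, q\<^sub>1)) \<eta>\<^sub>1"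
    "short_exact Fun \<eta>\<^sub>1" "Src Fun (fst \<eta>\<^sub>1) = F" "Tgt Fun (snd \<eta>\<^sub>1) = \<K> X" "Phi S B F c = ext_class Fun \<eta>\<^sub>1"
    unfolding \<epsilon>\<^sub>1(4) by (rule Phi_ex[OF F \<epsilon>\<^sub>1(1)]) simp_all
  obtain \<eta>\<^sub>2 where \<eta>\<^sub>2: "emor Fun (\<rho> F) (Ident Fun (\<K> X)) (Const_ses (i\<^sub>2, q\<^sub>2)) \<eta>\<^sub>2"
    "short_exact Fun \<eta>\<^sub>2" "Src Fun (fst \<eta>\<^sub>2) = F" "Tgt Fun (snd \<eta>\<^sub>2) = \<K> X" "Phi S B F d = ext_class Fun \<eta>\<^sub>2"
    unfolding \<epsilon>\<^sub>2(4) by (rule Phi_ex[OF F \<epsilon>\<^sub>2(1)]) simp_all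
  have "(\<eta>\<^sub>2, \<eta>\<^sub>1) \<in> ext_rel Fun"
    using eq \<eta>\<^sub>1(2,5) \<eta>\<^sub>2(5) by (intro Fn.ext_class_eqD) simp_all
  \<comment> \<open>Since the images agree as classes, \<open>\<eta>\<^sub>1\<close> is a pushout of
    both constant sequences.\<close>
  then have \<eta>\<^sub>2': "emor Fun (\<rho> F) (Ident Fun (\<K> X)) (Const_ses (i\<^sub>2, q\<^sub>2)) \<eta>\<^sub>1"
    by (rule Fn.emor_ext_rel_target[OF \<eta>\<^sub>2(1)])
  obtain \<iota> \<pi> where \<iota>: "\<eta>\<^sub>1 = (\<iota>, \<pi>)"
    by (cases \<eta>\<^sub>1)
  have [simp]: "Src Fun \<iota> = F" "Tgt Fun \<pi> = \<K> X"
    using \<eta>\<^sub>1(3,4) by (simp_all add: \<iota>)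
  note \<iota>\<pi> = \<eta>\<^sub>1(2)[unfolded \<iota>]
  note [simp] = Fn.short_exactD(1-3)[OF \<iota>\<pi>]
  \<comment> \<open>The unit of the adjunction at \<open>X\<close>, obtained by lifting the identity
    of \<open>\<K> X\<close>.\<close>
  obtain u where u [simp]: "u \<in> Arr B" "Src B u = X" "Tgt B u = \<L> (\<K> X)" and \<rho>u: "\<rho> (\<K> X) \<cdot>\<^bsub>Fun\<^esub> \<k> u = Ident Fun (\<K> X)"
    by (rule lim_lift[of "\<K> X" X "Ident Fun (\<K> X)"]) simp_all
  obtain v\<^sub>1 where v\<^sub>1: "v\<^sub>1 \<in> Arr B" "Src B v\<^sub>1 = Tgt B i\<^sub>1" "Tgt B v\<^sub>1 = \<L> (Src Fun \<pi>)"
    "v\<^sub>1 \<cdot>\<^bsub>B\<^esub> i\<^sub>1 = \<l> \<iota>" "\<l> \<pi> \<cdot>\<^bsub>B\<^esub> v\<^sub>1 = u \<cdot>\<^bsub>B\<^esub> q\<^sub>1"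
    by (rule emor_adjunct[of \<iota> "Ident Fun (\<K> X)" i\<^sub>1 q\<^sub>1 \<pi> u]) (use \<eta>\<^sub>1(1) \<epsilon>\<^sub>1(1) \<rho>u in \<open>simp_all add: \<iota>\<close>)
  obtain v\<^sub>2 where v\<^sub>2: "v\<^sub>2 \<in> Arr B" "Src B v\<^sub>2 = Tgt B i\<^sub>2" "Tgt B v\<^sub>2 = \<L> (Src Fun \<pi>)"
    "v\<^sub>2 \<cdot>\<^bsub>B\<^esub> i\<^sub>2 = \<l> \<iota>" "\<l> \<pi> \<cdot>\<^bsub>B\<^esub> v\<^sub>2 = u \<cdot>\<^bsub>B\<^esub> q\<^sub>2"
    by (rule emor_adjunct[of \<iota> "Ident Fun (\<K> X)" i\<^sub>2 q\<^sub>2 \<pi> u]) (use \<eta>\<^sub>2' \<epsilon>\<^sub>2(1) \<rho>u in \<open>simp_all add: \<iota>\<close>)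
  have "((i\<^sub>1, q\<^sub>1), (i\<^sub>2, q\<^sub>2)) \<in> ext_rel B"
    by (rule B.ext_rel_of_common_kernel[OF Lim_kernel[OF Fn.short_exactD(7)[OF \<iota>\<pi>]], of u i\<^sub>1 q\<^sub>1 i\<^sub>2 q\<^sub>2 v\<^sub>1 v\<^sub>2])
      (use v\<^sub>1 v\<^sub>2 \<epsilon>\<^sub>1(1) \<epsilon>\<^sub>2(1) in simp_all)
  then show "c = d"
    unfolding \<epsilon>\<^sub>1(4) \<epsilon>\<^sub>2(4) by (rule B.ext_class_eqI)
qed

lemma exact_imp_Phi_surj:
  assumes exact: "exact_functor Fun B (Lim S B)" and F: "F \<in> Obj Fun" and X [simp]: "X \<in> Obj B"
  shows "carrier (Ext1 Fun (\<K> X) F) \<subseteq> Phi S B F ` carrier (Ext1 B X (\<L> F))"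
proof
  fix d
  assume "d \<in> carrier (Ext1 Fun (\<K> X) F)"
  then obtain \<iota> \<pi> where \<iota>\<pi>: "short_exact Fun (\<iota>, \<pi>)" and [simp]: "Src Fun \<iota> = F" "Tgt Fun \<pi> = \<K> X"
    and d: "d = ext_class Fun (\<iota>, \<pi>)"
    unfolding Fn.Ext1_carrier_iff by (metis prod.collapse)
  define G where "G = Tgt Fun \<iota>"
  have \<iota> [simp]: "\<iota> \<in> Arr Fun" "\<pi> \<in> Arr Fun" "Tgt Fun \<iota> = G" "Src Fun \<pi> = G"
    using Fn.short_exactD(1-3)[OF \<iota>\<pi>] by (simp_all add: G_def)
  have [simp]: "F \<in> Obj Fun" "G \<in> Obj Fun"
    using Fn.Src_Obj[of \<iota> F] Fn.Src_Obj[of \<pi> G] by simp_all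
  have L: "short_exact B (\<l> \<iota>, \<l> \<pi>)"
    using exact \<iota>\<pi> unfolding exact_functor_def by blast
  obtain u where u [simp]: "u \<in> Arr B" "Src B u = X" "Tgt B u = \<L> (\<K> X)" and \<rho>u: "\<rho> (\<K> X) \<cdot>\<^bsub>Fun\<^esub> \<k> u = Ident Fun (\<K> X)"
    by (rule lim_lift[of "\<K> X" X "Ident Fun (\<K> X)"]) simp_all
  obtain \<epsilon> where "pullback_ext B u (\<l> \<iota>, \<l> \<pi>) \<epsilon>"
    by (rule B.ex_pullback_ext[OF L, of u]) simp_all
  then have \<epsilon>: "emor B (Ident B (\<L> F)) u \<epsilon> (\<l> \<iota>, \<l> \<pi>)"
    by (simp add: B.pullback_ext_iff)
  have [simp]: "short_exact B \<epsilon>" "Src B (fst \<epsilon>) = \<L> F" "Tgt B (snd \<epsilon>) = X"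
    using B.emor_shape[OF \<epsilon>] by simp_all
  \<comment> \<open>The universal cones form a morphism of sequences by the defining equations of
    \<open>\<l> \<iota>\<close> and \<open>\<l> \<pi>\<close>. Exactness of limits is what makes its
    source short exact.\<close>
  have "emor Fun (\<rho> F) (\<rho> (\<K> X)) (Const_ses (\<l> \<iota>, \<l> \<pi>)) (\<iota>, \<pi>)"
    using Const_short_exact[OF L] \<iota>\<pi> Lim_Arr(4)[of \<iota>] Lim_Arr(4)[of \<pi>]
    unfolding emor_def Const_ses_def map_prod_def prod.case
    by (intro conjI bexI[of _ "\<rho> G"]) simp_all
  \<comment> \<open>The right end \<open>\<rho> (\<K> X) \<cdot> \<k> u\<close> is the identity by
    the choice of \<open>u\<close>, so the given sequence is a pushout of
    \<open>Const_ses \<epsilon>\<close> along \<open>\<rho> F\<close>.\<close>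
  from Fn.emor_trans[OF Const_emor[OF \<epsilon>] this]
  have "emor Fun (\<rho> F) (Ident Fun (\<K> X)) (Const_ses \<epsilon>) (\<iota>, \<pi>)"
    by (simp add: Const_functorial \<rho>u)
  then have "Phi S B F (ext_class B \<epsilon>) = d"
    unfolding d by (intro Phi_class) simp_all
  moreover have "ext_class B \<epsilon> \<in> carrier (Ext1 B X (\<L> F))"
    unfolding B.Ext1_carrier_iff by (intro exI[of _ \<epsilon>]) simp
  ultimately show "d \<in> Phi S B F ` carrier (Ext1 B X (\<L> F))"
    by blast
qed

lemma Phi_surj_imp_exact:
  assumes surj: "\<And>X F. X \<in> Obj B \<Longrightarrow> F \<in> Obj Fun \<Longrightarrow>
    carrier (Ext1 Fun (\<K> X) F) \<subseteq> Phi S B F ` carrier (Ext1 B X (\<L> F))"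
  shows "exact_functor Fun B (Lim S B)"
  unfolding exact_Lim_iff
proof (intro allI impI)
  fix \<iota> \<pi>
  assume \<iota>\<pi>: "short_exact Fun (\<iota>, \<pi>)"
  define F where "F = Src Fun \<iota>"
  define G where "G = Tgt Fun \<iota>"
  define H where "H = Tgt Fun \<pi>"
  have \<iota> [simp]: "\<iota> \<in> Arr Fun" "\<pi> \<in> Arr Fun" "Src Fun \<iota> = F" "Tgt Fun \<iota> = G" "Src Fun \<pi> = G" "Tgt Fun \<pi> = H"
    using Fn.short_exactD(1-3)[OF \<iota>\<pi>] by (simp_all add: F_def G_def H_def)
  have [simp]: "F \<in> Obj Fun" "G \<in> Obj Fun" "H \<in> Obj Fun"
    using Fn.Src_Obj[of \<iota> F] Fn.Src_Obj[of \<pi> G] Fn.Tgt_Obj[of \<pi> H] by simp_all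
  obtain \<eta> where "pullback_ext Fun (\<rho> H) (\<iota>, \<pi>) \<eta>"
    by (rule Fn.ex_pullback_ext[OF \<iota>\<pi>, of "\<rho> H"]) simp_all
  then have \<eta>: "emor Fun (Ident Fun F) (\<rho> H) \<eta> (\<iota>, \<pi>)"
    by (simp add: Fn.pullback_ext_iff)
  have \<eta>' [simp]: "short_exact Fun \<eta>" "Src Fun (fst \<eta>) = F" "Tgt Fun (snd \<eta>) = \<K> (\<L> H)"
    using Fn.emor_shape[OF \<eta>] by simp_all
  then have "ext_class Fun \<eta> \<in> carrier (Ext1 Fun (\<K> (\<L> H)) F)"
    unfolding Fn.Ext1_carrier_iff by blast
  \<comment> \<open>Surjectivity is applied at the objects \<open>\<L> H\<close> and
    \<open>F\<close>; the pullback along \<open>\<rho> H\<close> has made the right end constant, as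
    \<open>Phi\<close> requires.\<close>
  then have "ext_class Fun \<eta> \<in> Phi S B F ` carrier (Ext1 B (\<L> H) (\<L> F))"
    using surj[of "\<L> H" F] by auto
  then obtain c where "c \<in> carrier (Ext1 B (\<L> H) (\<L> F))" and c: "ext_class Fun \<eta> = Phi S B F c"
    by blast
  then obtain \<epsilon> where \<epsilon>: "short_exact B \<epsilon>" "Src B (fst \<epsilon>) = \<L> F" "Tgt B (snd \<epsilon>) = \<L> H" "c = ext_class B \<epsilon>"
    unfolding B.Ext1_carrier_iff by blast
  obtain i q where iq': "\<epsilon> = (i, q)"
    by (cases \<epsilon>)
  have iq: "short_exact B (i, q)" and [simp]: "Src B i = \<L> F" "Tgt B q = \<L> H"
    and Phi: "ext_class Fun \<eta> = Phi S B F (ext_class B (i, q))"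
    using \<epsilon> c by (simp_all add: iq')
  note [simp] = B.short_exactD(1-3)[OF iq]
  obtain \<delta> where \<delta>: "emor Fun (\<rho> F) (Ident Fun (\<K> (\<L> H))) (Const_ses (i, q)) \<delta>"
    and "ext_class Fun \<delta> = ext_class Fun \<eta>"
    unfolding Phi by (rule Phi_ex[of F, OF _ iq]) simp_all
  then have "(\<delta>, \<eta>) \<in> ext_rel Fun"
    by (intro Fn.ext_class_eqD) simp_all
  \<comment> \<open>Equality of classes lets \<open>\<eta>\<close> replace \<open>\<delta>\<close>
    as target. The pushout morphism followed by the pullback morphism then leads from a constant
    sequence to the given one.\<close>
  from Fn.emor_trans[OF Fn.emor_ext_rel_target[OF \<delta> this] \<eta>]
  have em: "emor Fun (\<rho> F) (\<rho> H) (Const_ses (i, q)) (\<iota>, \<pi>)"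
    by simp
  \<comment> \<open>The transpose of \<open>\<rho> H\<close> is the identity of
    \<open>\<L> H\<close>, so transposition gives \<open>\<l> \<pi> \<cdot> v = q\<close>, and
    \<open>q\<close> is epi.\<close>
  obtain v where v: "v \<in> Arr B" "Src B v = Tgt B i" "Tgt B v = \<L> G" "\<l> \<pi> \<cdot>\<^bsub>B\<^esub> v = Ident B (\<L> H) \<cdot>\<^bsub>B\<^esub> q"
    by (rule emor_adjunct[of \<iota> "\<rho> H" i q \<pi> "Ident B (\<L> H)"]) (use em iq in \<open>simp_all add: Const_functorial\<close>)
  show "is_epi B (\<l> \<pi>)"
    by (rule B.epi_of_comp[of _ v]) (use v B.short_exactD(6)[OF iq] in simp_all)
qed

text \<open>\<open>iso\<close> asks for a bijective homomorphism. Additivity and injectivity are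
  already available, so the equivalence rests on surjectivity in each direction.\<close>

lemma exact_iff_Phi_iso:
  "exact_functor Fun B (Lim S B) \<longleftrightarrow>
    (\<forall>X \<in> Obj B. \<forall>F \<in> Obj Fun. Phi S B F \<in> iso (Ext1 B X (\<L> F)) (Ext1 Fun (\<K> X) F))"
proof
  assume exact: "exact_functor Fun B (Lim S B)"
  show "\<forall>X \<in> Obj B. \<forall>F \<in> Obj Fun. Phi S B F \<in> iso (Ext1 B X (\<L> F)) (Ext1 Fun (\<K> X) F)"
  proof (intro ballI)
    fix X F
    assume XF: "X \<in> Obj B" "F \<in> Obj Fun"
    have "Phi S B F ` carrier (Ext1 B X (\<L> F)) = carrier (Ext1 Fun (\<K> X) F)"
      using Phi_hom[OF XF(2), of X] exact_imp_Phi_surj[OF exact XF(2,1)] by (auto simp: hom_def)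
    then show "Phi S B F \<in> iso (Ext1 B X (\<L> F)) (Ext1 Fun (\<K> X) F)"
      using Phi_hom[OF XF(2), of X] Phi_inj[OF XF(2), of X] by (simp add: iso_def bij_betw_def)
  qed
next
  assume "\<forall>X \<in> Obj B. \<forall>F \<in> Obj Fun. Phi S B F \<in> iso (Ext1 B X (\<L> F)) (Ext1 Fun (\<K> X) F)"
  then show "exact_functor Fun B (Lim S B)"
    by (intro Phi_surj_imp_exact) (auto simp: iso_def bij_betw_def)
qed

end

section \<open>Exactness of limits and the comparison isomorphisms\<close>

theorem corollary7:
  fixes S :: "('s, 't) category"
    and B :: "('o, 'a) ab_category"
  assumes "category S"
    and "abelian_category B"
    and "complete_for S B"
  defines "Fn \<equiv> FunCat S B"
    and "\<kappa> \<equiv> Const S B"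
    and "L \<equiv> Lim S B"
  shows "(exact_functor Fn B L
      \<longleftrightarrow>
        (\<forall>F \<in> Obj Fn. nat_group_iso (Op B)
           (\<lambda>X. Ext1 B X (omap L F)) (\<lambda>g. ext_pull B g)
           (\<lambda>X. Ext1 Fn (omap \<kappa> X) F) (\<lambda>g. ext_pull Fn (amap \<kappa> g))
           (\<lambda>X. Phi S B F))
      \<and> (\<forall>X \<in> Obj B. nat_group_iso Fn
           (\<lambda>F. Ext1 B X (omap L F)) (\<lambda>\<eta>. ext_push B (amap L \<eta>))
           (\<lambda>F. Ext1 Fn (omap \<kappa> X) F) (\<lambda>\<eta>. ext_push Fn \<eta>)
           (\<lambda>F. Phi S B F)))
    \<and> (exact_functor Fn B L
      \<longleftrightarrow> nat_group_iso (ProdCat (Op B) Fn)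
           (\<lambda>(X, F). Ext1 B X (omap L F)) (\<lambda>(g, \<eta>). ext_map B g (amap L \<eta>))
           (\<lambda>(X, F). Ext1 Fn (omap \<kappa> X) F) (\<lambda>(g, \<eta>). ext_map Fn (amap \<kappa> g) \<eta>)
           (\<lambda>(X, F). Phi S B F))"
proof -
  interpret complete_functor_category S B
    using assms(1-3)
    by (intro complete_functor_category.intro functor_category.intro complete_functor_category_axioms.intro)
  \<comment> \<open>The naturality squares always commute, so each predicate reduces to its
    isomorphism clause. Over \<open>Op B\<close> an arrow \<open>g\<close> runs from its target to
    its source, as pullback along \<open>g\<close> does.\<close>
  have left: "nat_group_iso (Op B) (\<lambda>X. Ext1 B X (\<L> F)) (\<lambda>g. ext_pull B g)
      (\<lambda>X. Ext1 Fun (\<K> X) F) (\<lambda>g. ext_pull Fun (\<k> g)) (\<lambda>X. Phi S B F) \<longleftrightarrow>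
    (\<forall>X \<in> Obj B. Phi S B F \<in> iso (Ext1 B X (\<L> F)) (Ext1 Fun (\<K> X) F))" if "F \<in> Obj Fun" for F
    using Phi_natural_left(2)[OF that] by (auto simp: nat_group_iso_def)
  have right: "nat_group_iso Fun (\<lambda>F. Ext1 B X (\<L> F)) (\<lambda>\<eta>. ext_push B (\<l> \<eta>))
      (\<lambda>F. Ext1 Fun (\<K> X) F) (\<lambda>\<eta>. ext_push Fun \<eta>) (\<lambda>F. Phi S B F) \<longleftrightarrow>
    (\<forall>F \<in> Obj Fun. Phi S B F \<in> iso (Ext1 B X (\<L> F)) (Ext1 Fun (\<K> X) F))" for X
    using Phi_natural_right by (auto simp: nat_group_iso_def)
  \<comment> \<open>\<open>ext_map\<close> first pulls back and then pushes out. The pulled back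
    class lies in the right group, so the squares for the two variables can be pasted.\<close>
  have natural: "Phi S B (Tgt Fun \<eta>) (ext_map B g (\<l> \<eta>) c) = ext_map Fun (\<k> g) \<eta> (Phi S B (Src Fun \<eta>) c)"
    if "g \<in> Arr B" "\<eta> \<in> Arr Fun" "c \<in> carrier (Ext1 B (Tgt B g) (\<L> (Src Fun \<eta>)))" for g \<eta> c
    using Phi_natural_left[of "Src Fun \<eta>" g c] Phi_natural_right[of \<eta> "ext_pull B g c" "Src B g"] that
    by (simp add: ext_map_def)
  have both: "nat_group_iso (ProdCat (Op B) Fun)
      (\<lambda>(X, F). Ext1 B X (\<L> F)) (\<lambda>(g, \<eta>). ext_map B g (\<l> \<eta>))
      (\<lambda>(X, F). Ext1 Fun (\<K> X) F) (\<lambda>(g, \<eta>). ext_map Fun (\<k> g) \<eta>) (\<lambda>(X, F). Phi S B F) \<longleftrightarrow>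
    (\<forall>X \<in> Obj B. \<forall>F \<in> Obj Fun. Phi S B F \<in> iso (Ext1 B X (\<L> F)) (Ext1 Fun (\<K> X) F))"
    using natural by (auto simp: nat_group_iso_def ProdCat_def)
  show ?thesis
    \<comment> \<open>Every condition has become the statement that all \<open>Phi S B F\<close> are
      isomorphisms. The equivalence \<open>left\<close> is conditional on
      \<open>F \<in> Obj Fun\<close> and is therefore supplied as a fact, while the others
      rewrite.\<close>
    unfolding Fn_def \<kappa>_def L_def both right exact_iff_Phi_iso using left by blast
qed

end
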